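(* Let $\mathbf{C}^-:=\inf_{F\in\mathcal{H}_{\pi\Delta},F\ne0}\|F\|_{L^2(\mathbb{R},W)}/\|F\|_{L^2(\mathbb{R})}$ and $\mathbf{C}^+:=\sup_{F\in\mathcal{H}_{\pi\Delta},F\ne0}\|F\|_{L^2(\mathbb{R},W)}/\|F\|_{L^2(\mathbb{R})}$, where $W(x)=1-\frac{\sin 2\pi x}{2\pi x}+\boldsymbol{\delta}_0(x)$. (i) For $0<\Delta\le1$: $\mathbf{C}^-=1$ and $\mathbf{C}^+=\sqrt{1+\frac{\Delta}{2}}$. (ii) For $1<\Delta\le2$, let $\eta^+$ and $\eta^-$ be the largest and the smallest real solutions $\eta$ of \[ \left(\tfrac{3}{2}-\tfrac{2-\Delta}{4\eta}\right)\cos\left(\tfrac{\Delta-1}{2\eta}\right)-\sin\left(\tfrac{\Delta-1}{2\eta}\right) = 1. \] Then $\mathbf{C}^-=\sqrt{1+\eta^-}$ and $\mathbf{C}^+=\sqrt{1+\eta^+}$.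
   Context: $\mathcal{H}_{\pi\Delta}$ is the space of entire functions of exponential type at most $\pi\Delta$ that are square-integrable on $\mathbb{R}$. $\boldsymbol{\delta}_0$ is the Dirac delta at $0$, so $\|F\|^2_{L^2(\mathbb{R},W)}=\int_{\mathbb{R}}|F(x)|^2\big(1-\frac{\sin 2\pi x}{2\pi x}\big)dx+|F(0)|^2$. *)

theory Defs
  imports "HOL-Analysis.Analysis"
begin

definition exp_type_le :: "(complex \<Rightarrow> complex) \<Rightarrow> real \<Rightarrow> bool" where
  "exp_type_le F \<tau> \<longleftrightarrow>
     (\<forall>\<epsilon>>0. \<exists>C. \<forall>z. norm (F z) \<le> C * exp ((\<tau> + \<epsilon>) * norm z))"

definition PW :: "real \<Rightarrow> (complex \<Rightarrow> complex) set" where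
  "PW \<tau> = {F. F holomorphic_on UNIV \<and> exp_type_le F \<tau> \<and>
              integrable lborel (\<lambda>x::real. (norm (F (of_real x)))\<^sup>2)}"

definition L2_sq :: "(complex \<Rightarrow> complex) \<Rightarrow> real" where
  "L2_sq F = integral\<^sup>L lborel (\<lambda>x::real. (norm (F (of_real x)))\<^sup>2)"

text \<open>Squared weighted norm with W(x) = 1 - sin(2 pi x)/(2 pi x) + delta_0.\<close>
definition LW_sq :: "(complex \<Rightarrow> complex) \<Rightarrow> real" where
  "LW_sq F = integral\<^sup>L lborel
       (\<lambda>x::real. (norm (F (of_real x)))\<^sup>2 * (1 - sin (2*pi*x) / (2*pi*x)))
     + (norm (F 0))\<^sup>2"

definition ratios :: "real \<Rightarrow> real set" where
  "ratios \<Delta> = {sqrt (LW_sq F) / sqrt (L2_sq F) | F. F \<in> PW (pi * \<Delta>) \<and> F \<noteq> (\<lambda>_. 0)}"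

definition C_minus :: "real \<Rightarrow> real" where
  "C_minus \<Delta> = Inf (ratios \<Delta>)"

definition C_plus :: "real \<Rightarrow> real" where
  "C_plus \<Delta> = Sup (ratios \<Delta>)"

definition eta_solution :: "real \<Rightarrow> real \<Rightarrow> bool" where
  "eta_solution \<Delta> \<eta> \<longleftrightarrow> \<eta> \<noteq> 0 \<and>
     (3/2 - (2 - \<Delta>) / (4*\<eta>)) * cos ((\<Delta> - 1) / (2*\<eta>)) - sin ((\<Delta> - 1) / (2*\<eta>)) = 1"

end

theory Submission
  imports Defs "HOL-Probability.Probability" "HOL-Complex_Analysis.Complex_Analysis" "HOL-Real_Asymp.Real_Asymp"
begin

text \<open>
  By Paley--Wiener, \<open>F\<close> is the Fourier transform of a function \<open>f\<close> on \<open>[-a, a]\<close>, \<open>a = \<Delta>/2\<close>, and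
  Parseval turns \<open>\<parallel>F\<parallel>\<^sub>W\<^sup>2 - \<parallel>F\<parallel>\<^sup>2\<close> into the quadratic form of the kernel
  \<open>K(t,u) = 1/2 + 1/2 [|t - u| > 1]\<close> on \<open>[-a, a]\<close>, so that the extremal ratios are governed by
  its spectrum. No spectral theorem is needed. Since \<open>K > 0\<close>, a positive eigenfunction
  certifies its eigenvalue as the maximum by the Schur test; it is
  \<open>cos (\<omega> (u + a) + \<beta>)\<close>, \<open>sin \<beta>\<close>, \<open>sin (\<omega> (u + a - 1) + \<beta>)\<close> on the left, middle and right
  part of the interval, and the eigenvalue \<open>1/(2\<omega>)\<close> is the largest solution of the transcendental
  equation. The smallest solution is explicitly \<open>-(\<Delta> - 1)/\<pi>\<close>: the Schur test with \<open>\<beta> = 0\<close> for the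
  kernel \<open>1/2 [|t - u| > 1]\<close> (the rest of \<open>K\<close> is positive semidefinite) gives the lower bound, and
  changing the sign of the right part yields an odd eigenfunction attaining it.

  That the transform of \<open>F\<close> vanishes off \<open>[-a, a]\<close> is shown by rotating each half line
  to the negative imaginary axis.
\<close>

section \<open>Gaussian regularisation of the Fourier transform\<close>

text \<open>A member of \<open>PW\<close> is only square-integrable on the line, so its transform
  need not be an absolutely convergent integral, whereas the contour rotation works with integrable
  functions. The form bounds are therefore proved for bounded \<open>f\<close> supported in
  \<open>[-a, a]\<close> and carried over: the product of \<open>F(rz)\<close> and
  \<open>S(sz)\<close>, with \<open>r + s = 1\<close> and \<open>S\<close> a normalised sinc, keeps
  the type, is integrable on the line and tends to \<open>F\<close> as \<open>s -> 0\<close>.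
  Extremal functions come from bounded \<open>f\<close> directly.

  The shape of the eigenfunction is forced. On the left part, \<open>\<eta> f(t)\<close> is a
  constant plus half the integral of \<open>f\<close> over \<open>[t+1, a]\<close>, so
  \<open>2 \<eta> f'(t) = - f(t+1)\<close>; on the right part
  \<open>2 \<eta> f'(t) = f(t-1)\<close>; in the middle \<open>f\<close> is constant. Hence
  \<open>f'' = - f / (4 \<eta>^2)\<close> on the outer parts, with frequency
  \<open>\<omega> = 1 / (2 \<eta>)\<close> for positive eta, and matching the pieces gives
  \<open>\<omega> (2a - 1) + 2 \<beta> = pi/2\<close>. The remaining condition, that the constant be
  right, is the transcendental equation in \<open>\<theta> = \<omega> (2a - 1)\<close>. As eta is
  inversely proportional to theta, the largest eta belongs to the first positive theta.\<close>

definition fourier :: "(real \<Rightarrow> complex) \<Rightarrow> real \<Rightarrow> complex" where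
  "fourier f x = (LINT t|lborel. f t * cis (2 * pi * x * t))"

lemma measurable_cis [measurable]: "cis \<in> borel_measurable borel"
  by (intro borel_measurable_continuous_onI continuous_intros)

lemma measurable_cnj [measurable]: "cnj \<in> borel_measurable borel"
  by (intro borel_measurable_continuous_onI continuous_intros)

lemma integrable_mult_cis:
  assumes "integrable lborel f"
  shows "integrable lborel (\<lambda>t. f t * cis (c * t))"
  using assms by (rule Bochner_Integration.integrable_bound) (use assms in \<open>auto simp: norm_mult\<close>)

lemma fourier_bound:
  assumes "integrable lborel f"
  shows "norm (fourier f x) \<le> (LINT t|lborel. norm (f t))"
  unfolding fourier_def
  by (rule order_trans[OF integral_norm_bound]) (simp add: norm_mult)

lemma measurable_fourier [measurable]:
  assumes [measurable]: "f \<in> borel_measurable borel"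
  shows "fourier f \<in> borel_measurable borel"
  unfolding fourier_def by measurable

text \<open>Fubini: the phase is symmetric in \<open>x\<close> and \<open>t\<close> and has modulus
  one, so \<open>|f(t)| |k(x)|\<close> dominates the double integral. Every later transfer of a
  transform from one factor to the other goes through this identity.\<close>

lemma fourier_multiplication:
  assumes f: "integrable lborel f" and k: "integrable lborel k"
  shows "(LINT x|lborel. fourier f x * k x) = (LINT t|lborel. f t * fourier k t)"
proof -
  note [measurable] = borel_measurable_integrable[OF f, simplified] borel_measurable_integrable[OF k, simplified]
  let ?h = "\<lambda>t x. f t * (k x * cis (2 * pi * x * t))"
  have "integrable (lborel \<Otimes>\<^sub>M lborel) (\<lambda>(t,x). ?h t x)"
  proof (rule lborel_pair.Fubini_integrable)
    show "(\<lambda>(t,x). ?h t x) \<in> borel_measurable (lborel \<Otimes>\<^sub>M lborel)"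
      by measurable
    have "(LINT x|lborel. norm (case (t, x) of (t, x) \<Rightarrow> ?h t x)) = norm (f t) * (LINT x|lborel. norm (k x))" for t
      by (simp add: norm_mult)
    then show "integrable lborel (\<lambda>t. LINT x|lborel. norm (case (t, x) of (t, x) \<Rightarrow> ?h t x))"
      using f by simp
    have "integrable lborel (\<lambda>x. ?h t x)" for t
      using integrable_mult_cis[OF k, of "2*pi*t"] by (simp add: mult_ac)
    then show "AE t in lborel. integrable lborel (\<lambda>x. case (t, x) of (t, x) \<Rightarrow> ?h t x)"
      by simp
  qed
  then have "(LINT x|lborel. LINT t|lborel. ?h t x) = (LINT t|lborel. LINT x|lborel. ?h t x)"
    by (rule lborel_pair.Fubini_integral)
  moreover have "(LINT t|lborel. ?h t x) = fourier f x * k x" for x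
    unfolding fourier_def integral_mult_left_zero[symmetric] by (simp add: mult_ac)
  moreover have "(LINT x|lborel. ?h t x) = f t * fourier k t" for t
    unfolding fourier_def integral_mult_right_zero[symmetric] by (simp add: mult_ac)
  ultimately show ?thesis by (simp only:)
qed

text \<open>Scaled so that its transform is the normal density of standard deviation
  \<open>\<sigma>\<close>: as \<open>\<sigma>\<close> tends to 0 the multiplier tends to 1 while its
  transform concentrates at 0.\<close>

definition gauss :: "real \<Rightarrow> real \<Rightarrow> real" where
  "gauss \<sigma> x = exp (- (2 * pi * \<sigma> * x)\<^sup>2 / 2)"

lemma measurable_gauss [measurable]: "gauss \<sigma> \<in> borel_measurable borel"
  unfolding gauss_def by measurable

lemma gauss_bounds: "0 \<le> gauss \<sigma> x" "gauss \<sigma> x \<le> 1"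
  by (auto simp: gauss_def)

lemma gauss_minus: "gauss \<sigma> (-x) = gauss \<sigma> x"
  by (simp add: gauss_def)

lemma gauss_tendsto_1:
  assumes "\<sigma> \<longlonglongrightarrow> 0"
  shows "(\<lambda>n. gauss (\<sigma> n) x) \<longlonglongrightarrow> 1"
proof -
  have "(\<lambda>n. gauss (\<sigma> n) x) \<longlonglongrightarrow> exp (- (2 * pi * 0 * x)\<^sup>2 / 2)"
    unfolding gauss_def using assms by (intro tendsto_intros) auto
  then show ?thesis by simp
qed

lemma gauss_eq_density: "\<sigma> > 0 \<Longrightarrow> gauss \<sigma> x = sqrt (2 * pi) * std_normal_density (0 + 2 * pi * \<sigma> * x)"
  by (simp add: gauss_def std_normal_density_def)

lemma integrable_gauss:
  assumes "\<sigma> > 0" shows "integrable lborel (gauss \<sigma>)"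
proof -
  have "integrable lborel (\<lambda>x. std_normal_density (0 + (2 * pi * \<sigma>) * x))"
    using assms by (intro lborel_integrable_real_affine) auto
  then have "integrable lborel (\<lambda>x. sqrt (2 * pi) * std_normal_density (0 + (2 * pi * \<sigma>) * x))"
    by (rule integrable_mult_right)
  then show ?thesis
    by (simp only: gauss_eq_density[OF assms, symmetric])
qed

text \<open>This is the characteristic function of the standard normal distribution at
  \<open>s / \<sigma>\<close>, after the substitution \<open>y = 2 pi \<sigma> x\<close>. The
  remaining factor \<open>sqrt (2 pi) / (2 pi \<sigma>)\<close> is the normalisation of the
  density.\<close>

lemma fourier_gauss:
  assumes \<sigma>: "\<sigma> > 0"
  shows "fourier (\<lambda>x. of_real (gauss \<sigma> x)) s = of_real (normal_density 0 \<sigma> s)"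
proof -
  let ?c = "2 * pi * \<sigma>"
  have "of_real (exp (- (s/\<sigma>)\<^sup>2 / 2)) = char std_normal_distribution (s / \<sigma>)"
    by (simp add: char_std_normal_distribution)
  also have "\<dots> = (LINT y|lborel. std_normal_density y *\<^sub>R iexp (s / \<sigma> * y))"
    unfolding char_def by (subst integral_density) auto
  also have "\<dots> = \<bar>?c\<bar> *\<^sub>R (LINT x|lborel. std_normal_density (0 + ?c * x) *\<^sub>R iexp (s / \<sigma> * (0 + ?c * x)))"
    by (rule lborel_integral_real_affine) (use \<sigma> in auto)
  also have "(LINT x|lborel. std_normal_density (0 + ?c * x) *\<^sub>R iexp (s / \<sigma> * (0 + ?c * x)))
      = (LINT x|lborel. (1 / sqrt (2 * pi)) *\<^sub>R (of_real (gauss \<sigma> x) * cis (2 * pi * s * x)))"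
    using \<sigma> by (intro Bochner_Integration.integral_cong)
      (auto simp: gauss_eq_density cis_conv_exp scaleR_conv_of_real mult_ac)
  also have "\<dots> = (1 / sqrt (2 * pi)) *\<^sub>R fourier (\<lambda>x. of_real (gauss \<sigma> x)) s"
    unfolding fourier_def by (rule integral_scaleR_right)
  finally have "fourier (\<lambda>x. of_real (gauss \<sigma> x)) s = of_real (sqrt (2*pi) / ?c * exp (- (s/\<sigma>)\<^sup>2 / 2))"
    using \<sigma> by (simp add: scaleR_conv_of_real field_simps)
  also have "sqrt (2*pi) / ?c * exp (- (s/\<sigma>)\<^sup>2 / 2) = normal_density 0 \<sigma> s"
  proof -
    have "sqrt (2*pi) / ?c = 1 / (sqrt (2*pi) * \<sigma>)"
      using \<sigma> real_sqrt_mult_self[of "2*pi"] by (simp add: field_simps)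
    then show ?thesis
      using \<sigma> by (simp add: normal_density_def real_sqrt_mult power_divide)
  qed
  finally show ?thesis .
qed

lemma fourier_gauss_modulated:
  assumes "\<sigma> > 0"
  shows "fourier (\<lambda>x. of_real (gauss \<sigma> x) * cis (2 * pi * t * x)) s = of_real (normal_density 0 \<sigma> (t + s))"
  using fourier_gauss[OF assms, of "t + s"]
  by (simp add: fourier_def cis_mult algebra_simps)

lemma normal_density_rescale:
  "\<sigma> > 0 \<Longrightarrow> \<sigma> * normal_density 0 \<sigma> (\<sigma> * v) = std_normal_density v"
  by (simp add: normal_density_def real_sqrt_mult power_mult_distrib)

text \<open>Substituting \<open>y = \<sigma> v\<close> moves the parameter into
  \<open>h (\<sigma> v)\<close>, which tends to \<open>h 0\<close>; the fixed standard normal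
  density times \<open>M\<close> dominates.\<close>

lemma approx_identity_bounded:
  fixes h :: "real \<Rightarrow> complex"
  assumes [measurable]: "h \<in> borel_measurable borel" and bdd: "\<And>y. norm (h y) \<le> M"
    and cont: "isCont h 0" and \<sigma>: "\<sigma> \<longlonglongrightarrow> 0" "\<And>n. \<sigma> n > 0"
  shows "(\<lambda>n. LINT y|lborel. h y * of_real (normal_density 0 (\<sigma> n) y)) \<longlonglongrightarrow> h 0"
proof -
  have eq: "(LINT y|lborel. h y * of_real (normal_density 0 (\<sigma> n) y))
      = (LINT v|lborel. h (\<sigma> n * v) * of_real (std_normal_density v))" for n
  proof -
    have "(LINT y|lborel. h y * of_real (normal_density 0 (\<sigma> n) y))
      = \<bar>\<sigma> n\<bar> *\<^sub>R (LINT v|lborel. h (0 + \<sigma> n * v) * of_real (normal_density 0 (\<sigma> n) (0 + \<sigma> n * v)))"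
      by (rule lborel_integral_real_affine) (use \<sigma>(2)[of n] in auto)
    also have "\<dots> = (LINT v|lborel. h (\<sigma> n * v) * of_real (\<sigma> n * normal_density 0 (\<sigma> n) (\<sigma> n * v)))"
      unfolding integral_scaleR_right[symmetric] using \<sigma>(2)[of n]
      by (intro Bochner_Integration.integral_cong) (auto simp: scaleR_conv_of_real)
    finally show ?thesis
      using \<sigma>(2)[of n] by (simp add: normal_density_rescale)
  qed
  have "(\<lambda>n. LINT v|lborel. h (\<sigma> n * v) * of_real (std_normal_density v))
      \<longlonglongrightarrow> (LINT v|lborel. h 0 * of_real (std_normal_density v))"
  proof (rule integral_dominated_convergence[where w = "\<lambda>v. M * std_normal_density v"])
    have "(\<lambda>n. h (\<sigma> n * v)) \<longlonglongrightarrow> h 0" for v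
      using \<sigma>(1) by (intro isCont_tendsto_compose[OF cont] tendsto_mult_left_zero)
    then show "AE v in lborel. (\<lambda>n. h (\<sigma> n * v) * of_real (std_normal_density v)) \<longlonglongrightarrow> h 0 * of_real (std_normal_density v)"
      by (auto intro!: tendsto_intros)
    show "AE v in lborel. norm (h (\<sigma> n * v) * of_real (std_normal_density v)) \<le> M * std_normal_density v" for n
      using bdd by (intro always_eventually) (auto simp: norm_mult intro!: mult_right_mono)
  qed (auto intro!: integrable_normal_density integrable_mult_right)
  moreover have "(LINT v|lborel. complex_of_real (std_normal_density v)) = 1"
    by (simp add: integral_complex_of_real)
  ultimately show ?thesis
    by (simp add: eq)
qed

section \<open>Parseval's identity\<close>

definition bandlimit :: "real \<Rightarrow> (real \<Rightarrow> complex) \<Rightarrow> bool" where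
  "bandlimit a f \<longleftrightarrow> f \<in> borel_measurable borel \<and> (\<exists>M. \<forall>t. norm (f t) \<le> M) \<and> (\<forall>t. \<bar>t\<bar> > a \<longrightarrow> f t = 0)"

lemma bandlimit_measurable [measurable_dest]: "bandlimit a f \<Longrightarrow> f \<in> borel_measurable borel"
  by (simp add: bandlimit_def)

lemma bandlimit_dominated:
  assumes "bandlimit a f"
  obtains M where "M \<ge> 0" "\<And>t. norm (f t) \<le> M" "\<And>t. norm (f t) \<le> M * indicator {-a..a} t"
proof -
  from assms obtain M where M: "\<And>t. norm (f t) \<le> M"
    by (auto simp: bandlimit_def)
  moreover have "M \<ge> 0"
    using M[of 0] norm_ge_zero order_trans by blast
  moreover have "norm (f t) \<le> M * indicator {-a..a} t" for t
    using M[of t] assms by (auto simp: bandlimit_def indicator_def abs_le_iff)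
  ultimately show ?thesis using that by blast
qed

lemma integrable_indicator_interval: "integrable lborel (\<lambda>t::real. c * indicator {a..b} t :: real)"
  by (intro integrable_mult_right integrable_real_indicator) (auto simp: emeasure_lborel_Icc_eq)

lemma bandlimit_integrable:
  assumes "bandlimit a f" shows "integrable lborel f"
proof -
  obtain M where M: "M \<ge> 0" "\<And>t. norm (f t) \<le> M * indicator {-a..a} t"
    using bandlimit_dominated[OF assms] by metis
  show ?thesis
    by (rule Bochner_Integration.integrable_bound[OF integrable_indicator_interval[of M "-a" a]])
      (use M assms in \<open>auto simp: bandlimit_def indicator_def\<close>)
qed

lemma fourier_cnj: "cnj (fourier g x) = fourier (\<lambda>u. cnj (g (-u))) x"
proof -
  have "cnj (fourier g x) = (LINT u|lborel. cnj (g u) * cis (- (2 * pi * x * u)))"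
    unfolding fourier_def by (subst Bochner_Integration.integral_cnj[symmetric]) (simp add: cis_cnj del: Bochner_Integration.integral_cnj)
  also have "\<dots> = \<bar>-1\<bar> *\<^sub>R (LINT u|lborel. cnj (g (0 + -1 * u)) * cis (- (2 * pi * x * (0 + -1 * u))))"
    by (rule lborel_integral_real_affine) simp
  finally show ?thesis by (simp add: fourier_def)
qed

text \<open>The Gaussian makes \<open>cnj (fourier g x)\<close> times the weight integrable before
  any square-integrability of transforms is known, so the multiplication identity applies twice:
  once to \<open>f\<close>, once to the reflected conjugate of \<open>g\<close>. The second use
  turns the inner transform into an average of \<open>cnj g\<close> around \<open>t\<close>.\<close>

lemma fourier_product_gauss:
  assumes f: "bandlimit a f" and g: "bandlimit a g" and \<sigma>: "\<sigma> > 0"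
  shows "(LINT x|lborel. fourier f x * cnj (fourier g x) * of_real (gauss \<sigma> x))
     = (LINT t|lborel. f t * (LINT y|lborel. cnj (g (t + y)) * of_real (normal_density 0 \<sigma> y)))"
proof -
  let ?g = "\<lambda>u. cnj (g (-u))"
  have g': "integrable lborel ?g"
  proof -
    have "integrable lborel (\<lambda>u. g (0 + -1 * u))"
      by (intro lborel_integrable_real_affine bandlimit_integrable[OF g]) auto
    then show ?thesis by simp
  qed
  note [measurable] = bandlimit_measurable[OF f] bandlimit_measurable[OF g]
  have G: "integrable lborel (\<lambda>x. complex_of_real (gauss \<sigma> x))"
    using integrable_gauss[OF \<sigma>] by simp
  let ?k = "\<lambda>x. cnj (fourier g x) * of_real (gauss \<sigma> x)"
  have k: "integrable lborel ?k"
  proof (rule Bochner_Integration.integrable_bound)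
    show "integrable lborel (\<lambda>x. (LINT t|lborel. norm (g t)) * gauss \<sigma> x)"
      using integrable_gauss[OF \<sigma>] by simp
    show "AE x in lborel. norm (?k x) \<le> norm ((LINT t|lborel. norm (g t)) * gauss \<sigma> x)"
      using fourier_bound[OF bandlimit_integrable[OF g]] gauss_bounds
      by (intro always_eventually) (auto simp: norm_mult intro!: mult_right_mono)
  qed measurable
  have "(LINT x|lborel. fourier f x * ?k x) = (LINT t|lborel. f t * fourier ?k t)"
    by (rule fourier_multiplication[OF bandlimit_integrable[OF f] k])
  moreover have "fourier ?k t = (LINT y|lborel. cnj (g (t + y)) * of_real (normal_density 0 \<sigma> y))" for t
  proof -
    have "fourier ?k t = (LINT x|lborel. fourier ?g x * (of_real (gauss \<sigma> x) * cis (2 * pi * t * x)))"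
      by (subst fourier_def) (simp add: fourier_cnj mult_ac)
    also have "\<dots> = (LINT v|lborel. ?g v * fourier (\<lambda>x. of_real (gauss \<sigma> x) * cis (2 * pi * t * x)) v)"
      by (rule fourier_multiplication[OF g' integrable_mult_cis[OF G]])
    also have "\<dots> = (LINT v|lborel. ?g v * of_real (normal_density 0 \<sigma> (t + v)))"
      by (simp add: fourier_gauss_modulated[OF \<sigma>])
    also have "\<dots> = \<bar>-1\<bar> *\<^sub>R (LINT y|lborel. ?g (-t + -1 * y) * of_real (normal_density 0 \<sigma> (t + (-t + -1 * y))))"
      by (rule lborel_integral_real_affine) simp
    also have "\<dots> = (LINT y|lborel. cnj (g (t + y)) * of_real (normal_density 0 \<sigma> y))"
      by (simp add: normal_density_def add.commute)
    finally show ?thesis .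
  qed
  ultimately show ?thesis by (simp add: mult.assoc)
qed

lemma normal_average_bound:
  fixes h :: "real \<Rightarrow> complex"
  assumes [measurable]: "h \<in> borel_measurable borel" and bdd: "\<And>y. norm (h y) \<le> M" and \<sigma>: "\<sigma> > 0"
  shows "norm (LINT y|lborel. h y * of_real (normal_density 0 \<sigma> y)) \<le> M"
proof -
  have "norm (LINT y|lborel. h y * of_real (normal_density 0 \<sigma> y)) \<le> (LINT y|lborel. norm (h y * of_real (normal_density 0 \<sigma> y)))"
    by (rule integral_norm_bound)
  also have "\<dots> \<le> (LINT y|lborel. M * normal_density 0 \<sigma> y)"
  proof (rule integral_mono)
    show "integrable lborel (\<lambda>y. norm (h y * of_real (normal_density 0 \<sigma> y)))"
    proof (rule Bochner_Integration.integrable_bound)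
      show "integrable lborel (\<lambda>y. M * normal_density 0 \<sigma> y)"
        using \<sigma> by simp
      have "norm (h y) \<le> \<bar>M\<bar>" for y
        using bdd[of y] by linarith
      then show "AE y in lborel. norm (norm (h y * of_real (normal_density 0 \<sigma> y))) \<le> norm (M * normal_density 0 \<sigma> y)"
        by (intro always_eventually) (auto simp: norm_mult abs_mult intro!: mult_right_mono)
    qed measurable
  qed (use bdd \<sigma> in \<open>auto simp: norm_mult intro!: mult_right_mono\<close>)
  also have "\<dots> = M" using \<sigma> by simp
  finally show ?thesis .
qed

text \<open>The Gaussian-weighted integrals are pairings of \<open>f\<close> with averages of its
  conjugate, hence stay below the constant \<open>B\<close> for every \<open>\<sigma>\<close>. As
  the Gaussian tends to 1, Fatou's lemma gives finiteness.\<close>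

lemma fourier_square_integrable:
  assumes f: "bandlimit a f"
  shows "integrable lborel (\<lambda>x. (norm (fourier f x))\<^sup>2)"
proof -
  obtain M where M: "M \<ge> 0" "\<And>t. norm (f t) \<le> M" "\<And>t. norm (f t) \<le> M * indicator {-a..a} t"
    using bandlimit_dominated[OF f] by metis
  note [measurable] = bandlimit_measurable[OF f]
  define \<sigma> where "\<sigma> n = 1 / real (Suc n)" for n
  have \<sigma>: "\<sigma> n > 0" "\<sigma> \<longlonglongrightarrow> 0" for n
    unfolding \<sigma>_def using LIMSEQ_inverse_real_of_nat by (auto simp: inverse_eq_divide)
  define B where "B = (LINT t|lborel. (M * M) * indicator {-a..a} t :: real)"
  let ?h = "\<lambda>n x. (norm (fourier f x))\<^sup>2 * gauss (\<sigma> n) x"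
  have int: "integrable lborel (?h n)" for n
  proof (rule Bochner_Integration.integrable_bound)
    show "integrable lborel (\<lambda>x. (LINT t|lborel. norm (f t))\<^sup>2 * gauss (\<sigma> n) x)"
      using integrable_gauss[OF \<sigma>(1)] by simp
    show "AE x in lborel. norm (?h n x) \<le> norm ((LINT t|lborel. norm (f t))\<^sup>2 * gauss (\<sigma> n) x)"
      using fourier_bound[OF bandlimit_integrable[OF f]] gauss_bounds
      by (intro always_eventually) (auto simp: abs_mult intro!: mult_right_mono power_mono)
  qed measurable
  have le: "(LINT x|lborel. ?h n x) \<le> B" for n
  proof -
    have "complex_of_real (LINT x|lborel. ?h n x) = (LINT x|lborel. fourier f x * cnj (fourier f x) * of_real (gauss (\<sigma> n) x))"
      by (simp add: complex_norm_square[symmetric] flip: integral_complex_of_real)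
    also have "\<dots> = (LINT t|lborel. f t * (LINT y|lborel. cnj (f (t + y)) * of_real (normal_density 0 (\<sigma> n) y)))"
      by (rule fourier_product_gauss[OF f f \<sigma>(1)])
    finally have "\<bar>LINT x|lborel. ?h n x\<bar> = norm (LINT t|lborel. f t * (LINT y|lborel. cnj (f (t + y)) * of_real (normal_density 0 (\<sigma> n) y)))"
      by (metis norm_of_real)
    also have "\<dots> \<le> (LINT t|lborel. norm (f t * (LINT y|lborel. cnj (f (t + y)) * of_real (normal_density 0 (\<sigma> n) y))))"
      by (rule integral_norm_bound)
    also have "\<dots> \<le> B"
      unfolding B_def
    proof (rule Bochner_Integration.integral_mono')
      fix t
      have "norm (LINT y|lborel. cnj (f (t + y)) * of_real (normal_density 0 (\<sigma> n) y)) \<le> M"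
        by (rule normal_average_bound) (use M \<sigma> in auto)
      then show "norm (f t * (LINT y|lborel. cnj (f (t + y)) * of_real (normal_density 0 (\<sigma> n) y))) \<le> M * M * indicator {-a..a} t"
        unfolding norm_mult using mult_mono[OF M(3)[of t]] M(1) by (fastforce simp: mult_ac)
    qed (rule integrable_indicator_interval, use M in simp)
    finally show ?thesis by linarith
  qed
  have "(\<integral>\<^sup>+x. ennreal ((norm (fourier f x))\<^sup>2) \<partial>lborel) = (\<integral>\<^sup>+x. liminf (\<lambda>n. ennreal (?h n x)) \<partial>lborel)"
  proof (rule nn_integral_cong)
    fix x
    have "(\<lambda>n. ennreal (?h n x)) \<longlonglongrightarrow> ennreal ((norm (fourier f x))\<^sup>2 * 1)"
      by (intro tendsto_ennrealI tendsto_intros gauss_tendsto_1 \<sigma>)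
    then show "ennreal ((norm (fourier f x))\<^sup>2) = liminf (\<lambda>n. ennreal (?h n x))"
      by (simp add: lim_imp_Liminf)
  qed
  also have "\<dots> \<le> liminf (\<lambda>n. \<integral>\<^sup>+x. ennreal (?h n x) \<partial>lborel)"
    by (rule nn_integral_liminf) measurable
  also have "\<dots> \<le> ennreal B"
  proof -
    have "(\<integral>\<^sup>+x. ennreal (?h n x) \<partial>lborel) \<le> ennreal B" for n
      using int[of n] le[of n] gauss_bounds by (subst nn_integral_eq_integral) (auto intro!: ennreal_leI)
    then show ?thesis
      by (intro Liminf_le) auto
  qed
  finally show ?thesis
    by (intro integrableI_bounded) (auto simp: top_unique intro: le_less_trans)
qed

lemma integrable_mult_square_integrable:
  fixes u v :: "real \<Rightarrow> complex"
  assumes [measurable]: "u \<in> borel_measurable borel" "v \<in> borel_measurable borel"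
    and "integrable lborel (\<lambda>x. (norm (u x))\<^sup>2)" "integrable lborel (\<lambda>x. (norm (v x))\<^sup>2)"
  shows "integrable lborel (\<lambda>x. u x * v x)"
proof (rule Bochner_Integration.integrable_bound)
  show "integrable lborel (\<lambda>x. (norm (u x))\<^sup>2 + (norm (v x))\<^sup>2)"
    using assms by simp
  have "p * q \<le> p\<^sup>2 + q\<^sup>2" if "p \<ge> 0" "q \<ge> 0" for p q :: real
    using sum_squares_bound[of p q] mult_nonneg_nonneg[OF that] by linarith
  then show "AE x in lborel. norm (u x * v x) \<le> norm ((norm (u x))\<^sup>2 + (norm (v x))\<^sup>2)"
    by (intro always_eventually) (auto simp: norm_mult)
qed measurable

text \<open>Both sides of the Gaussian identity converge: the left one by domination, since a
  product of two transforms is integrable, the right one because averages of \<open>g\<close> tend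
  to \<open>g t\<close> at each point of continuity.\<close>

theorem fourier_parseval:
  assumes f: "bandlimit a f" and g: "bandlimit a g" and cont: "AE t in lborel. isCont g t"
  shows "(LINT x|lborel. fourier f x * cnj (fourier g x)) = (LINT t|lborel. f t * cnj (g t))"
proof -
  note [measurable] = bandlimit_measurable[OF f] bandlimit_measurable[OF g]
  obtain M where M: "M \<ge> 0" "\<And>t. norm (g t) \<le> M"
    using bandlimit_dominated[OF g] by metis
  define \<sigma> where "\<sigma> n = 1 / real (Suc n)" for n
  have \<sigma>: "\<sigma> n > 0" "\<sigma> \<longlonglongrightarrow> 0" for n
    unfolding \<sigma>_def using LIMSEQ_inverse_real_of_nat by (auto simp: inverse_eq_divide)
  have "(\<lambda>n. LINT x|lborel. fourier f x * cnj (fourier g x) * of_real (gauss (\<sigma> n) x))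
      \<longlonglongrightarrow> (LINT x|lborel. fourier f x * cnj (fourier g x))"
  proof (rule integral_dominated_convergence[where w = "\<lambda>x. norm (fourier f x * cnj (fourier g x))"])
    show "integrable lborel (\<lambda>x. norm (fourier f x * cnj (fourier g x)))"
      using fourier_square_integrable[OF f] fourier_square_integrable[OF g]
      by (intro integrable_norm integrable_mult_square_integrable) (auto simp: norm_mult)
    have "(\<lambda>n. fourier f x * cnj (fourier g x) * of_real (gauss (\<sigma> n) x)) \<longlonglongrightarrow> fourier f x * cnj (fourier g x) * of_real 1" for x
      by (intro tendsto_intros gauss_tendsto_1 \<sigma>)
    then show "AE x in lborel. (\<lambda>n. fourier f x * cnj (fourier g x) * of_real (gauss (\<sigma> n) x)) \<longlonglongrightarrow> fourier f x * cnj (fourier g x)"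
      by simp
    show "AE x in lborel. norm (fourier f x * cnj (fourier g x) * of_real (gauss (\<sigma> n) x)) \<le> norm (fourier f x * cnj (fourier g x))" for n
      using gauss_bounds by (intro always_eventually) (auto simp: norm_mult intro!: mult_right_le_one_le)
  qed measurable
  moreover have "(\<lambda>n. LINT t|lborel. f t * (LINT y|lborel. cnj (g (t + y)) * of_real (normal_density 0 (\<sigma> n) y)))
      \<longlonglongrightarrow> (LINT t|lborel. f t * cnj (g t))"
  proof (rule integral_dominated_convergence[where w = "\<lambda>t. norm (f t) * M"])
    show "integrable lborel (\<lambda>t. norm (f t) * M)"
      using bandlimit_integrable[OF f] by simp
    show "AE t in lborel. (\<lambda>n. f t * (LINT y|lborel. cnj (g (t + y)) * of_real (normal_density 0 (\<sigma> n) y))) \<longlonglongrightarrow> f t * cnj (g t)"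
      using cont
    proof eventually_elim
      case (elim t)
      have "(\<lambda>n. LINT y|lborel. cnj (g (t + y)) * of_real (normal_density 0 (\<sigma> n) y)) \<longlonglongrightarrow> cnj (g (t + 0))"
      proof (rule approx_identity_bounded[where h = "\<lambda>y. cnj (g (t + y))"])
        show "isCont (\<lambda>y. cnj (g (t + y))) 0"
          by (intro continuous_intros isCont_o2[of 0 "\<lambda>y. t + y" g]) (use elim in auto)
      qed (use M \<sigma> in auto)
      then show ?case by (intro tendsto_intros) simp
    qed
    have "norm (LINT y|lborel. cnj (g (t + y)) * of_real (normal_density 0 (\<sigma> n) y)) \<le> M" for n t
      by (rule normal_average_bound) (use M \<sigma> in auto)
    then show "AE t in lborel. norm (f t * (LINT y|lborel. cnj (g (t + y)) * of_real (normal_density 0 (\<sigma> n) y))) \<le> norm (f t) * M" for n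
      by (intro always_eventually) (auto simp: norm_mult intro!: mult_left_mono)
  qed measurable
  ultimately show ?thesis
    unfolding fourier_product_gauss[OF f g \<sigma>(1)] by (rule LIMSEQ_unique)
qed

lemma fourier_plancherel:
  assumes f: "bandlimit a f" and cont: "AE t in lborel. isCont f t"
  shows "(LINT x|lborel. (norm (fourier f x))\<^sup>2) = (LINT t|lborel. (norm (f t))\<^sup>2)"
proof -
  have "complex_of_real (LINT x|lborel. (norm (fourier f x))\<^sup>2) = of_real (LINT t|lborel. (norm (f t))\<^sup>2)"
    using fourier_parseval[OF f f cont]
    by (simp only: complex_norm_square[symmetric] integral_complex_of_real)
  then show ?thesis by (simp only: of_real_eq_iff)
qed

section \<open>The sinc weight on the spectral side\<close>

lemma bandlimit_mono: "bandlimit a f \<Longrightarrow> a \<le> b \<Longrightarrow> bandlimit b f"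
  by (auto simp: bandlimit_def)

text \<open>The sinc in the weight is the transform of this box centred at 0, so multiplying a
  transform by the sinc amounts to averaging \<open>f\<close> over \<open>[t-1, t+1]\<close>. Height
  1/2 makes the integral 1.\<close>

definition half_box :: "real \<Rightarrow> real \<Rightarrow> complex" where
  "half_box t s = of_real (indicator {t-1..t+1} s / 2)"

lemma measurable_half_box [measurable]: "(\<lambda>(t,s). half_box t s) \<in> borel_measurable (borel \<Otimes>\<^sub>M borel)"
proof -
  have "(\<lambda>(t,s). half_box t s) = (\<lambda>(t,s). if t - 1 \<le> s \<and> s \<le> t + 1 then 1/2 else 0)"
    by (auto simp: half_box_def indicator_def)
  also have "\<dots> \<in> borel_measurable (borel \<Otimes>\<^sub>M borel)" by measurable
  finally show ?thesis .
qed

lemma bandlimit_half_box: "bandlimit (\<bar>t\<bar> + 1) (half_box t)"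
  unfolding bandlimit_def
proof (intro conjI)
  show "\<exists>M. \<forall>s. norm (half_box t s) \<le> M" by (rule exI[of _ 1]) (auto simp: half_box_def indicator_def)
qed (auto simp: half_box_def indicator_def)

text \<open>At \<open>x = 0\<close> the identity fails: division by zero makes the right side 0,
  while the transform there is 1. Later uses discard this null set.\<close>

lemma fourier_half_box:
  assumes "x \<noteq> 0"
  shows "fourier (half_box t) x = cis (2 * pi * t * x) * of_real (sin (2 * pi * x) / (2 * pi * x))"
proof -
  define c where "c = 2 * pi * x"
  have c: "c \<noteq> 0" using assms by (simp add: c_def)
  let ?F = "\<lambda>s. cis (c * s) / (2 * \<i> * of_real c)"
  have "fourier (half_box t) x = (LINT s|lborel. indicator {t-1..t+1} s *\<^sub>R (cis (c * s) / 2))"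
    unfolding fourier_def half_box_def c_def by (intro Bochner_Integration.integral_cong) (auto simp: indicator_def)
  also have "\<dots> = ?F (t + 1) - ?F (t - 1)"
  proof (rule integral_FTC_Icc)
    show "(?F has_vector_derivative cis (c * s) / 2) (at s within {t-1..t+1})" for s
      unfolding cis_conv_exp using c by (auto intro!: derivative_eq_intros has_vector_derivative_real_field simp: field_simps)
  qed (auto intro!: continuous_intros)
  also have "\<dots> = cis (c * t) * of_real (sin c / c)"
    using c by (auto simp: complex_eq_iff cis.ctr distrib_left right_diff_distrib cos_add sin_add cos_diff sin_diff field_simps Re_divide Im_divide power2_eq_square)
  finally show ?thesis by (simp add: c_def mult_ac)
qed

text \<open>The sinc alone is not integrable, so it stays attached to
  \<open>cnj (fourier f x)\<close>: a product of two square-integrable functions is integrable and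
  the multiplication identity applies. The transform of that product at \<open>t\<close> is then
  evaluated by Parseval against the box centred at \<open>t\<close>.\<close>

lemma fourier_sinc_weight:
  assumes f: "bandlimit a f" and cont: "AE t in lborel. isCont f t"
  shows "of_real (LINT x|lborel. (norm (fourier f x))\<^sup>2 * (sin (2 * pi * x) / (2 * pi * x)))
    = (LINT t|lborel. f t * cnj (LINT s|lborel. half_box t s * f s))"
proof -
  note [measurable] = bandlimit_measurable[OF f]
  let ?s = "\<lambda>x. complex_of_real (sin (2 * pi * x) / (2 * pi * x))"
  let ?k = "\<lambda>x. cnj (fourier f x) * ?s x"
  have AE0: "AE x in lborel. x \<noteq> (0::real)"
    using AE_lborel_singleton by blast
  have "integrable lborel (\<lambda>x. cnj (fourier f x) * fourier (half_box 0) x)"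
    using fourier_square_integrable[OF f] fourier_square_integrable[OF bandlimit_half_box]
    by (intro integrable_mult_square_integrable) auto
  then have k: "integrable lborel ?k"
  proof (rule integrable_cong_AE_imp)
    show "AE x in lborel. cnj (fourier f x) * fourier (half_box 0) x = cnj (fourier f x) * ?s x"
      using AE0 by eventually_elim (simp add: fourier_half_box)
  qed measurable
  have "of_real (LINT x|lborel. (norm (fourier f x))\<^sup>2 * (sin (2 * pi * x) / (2 * pi * x))) = (LINT x|lborel. fourier f x * ?k x)"
    by (simp only: integral_complex_of_real[symmetric] of_real_mult complex_norm_square mult.assoc)
  also have "\<dots> = (LINT t|lborel. f t * fourier ?k t)"
    by (rule fourier_multiplication[OF bandlimit_integrable[OF f] k])
  also have "\<dots> = (LINT t|lborel. f t * cnj (LINT s|lborel. half_box t s * f s))"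
  proof (rule Bochner_Integration.integral_cong)
    fix t
    let ?a = "max a (\<bar>t\<bar> + 1)"
    have "fourier ?k t = (LINT x|lborel. fourier (half_box t) x * cnj (fourier f x))"
      unfolding fourier_def[of ?k]
    proof (rule integral_cong_AE)
      show "AE x in lborel. ?k x * cis (2 * pi * t * x) = fourier (half_box t) x * cnj (fourier f x)"
        using AE0 by eventually_elim (simp add: fourier_half_box mult_ac)
    qed measurable
    \<comment> \<open>Parseval asks for continuity almost everywhere of its second factor, hence
      this order; \<open>?a\<close> is a band containing both supports.\<close>
    also have "\<dots> = (LINT s|lborel. half_box t s * cnj (f s))"
      by (rule fourier_parseval[OF _ _ cont, of ?a]) (auto intro: bandlimit_mono[OF f] bandlimit_mono[OF bandlimit_half_box])
    also have "\<dots> = cnj (LINT s|lborel. half_box t s * f s)"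
      by (subst Bochner_Integration.integral_cnj[symmetric]) (simp add: half_box_def del: Bochner_Integration.integral_cnj)
    finally show "f t * fourier ?k t = f t * cnj (LINT s|lborel. half_box t s * f s)" by simp
  qed simp
  finally show ?thesis .
qed

section \<open>The Paley--Wiener theorem\<close>

text \<open>In the cone \<open>|arg w| <= pi/4\<close> the power \<open>w^(3/2)\<close> has argument
  at most \<open>3 pi/8\<close> in modulus, so its real part is comparable with
  \<open>(Re w)^(3/2)\<close>. The proof is algebraic in the real and imaginary parts
  \<open>a\<close>, \<open>b\<close> of the square root:
  \<open>Re (w * csqrt w) = a (a^2 - 3 b^2)\<close>.\<close>

lemma Re_three_halves_power:
  assumes "\<bar>Im w\<bar> \<le> Re w"
  shows "2/5 * (Re w * sqrt (Re w)) \<le> Re (w * csqrt w)"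
proof -
  define a b where "a = Re (csqrt w)" "b = Im (csqrt w)"
  have w: "csqrt w = Complex a b" by (simp add: a_b_def complex_eq_iff del: csqrt.simps)
  have "(csqrt w)\<^sup>2 = w" by simp
  then have re: "Re w = a\<^sup>2 - b\<^sup>2" and im: "Im w = 2 * a * b"
    by (simp_all add: w complex_eq_iff power2_eq_square)
  have a: "a \<ge> 0" unfolding a_b_def by (rule Re_csqrt)
  have "(Im w)\<^sup>2 \<le> (Re w)\<^sup>2"
    using assms by (metis abs_ge_zero abs_le_square_iff abs_of_nonneg order_trans)
  then have quad: "4 * (a\<^sup>2 * b\<^sup>2) \<le> (a\<^sup>2 - b\<^sup>2)\<^sup>2"
    unfolding re im by (simp add: power_mult_distrib)
  have "Re w \<ge> 0" using assms by linarith
  then have AB: "b\<^sup>2 \<le> a\<^sup>2" by (simp add: re)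
  \<comment> \<open>The cone means \<open>b^2 <= tan^2(pi/8) a^2\<close>, where
    \<open>tan^2(pi/8) = 3 - 2 sqrt 2\<close> is about 0.172. The rational bound 1/5 suffices and is
    the source of 2/5, since then \<open>a^2 - 3 b^2 >= (2/5) a^2\<close>.\<close>
  have five: "5 * b\<^sup>2 \<le> a\<^sup>2"
  proof (rule ccontr)
    assume *: "\<not> 5 * b\<^sup>2 \<le> a\<^sup>2"
    then have "b\<^sup>2 > 0" using zero_le_power2[of a] zero_le_power2[of b] by linarith
    have "(a\<^sup>2 - 5 * b\<^sup>2) * (a\<^sup>2 - b\<^sup>2) \<le> 0"
      using * AB by (intro mult_nonpos_nonneg) auto
    moreover have "(a\<^sup>2 - b\<^sup>2)\<^sup>2 - 4 * (a\<^sup>2 * b\<^sup>2) = (a\<^sup>2 - 5 * b\<^sup>2) * (a\<^sup>2 - b\<^sup>2) - 4 * (b\<^sup>2 * b\<^sup>2)"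
      by (simp add: algebra_simps power2_eq_square)
    moreover have "b\<^sup>2 * b\<^sup>2 > 0" using \<open>b\<^sup>2 > 0\<close> by simp
    ultimately show False using quad by linarith
  qed
  have "sqrt (Re w) \<le> a"
    using a zero_le_power2[of b] by (intro real_le_lsqrt) (auto simp: re)
  moreover have "Re w \<le> a\<^sup>2" by (simp add: re)
  ultimately have "Re w * sqrt (Re w) \<le> a\<^sup>2 * a"
    using \<open>Re w \<ge> 0\<close> a by (intro mult_mono) auto
  moreover have "a * (2/5 * a\<^sup>2) \<le> a * (a\<^sup>2 - 3 * b\<^sup>2)"
    using five a by (intro mult_left_mono) auto
  moreover have "Re (w * csqrt w) = a * (a\<^sup>2 - 3 * b\<^sup>2)"
    by (simp add: w re im algebra_simps power2_eq_square)
  ultimately show ?thesis by (simp add: mult_ac)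
qed

lemma integrable_exp_neg_half_line:
  assumes "c > 0"
  shows "integrable lborel (\<lambda>y::real. indicator {..<0} y * exp (c * y))"
proof -
  have "integrable lborel (\<lambda>y. indicator {0<..} y * exp (- (y * c)))"
    using integrable_I0i_exp_mscale[OF assms] by (simp add: set_integrable_def)
  then have "integrable lborel (\<lambda>y. indicator {0<..} (0 + (-1) * y) * exp (- ((0 + (-1) * y) * c)))"
    by (rule lborel_integrable_real_affine) simp
  moreover have "indicator {0<..} (0 + (-1) * y) = (indicator {..<0} y :: real)" for y :: real
    by (simp add: indicator_def)
  ultimately show ?thesis by (simp add: mult.commute)
qed

text \<open>
  The factor \<open>exp (- \<delta> w\<^sup>3\<^sup>/\<^sup>2)\<close> with \<open>w = 1 + (1 + \<i>) z\<close>, which maps the quadrant into the cone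
  \<open>|Im w| \<le> Re w\<close>, beats any exponential growth there, is bounded by 1 and tends to 1 as
  \<open>\<delta> \<rightarrow> 0\<close>. Taking \<open>\<delta> = 1/N\<close> on the triangle of size \<open>R = N\<^sup>4 - 1\<close> makes \<open>\<delta> R\<^sup>3\<^sup>/\<^sup>2 \<approx> N\<^sup>5\<close> dominate \<open>R\<close>,
  so a single limit suffices.
\<close>

lemma quadrant_contour:
  assumes hol: "F holomorphic_on UNIV" and etype: "exp_type_le F \<tau>" and "\<tau> \<ge> 0" "T > \<tau>"
    and int: "integrable lborel (\<lambda>x. F (of_real x))"
  shows "(LINT x|lborel. indicator {0..} x *\<^sub>R (F (of_real x) * cis (- T * x)))
       + \<i> * (LINT y|lborel. indicator {..0} y *\<^sub>R (F (\<i> * of_real y) * of_real (exp (T * y)))) = 0"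
proof -
  \<comment> \<open>Half the gap, so that \<open>\<tau> + \<epsilon> = T - \<epsilon>\<close>: on
    the negative imaginary axis the growth of \<open>F\<close> is beaten with the factor
    \<open>exp (\<epsilon> * y)\<close> to spare.\<close>
  define \<epsilon> where "\<epsilon> = (T - \<tau>) / 2"
  have \<epsilon>: "\<epsilon> > 0" "\<tau> + \<epsilon> = T - \<epsilon>" "T > 0" using assms by (auto simp: \<epsilon>_def field_simps)
  obtain C where C: "\<And>z. norm (F z) \<le> C * exp ((\<tau> + \<epsilon>) * norm z)"
    using etype \<epsilon>(1) unfolding exp_type_le_def by blast
  have C0: "C \<ge> 0" using order_trans[OF norm_ge_zero C[of 0]] by simp
  have contF: "continuous_on UNIV F" using hol holomorphic_on_imp_continuous_on by blast
  have [measurable]: "F \<in> borel_measurable borel" using contF by (rule borel_measurable_continuous_onI)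
  define w where "w z = 1 + (1 + \<i>) * z" for z :: complex
  define m where "m n z = exp (- (of_real (1 / real (Suc n)) * (w z * csqrt (w z))))" for n z
  define H where "H n z = F z * m n z * exp (- \<i> * of_real T * z)" for n z
  define R where "R n = real (Suc n) ^ 4 - 1" for n
  define Q where "Q = {z. Re z \<ge> 0 \<and> Im z \<le> 0}"
  have w_Re: "Re (w z) = 1 + Re z - Im z" for z by (simp add: w_def)
  have w_cone: "\<bar>Im (w z)\<bar> \<le> Re (w z)" if "z \<in> Q" for z
    using that by (auto simp: w_def Q_def)
  have w_pos: "Re (w z) \<ge> 1" if "z \<in> Q" for z
    using that by (auto simp: w_Re Q_def)
  have m_bound: "norm (m n z) \<le> exp (- (1 / real (Suc n) * (2/5 * (Re (w z) * sqrt (Re (w z))))))" if "z \<in> Q" for n z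
  proof -
    have "Re (- (of_real (1 / real (Suc n)) * v)) = - (1 / real (Suc n) * Re v)" for v
      by (simp del: of_nat_Suc)
    then show ?thesis
      using mult_left_mono[OF Re_three_halves_power[OF w_cone[OF that]], of "1 / real (Suc n)"]
      unfolding m_def norm_exp_eq_Re by (simp del: csqrt.simps of_nat_Suc times_complex.sel)
  qed
  have m_le1: "norm (m n z) \<le> 1" if "z \<in> Q" for n z
    using w_pos[OF that] by (intro order_trans[OF m_bound[OF that]]) simp
  have m_lim: "(\<lambda>n. m n z) \<longlonglongrightarrow> 1" for z
  proof -
    have "(\<lambda>n. 1 / real (Suc n)) \<longlonglongrightarrow> 0"
      using LIMSEQ_inverse_real_of_nat by (simp add: inverse_eq_divide)
    then have "(\<lambda>n. m n z) \<longlonglongrightarrow> exp (- (of_real 0 * (w z * csqrt (w z))))"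
      unfolding m_def by (intro tendsto_exp tendsto_minus tendsto_mult tendsto_of_real tendsto_const)
    then show ?thesis by simp
  qed
  have holH: "H n holomorphic_on Q" for n
  proof -
    have "w z \<notin> \<real>\<^sub>\<le>\<^sub>0" if "z \<in> Q" for z
      using w_pos[OF that] by (auto simp: complex_nonpos_Reals_iff)
    moreover have "w holomorphic_on Q"
      unfolding w_def by (intro holomorphic_intros)
    ultimately show ?thesis
      unfolding H_def m_def using holomorphic_on_subset[OF hol, of Q]
      by (intro holomorphic_intros) auto
  qed
  have contH: "continuous_on Q (H n)" for n
    using holH by (rule holomorphic_on_imp_continuous_on)
  have H_bound: "norm (H n z) \<le> norm (F z) * exp (T * Im z)" if "z \<in> Q" for n z
  proof -
    have "norm (exp (- \<i> * of_real T * z)) = exp (T * Im z)"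
      by (simp add: norm_exp_eq_Re)
    moreover have "norm (F z) * norm (m n z) \<le> norm (F z)"
      using m_le1[OF that] by (rule mult_left_le) simp
    ultimately show ?thesis
      unfolding H_def norm_mult by (simp add: mult_right_mono)
  qed
  have R: "R n > 0" if "n > 0" for n
    using that unfolding R_def by simp
  have R_top: "filterlim R at_top sequentially"
    unfolding R_def by real_asymp
  define I1 where "I1 n = (LINT x|lborel. indicator {0..R n} x *\<^sub>R H n (of_real x))" for n
  define I2 where "I2 n = (LINT y|lborel. indicator {-R n..0} y *\<^sub>R H n (\<i> * of_real y))" for n
  define I3 where "I3 n = contour_integral (linepath (of_real (R n)) (- \<i> * of_real (R n))) (H n)" for n
  have c1: "continuous_on {0..R n} (\<lambda>x. H n (of_real x))" for n
    by (rule continuous_on_compose2[OF contH]) (auto intro!: continuous_intros simp: Q_def)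
  have c2: "continuous_on {-R n..0} (\<lambda>y. H n (\<i> * of_real y))" for n
    by (rule continuous_on_compose2[OF contH]) (auto intro!: continuous_intros simp: Q_def)
  have cauchy: "I1 n + I3 n + \<i> * I2 n = 0" if "n > 0" for n
  proof -
    let ?r = "complex_of_real (R n)"
    have "convex Q"
    proof -
      have "Q = {z. Re z \<ge> 0} \<inter> {z. Im z \<le> 0}" by (auto simp: Q_def)
      then show ?thesis by (simp add: convex_Int convex_halfspace_Re_ge convex_halfspace_Im_le)
    qed
    then have "convex hull {0, ?r, - \<i> * ?r} \<subseteq> Q"
      using R[OF that] by (intro hull_minimal) (auto simp: Q_def)
    then have "contour_integral (linepath 0 ?r) (H n) + contour_integral (linepath ?r (- \<i> * ?r)) (H n)
        + contour_integral (linepath (- \<i> * ?r) 0) (H n) = 0"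
      by (intro has_chain_integral_chain_integral3 Cauchy_theorem_triangle holomorphic_on_subset[OF holH])
    moreover have "contour_integral (linepath 0 ?r) (H n) = I1 n"
      using R[OF that] set_borel_integral_eq_integral(2)[OF borel_integrable_atLeastAtMost'[OF c1[of n]]]
      by (subst contour_integral_linepath_Reals_eq) (auto simp: I1_def set_lebesgue_integral_def)
    moreover have "contour_integral (linepath (- \<i> * ?r) 0) (H n) = \<i> * I2 n"
    proof -
      have "Complex 0 y = \<i> * of_real y" for y by (simp add: complex_eq_iff)
      then show ?thesis
        using R[OF that] set_borel_integral_eq_integral(2)[OF borel_integrable_atLeastAtMost'[OF c2[of n]]]
        by (subst contour_integral_linepath_same_Re[where c = 0 and a = "- R n" and b = 0])
          (auto simp: I2_def set_lebesgue_integral_def)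
    qed
    ultimately show ?thesis by (simp add: I3_def)
  qed
  have "I3 \<longlonglongrightarrow> 0"
  proof (rule Lim_null_comparison)
    define B where "B n = C * exp ((\<tau> + \<epsilon>) * R n) * exp (- (2/5 * real (Suc n) ^ 5))" for n
    have "norm (I3 n) \<le> B n * (2 * R n)" if n: "n > 0" for n
    proof -
      let ?r = "complex_of_real (R n)"
      \<comment> \<open>On the hypotenuse \<open>Re z - Im z = R n\<close>, so
        \<open>Re (w z)\<close> is the constant \<open>(n+1)^4\<close>, and the regulariser is at
        most \<open>exp (- 2/5 (n+1)^5)\<close> along the whole segment.\<close>
      have seg: "z \<in> Q" "norm z \<le> R n" "Re (w z) = real (Suc n) ^ 4"
        if "z \<in> closed_segment ?r (- \<i> * ?r)" for z
      proof -
        obtain u where u: "0 \<le> u" "u \<le> 1" and z: "z = (1 - u) *\<^sub>R ?r + u *\<^sub>R (- \<i> * ?r)"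
          using \<open>z \<in> _\<close> unfolding closed_segment_def by blast
        have reim: "Re z = (1 - u) * R n" "Im z = - (u * R n)"
          by (auto simp: z)
        then show "z \<in> Q"
          using u R[OF n] by (simp add: Q_def)
        show "Re (w z) = real (Suc n) ^ 4"
          unfolding w_Re reim R_def by (simp add: algebra_simps)
        have "norm z \<le> norm ((1 - u) *\<^sub>R ?r) + norm (u *\<^sub>R (- \<i> * ?r))"
          unfolding z by (rule norm_triangle_ineq)
        also have "\<dots> = (1 - u) * R n + u * R n"
          using u R[OF n] by (simp add: norm_mult)
        finally show "norm z \<le> R n" by (simp add: algebra_simps)
      qed
      have "norm (I3 n) \<le> B n * norm (- \<i> * ?r - ?r)"
        unfolding I3_def
      proof (rule contour_integral_bound_linepath)
        have "closed_segment ?r (- \<i> * ?r) \<subseteq> Q" using seg(1) by blast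
        then show "H n contour_integrable_on linepath ?r (- \<i> * ?r)"
          by (intro contour_integrable_continuous_linepath continuous_on_subset[OF contH])
        show "0 \<le> B n" using C0 by (simp add: B_def)
        fix z assume z: "z \<in> closed_segment ?r (- \<i> * ?r)"
        have "norm (F z) \<le> C * exp ((\<tau> + \<epsilon>) * R n)"
          using seg(2)[OF z] C0 \<epsilon>(1) \<open>\<tau> \<ge> 0\<close>
          by (intro order_trans[OF C] mult_left_mono) auto
        moreover have "norm (m n z) \<le> exp (- (2/5 * real (Suc n) ^ 5))"
        proof -
          have "sqrt (real (Suc n) ^ 4) = real (Suc n) ^ 2"
            by (rule real_sqrt_unique) (auto simp: power_mult[symmetric] simp del: of_nat_Suc)
          moreover have "1 / real (Suc n) * (2/5 * (real (Suc n) ^ 4 * real (Suc n) ^ 2)) = 2/5 * real (Suc n) ^ 5"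
            by (simp add: field_simps power_numeral_reduce del: of_nat_Suc)
          ultimately show ?thesis
            using m_bound[OF seg(1)[OF z], of n] unfolding seg(3)[OF z] by (simp only:)
        qed
        moreover have "norm (exp (- \<i> * of_real T * z)) \<le> 1"
          using seg(1)[OF z] \<epsilon>(3) by (auto simp: norm_exp_eq_Re Q_def mult_le_0_iff)
        ultimately have "norm (H n z) \<le> B n * 1"
          unfolding H_def norm_mult B_def using C0 by (intro mult_mono) auto
        then show "norm (H n z) \<le> B n" by simp
      qed
      also have "\<dots> \<le> B n * (2 * R n)"
      proof -
        have "norm (- \<i> * ?r - ?r) \<le> norm (- \<i> * ?r) + norm ?r" by (rule norm_triangle_ineq4)
        then show ?thesis
          using R[OF n] C0 by (intro mult_left_mono) (auto simp: norm_mult B_def)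
      qed
      finally show ?thesis .
    qed
    then show "\<forall>\<^sub>F n in sequentially. norm (I3 n) \<le> B n * (2 * R n)"
      using eventually_gt_at_top[of 0] by (rule eventually_mono[rotated])
    have "\<tau> + \<epsilon> > 0" using \<epsilon> \<open>\<tau> \<ge> 0\<close> by simp
    then show "(\<lambda>n. B n * (2 * R n)) \<longlonglongrightarrow> 0"
      unfolding B_def R_def by real_asymp
  qed
  moreover have "I1 \<longlonglongrightarrow> (LINT x|lborel. indicator {0..} x *\<^sub>R (F (of_real x) * cis (- T * x)))"
    unfolding I1_def
  proof (rule integral_dominated_convergence[where w = "\<lambda>x. norm (F (of_real x))"])
    show "(\<lambda>x. indicator {0..R n} x *\<^sub>R H n (of_real x)) \<in> borel_measurable lborel" for n
      using borel_integrable_atLeastAtMost'[OF c1[of n]] unfolding set_integrable_def by (rule borel_measurable_integrable)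
    show "integrable lborel (\<lambda>x. norm (F (of_real x)))" using int by (rule integrable_norm)
    show "AE x in lborel. norm (indicator {0..R n} x *\<^sub>R H n (of_real x)) \<le> norm (F (of_real x))" for n
      using H_bound[of "of_real _" n] by (intro always_eventually) (auto simp: Q_def indicator_def)
    have "(\<lambda>n. indicator {0..R n} x *\<^sub>R H n (of_real x)) \<longlonglongrightarrow> indicator {0..} x *\<^sub>R (F (of_real x) * cis (- T * x))" for x
    proof (intro tendsto_scaleR)
      have "\<forall>\<^sub>F n in sequentially. x \<le> R n"
        using R_top by (simp add: filterlim_at_top)
      then have "\<forall>\<^sub>F n in sequentially. indicator {0..R n} x = (indicator {0..} x :: real)"
        by eventually_elim (auto simp: indicator_def)
      then show "(\<lambda>n. indicator {0..R n} x :: real) \<longlonglongrightarrow> indicator {0..} x"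
        by (rule tendsto_eventually)
      have "(\<lambda>n. H n (of_real x)) \<longlonglongrightarrow> F (of_real x) * 1 * exp (- \<i> * of_real T * of_real x)"
        unfolding H_def by (intro tendsto_intros m_lim)
      then show "(\<lambda>n. H n (of_real x)) \<longlonglongrightarrow> F (of_real x) * cis (- T * x)"
        by (simp add: cis_conv_exp mult.assoc)
    qed
    then show "AE x in lborel. (\<lambda>n. indicator {0..R n} x *\<^sub>R H n (of_real x)) \<longlonglongrightarrow> indicator {0..} x *\<^sub>R (F (of_real x) * cis (- T * x))"
      by simp
  qed measurable
  moreover have "I2 \<longlonglongrightarrow> (LINT y|lborel. indicator {..0} y *\<^sub>R (F (\<i> * of_real y) * of_real (exp (T * y))))"
    unfolding I2_def
  proof (rule integral_dominated_convergence[where w = "\<lambda>y. C * (indicator {..<0} y * exp (\<epsilon> * y))"])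
    show "(\<lambda>y. indicator {-R n..0} y *\<^sub>R H n (\<i> * of_real y)) \<in> borel_measurable lborel" for n
      using borel_integrable_atLeastAtMost'[OF c2[of n]] unfolding set_integrable_def by (rule borel_measurable_integrable)
    show "integrable lborel (\<lambda>y. C * (indicator {..<0} y * exp (\<epsilon> * y)))"
      by (intro integrable_mult_right integrable_exp_neg_half_line \<epsilon>)
    have "norm (H n (\<i> * of_real y)) \<le> C * exp (\<epsilon> * y)" if "y < 0" for n y
    proof -
      have "norm (H n (\<i> * of_real y)) \<le> norm (F (\<i> * of_real y)) * exp (T * y)"
        using H_bound[of "\<i> * of_real y" n] that by (auto simp: Q_def)
      also have "\<dots> \<le> C * exp ((\<tau> + \<epsilon>) * norm (\<i> * of_real y)) * exp (T * y)"
        by (intro mult_right_mono C) auto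
      also have "\<dots> = C * exp (\<epsilon> * y)"
        unfolding \<epsilon>(2) using that by (simp add: norm_mult mult.assoc flip: exp_add) (simp add: algebra_simps)
      finally show ?thesis .
    qed
    \<comment> \<open>The dominating function is 0 at \<open>y = 0\<close>, so that point is
      discarded as a null set.\<close>
    moreover have "AE y in lborel. y \<noteq> (0::real)"
      using AE_lborel_singleton by blast
    ultimately show "AE y in lborel. norm (indicator {-R n..0} y *\<^sub>R H n (\<i> * of_real y)) \<le> C * (indicator {..<0} y * exp (\<epsilon> * y))" for n
      using C0 by (auto simp: indicator_def elim!: eventually_mono)
    have "(\<lambda>n. indicator {-R n..0} y *\<^sub>R H n (\<i> * of_real y)) \<longlonglongrightarrow> indicator {..0} y *\<^sub>R (F (\<i> * of_real y) * of_real (exp (T * y)))" for y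
    proof (intro tendsto_scaleR)
      have "\<forall>\<^sub>F n in sequentially. - y \<le> R n"
        using R_top by (simp add: filterlim_at_top)
      then have "\<forall>\<^sub>F n in sequentially. indicator {-R n..0} y = (indicator {..0} y :: real)"
        by eventually_elim (auto simp: indicator_def)
      then show "(\<lambda>n. indicator {-R n..0} y :: real) \<longlonglongrightarrow> indicator {..0} y"
        by (rule tendsto_eventually)
      have "(\<lambda>n. H n (\<i> * of_real y)) \<longlonglongrightarrow> F (\<i> * of_real y) * 1 * exp (- \<i> * of_real T * (\<i> * of_real y))"
        unfolding H_def by (intro tendsto_intros m_lim)
      moreover have "- \<i> * of_real T * (\<i> * of_real y) = complex_of_real (T * y)"
        by (simp add: complex_eq_iff)
      ultimately show "(\<lambda>n. H n (\<i> * of_real y)) \<longlonglongrightarrow> F (\<i> * of_real y) * of_real (exp (T * y))"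
        by (simp only: exp_of_real[symmetric] mult_1_right)
    qed
    then show "AE y in lborel. (\<lambda>n. indicator {-R n..0} y *\<^sub>R H n (\<i> * of_real y)) \<longlonglongrightarrow> indicator {..0} y *\<^sub>R (F (\<i> * of_real y) * of_real (exp (T * y)))"
      by simp
  qed measurable
  ultimately have "(\<lambda>n. I1 n + I3 n + \<i> * I2 n) \<longlonglongrightarrow>
       (LINT x|lborel. indicator {0..} x *\<^sub>R (F (of_real x) * cis (- T * x))) + 0
       + \<i> * (LINT y|lborel. indicator {..0} y *\<^sub>R (F (\<i> * of_real y) * of_real (exp (T * y))))"
    by (intro tendsto_add tendsto_mult tendsto_const)
  moreover have "(\<lambda>n. I1 n + I3 n + \<i> * I2 n) \<longlonglongrightarrow> 0"
    using cauchy by (intro tendsto_eventually eventually_mono[OF eventually_gt_at_top[of 0]])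
  ultimately show ?thesis
    using LIMSEQ_unique[of _ _ 0] by (simp only: add_0_right)
qed

lemma holomorphic_reflect:
  assumes "F holomorphic_on UNIV"
  shows "(\<lambda>z. F (-z)) holomorphic_on UNIV"
proof -
  have "(\<lambda>z::complex. -z) holomorphic_on UNIV" by (intro holomorphic_intros)
  from holomorphic_on_compose_gen[OF this assms] show ?thesis by (simp add: o_def)
qed

text \<open>The left quadrant is reduced to the right one by \<open>G z = cnj (F (- cnj z))\<close>,
  the reflection in the imaginary axis. It preserves type and integrability and equals
  \<open>cnj F\<close> on that axis, so the two half lines rotate to the same integral
  \<open>?Y\<close> with opposite signs and cancel.\<close>

lemma exp_type_transform_vanishes_pos:
  assumes hol: "F holomorphic_on UNIV" and etype: "exp_type_le F \<tau>" and T: "\<tau> \<ge> 0" "T > \<tau>"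
    and int: "integrable lborel (\<lambda>x. F (of_real x))"
  shows "(LINT x|lborel. F (of_real x) * cis (- T * x)) = 0"
proof -
  define G where "G = cnj \<circ> (\<lambda>z. F (-z)) \<circ> cnj"
  have "(\<lambda>z. F (-z)) holomorphic_on cnj ` UNIV"
    by (rule holomorphic_on_subset[OF holomorphic_reflect[OF hol] subset_UNIV])
  then have holG: "G holomorphic_on UNIV"
    unfolding G_def by (rule holomorphic_on_compose_cnj_cnj) simp
  have typG: "exp_type_le G \<tau>"
    unfolding exp_type_le_def
  proof (intro allI impI)
    fix \<epsilon> :: real assume "\<epsilon> > 0"
    then obtain C where "\<And>z. norm (F z) \<le> C * exp ((\<tau> + \<epsilon>) * norm z)"
      using etype unfolding exp_type_le_def by blast
    from this[of "- cnj _"] have "norm (G z) \<le> C * exp ((\<tau> + \<epsilon>) * norm z)" for z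
      by (simp add: G_def)
    then show "\<exists>C. \<forall>z. norm (G z) \<le> C * exp ((\<tau> + \<epsilon>) * norm z)" by blast
  qed
  have "integrable lborel (\<lambda>x. F (of_real (0 + (-1) * x)))"
    using lborel_integrable_real_affine[OF int, of "-1" 0] by simp
  then have intG: "integrable lborel (\<lambda>x. G (of_real x))"
    by (simp add: G_def)
  have intc: "integrable lborel (\<lambda>x. F (of_real x) * cis (- T * x))"
    by (rule integrable_mult_cis[OF int])
  let ?P = "LINT x|lborel. indicator {0..} x *\<^sub>R (F (of_real x) * cis (- T * x))"
  let ?N = "LINT x|lborel. indicator {..0} x *\<^sub>R (F (of_real x) * cis (- T * x))"
  let ?Y = "LINT y|lborel. indicator {..0} y *\<^sub>R (F (\<i> * of_real y) * of_real (exp (T * y)))"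
  have "?N = \<bar>-1\<bar> *\<^sub>R (LINT x|lborel. indicator {..0} (0 + (-1) * x) *\<^sub>R (F (of_real (0 + (-1) * x)) * cis (- T * (0 + (-1) * x))))"
    by (rule lborel_integral_real_affine) simp
  also have "\<dots> = (LINT x|lborel. cnj (indicator {0..} x *\<^sub>R (G (of_real x) * cis (- T * x))))"
  proof -
    have "indicator {..0} (0 + (-1) * x) *\<^sub>R (F (of_real (0 + (-1) * x)) * cis (- T * (0 + (-1) * x)))
        = cnj (indicator {0..} x *\<^sub>R (G (of_real x) * cis (- T * x)))" for x
      by (simp add: G_def cis_cnj indicator_def)
    then show ?thesis by (simp only: abs_minus_cancel abs_one scaleR_one)
  qed
  also have "\<dots> = cnj (LINT x|lborel. indicator {0..} x *\<^sub>R (G (of_real x) * cis (- T * x)))"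
    by (rule Bochner_Integration.integral_cnj)
  also have "\<dots> = cnj (- (\<i> * (LINT y|lborel. indicator {..0} y *\<^sub>R (G (\<i> * of_real y) * of_real (exp (T * y))))))"
    by (rule arg_cong[where f = cnj]) (use quadrant_contour[OF holG typG T intG] in \<open>simp only: eq_neg_iff_add_eq_0\<close>)
  also have "\<dots> = \<i> * (LINT y|lborel. cnj (indicator {..0} y *\<^sub>R (G (\<i> * of_real y) * of_real (exp (T * y)))))"
    unfolding Bochner_Integration.integral_cnj by simp
  also have "\<dots> = \<i> * ?Y"
  proof -
    have "cnj (indicator {..0} y *\<^sub>R (G (\<i> * of_real y) * of_real (exp (T * y))))
        = indicator {..0} y *\<^sub>R (F (\<i> * of_real y) * of_real (exp (T * y)))" for y
      by (simp add: G_def)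
    then show ?thesis by (simp only:)
  qed
  finally have N: "?N = \<i> * ?Y" .
  have AE0: "AE x in lborel. x \<noteq> (0::real)"
    using AE_lborel_singleton by blast
  note [measurable] = borel_measurable_integrable[OF intc]
  have "(LINT x|lborel. F (of_real x) * cis (- T * x))
     = (LINT x|lborel. indicator {0..} x *\<^sub>R (F (of_real x) * cis (- T * x)) + indicator {..0} x *\<^sub>R (F (of_real x) * cis (- T * x)))"
  proof (rule integral_cong_AE)
    show "AE x in lborel. F (of_real x) * cis (- T * x)
        = indicator {0..} x *\<^sub>R (F (of_real x) * cis (- T * x)) + indicator {..0} x *\<^sub>R (F (of_real x) * cis (- T * x))"
      using AE0 by eventually_elim (simp add: indicator_def)
  qed measurable
  also have "\<dots> = ?P + ?N"
    by (intro Bochner_Integration.integral_add integrable_mult_indicator intc) auto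
  also have "\<dots> = 0"
    using quadrant_contour[OF hol etype T int] unfolding N .
  finally show ?thesis .
qed

lemma exp_type_le_reflect: "exp_type_le F \<tau> \<Longrightarrow> exp_type_le (\<lambda>z. F (-z)) \<tau>"
  unfolding exp_type_le_def
proof (intro allI impI)
  fix \<epsilon> :: real assume *: "\<forall>\<epsilon>>0. \<exists>C. \<forall>z. norm (F z) \<le> C * exp ((\<tau> + \<epsilon>) * norm z)" and "\<epsilon> > 0"
  then obtain C where C: "\<And>z. norm (F z) \<le> C * exp ((\<tau> + \<epsilon>) * norm z)" by blast
  have "norm (F (-z)) \<le> C * exp ((\<tau> + \<epsilon>) * norm z)" for z
    using C[of "-z"] by simp
  then show "\<exists>C. \<forall>z. norm (F (-z)) \<le> C * exp ((\<tau> + \<epsilon>) * norm z)" by blast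
qed

text \<open>Negative frequencies decay in the lower half plane and are already settled;
  \<open>z -> -z\<close> turns positive ones into them.\<close>

theorem exp_type_transform_vanishes:
  assumes hol: "F holomorphic_on UNIV" and etype: "exp_type_le F \<tau>" and T: "\<tau> \<ge> 0" "\<bar>T\<bar> > \<tau>"
    and int: "integrable lborel (\<lambda>x. F (of_real x))"
  shows "(LINT x|lborel. F (of_real x) * cis (T * x)) = 0"
proof (cases "T < 0")
  case True
  then show ?thesis
    using exp_type_transform_vanishes_pos[OF hol etype T(1), of "-T"] int T by simp
next
  case False
  have "(\<lambda>z. F (-z)) holomorphic_on UNIV"
    by (rule holomorphic_reflect[OF hol])
  moreover have "integrable lborel (\<lambda>x. F (- of_real x))"
    using lborel_integrable_real_affine[OF int, of "-1" 0] by simp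
  ultimately have "(LINT x|lborel. F (- of_real x) * cis (- T * x)) = 0"
    using exp_type_transform_vanishes_pos[OF _ exp_type_le_reflect[OF etype] T(1), of T] False T by simp
  moreover have "(LINT x|lborel. F (of_real x) * cis (T * x))
     = \<bar>-1\<bar> *\<^sub>R (LINT x|lborel. F (of_real (0 + (-1) * x)) * cis (T * (0 + (-1) * x)))"
    by (rule lborel_integral_real_affine) simp
  ultimately show ?thesis by simp
qed

section \<open>Fourier inversion for integrable functions\<close>

text \<open>From \<open>exp x >= x\<close>: off the origin the density is \<open>O(\<sigma>)\<close>
  with a constant that depends only on the distance to 0. This controls tails.\<close>

lemma normal_density_le:
  assumes "\<sigma> > 0" "y \<noteq> 0"
  shows "normal_density 0 \<sigma> y \<le> 2 * \<sigma> / y\<^sup>2"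
proof -
  have "y\<^sup>2 / (2 * \<sigma>\<^sup>2) \<le> exp (y\<^sup>2 / (2 * \<sigma>\<^sup>2))"
    using exp_ge_add_one_self[of "y\<^sup>2 / (2 * \<sigma>\<^sup>2)"] by linarith
  then have "exp (- (y\<^sup>2 / (2 * \<sigma>\<^sup>2))) \<le> 2 * \<sigma>\<^sup>2 / y\<^sup>2"
    using assms by (simp add: exp_minus field_simps)
  moreover have "1 / sqrt (2 * pi * \<sigma>\<^sup>2) \<le> 1 / \<sigma>"
  proof -
    have "1 \<le> sqrt (2 * pi)" using pi_gt3 by simp
    then show ?thesis using assms by (simp add: real_sqrt_mult field_simps)
  qed
  ultimately have "normal_density 0 \<sigma> y \<le> (1 / \<sigma>) * (2 * \<sigma>\<^sup>2 / y\<^sup>2)"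
    unfolding normal_density_def using assms by (intro mult_mono) auto
  also have "\<dots> = 2 * \<sigma> / y\<^sup>2" using assms by (simp add: power2_eq_square)
  finally show ?thesis .
qed

text \<open>Here \<open>h\<close> may be unbounded. Near 0 continuity bounds it and the bounded
  version applies; at distance \<open>\<delta>\<close> and beyond the density is at most
  \<open>2 \<sigma> / \<delta>^2\<close>, so that part tends to 0. The assumption
  \<open>\<sigma> n \<le> 1\<close> makes the dominating function independent of
  \<open>n\<close>.\<close>

lemma approx_identity_integrable:
  fixes h :: "real \<Rightarrow> complex"
  assumes h: "integrable lborel h" and cont: "isCont h 0"
    and \<sigma>: "\<sigma> \<longlonglongrightarrow> 0" "\<And>n. \<sigma> n > 0" "\<And>n. \<sigma> n \<le> 1"
  shows "(\<lambda>n. LINT y|lborel. h y * of_real (normal_density 0 (\<sigma> n) y)) \<longlonglongrightarrow> h 0"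
proof -
  note [measurable] = borel_measurable_integrable[OF h, simplified]
  from cont obtain \<delta> where \<delta>: "\<delta> > 0" "\<And>y. \<bar>y\<bar> < \<delta> \<Longrightarrow> norm (h y - h 0) < 1"
    unfolding continuous_at_eps_delta dist_norm real_norm_def by (metis diff_zero zero_less_one)
  define near where "near y = indicator {-\<delta><..<\<delta>} y *\<^sub>R h y" for y
  define far where "far y = indicator (- {-\<delta><..<\<delta>}) y *\<^sub>R h y" for y
  have [measurable]: "near \<in> borel_measurable borel" "far \<in> borel_measurable borel"
    unfolding near_def far_def by measurable
  have near_bdd: "norm (near y) \<le> norm (h 0) + 1" for y
  proof (cases "\<bar>y\<bar> < \<delta>")
    case True
    then have "norm (h y) \<le> norm (h 0) + 1"
      using \<delta>(2)[of y] norm_triangle_ineq2[of "h y" "h 0"] by linarith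
    then show ?thesis by (simp add: near_def indicator_def)
  next
    case False
    then have "y \<notin> {-\<delta><..<\<delta>}" by auto
    then show ?thesis by (simp add: near_def add_nonneg_nonneg)
  qed
  have "(\<lambda>n. LINT y|lborel. near y * of_real (normal_density 0 (\<sigma> n) y)) \<longlonglongrightarrow> near 0"
  proof (rule approx_identity_bounded[OF _ near_bdd _ \<sigma>(1,2)])
    have "\<forall>\<^sub>F y in nhds 0. y \<in> {-\<delta><..<\<delta>}"
      using \<delta>(1) by (intro eventually_nhds_in_open) auto
    then have "\<forall>\<^sub>F y in nhds 0. near y = h y"
      by eventually_elim (simp add: near_def)
    then show "isCont near 0"
      using cont by (simp add: isCont_cong)
  qed measurable
  moreover have "(\<lambda>n. LINT y|lborel. far y * of_real (normal_density 0 (\<sigma> n) y)) \<longlonglongrightarrow> (LINT (y::real)|lborel. 0)"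
  proof (rule integral_dominated_convergence[where w = "\<lambda>y. norm (h y) * (2 / \<delta>\<^sup>2)"])
    show "integrable lborel (\<lambda>y. norm (h y) * (2 / \<delta>\<^sup>2))"
      using h by (intro integrable_mult_left integrable_norm)
    have bound: "norm (far y * of_real (normal_density 0 (\<sigma> n) y)) \<le> norm (h y) * (2 / \<delta>\<^sup>2 * \<sigma> n)" for y n
    proof (cases "\<bar>y\<bar> < \<delta>")
      case True
      then have "far y = 0" by (simp add: far_def abs_less_iff)
      then show ?thesis using \<sigma>(2)[of n] by simp
    next
      case False
      then have y: "y \<noteq> 0" "\<delta>\<^sup>2 \<le> y\<^sup>2" using \<delta>(1) by (auto simp: abs_le_square_iff[symmetric])
      have "normal_density 0 (\<sigma> n) y \<le> 2 * \<sigma> n / y\<^sup>2"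
        by (rule normal_density_le) (use \<sigma>(2) y in auto)
      also have "\<dots> \<le> 2 * \<sigma> n / \<delta>\<^sup>2"
        using y \<delta>(1) \<sigma>(2)[of n] by (intro divide_left_mono) auto
      finally have "normal_density 0 (\<sigma> n) y \<le> 2 / \<delta>\<^sup>2 * \<sigma> n" by simp
      moreover have "norm (far y) \<le> norm (h y)" by (simp add: far_def indicator_def)
      moreover have "norm (far y * of_real (normal_density 0 (\<sigma> n) y)) = norm (far y) * normal_density 0 (\<sigma> n) y"
        by (simp add: norm_mult)
      ultimately show ?thesis
        by (metis mult_mono norm_ge_zero normal_density_nonneg)
    qed
    show "AE y in lborel. norm (far y * of_real (normal_density 0 (\<sigma> n) y)) \<le> norm (h y) * (2 / \<delta>\<^sup>2)" for n
    proof (intro always_eventually allI)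
      fix y
      have "2 / \<delta>\<^sup>2 * \<sigma> n \<le> 2 / \<delta>\<^sup>2 * 1" using \<sigma>(3)[of n] \<delta>(1) by (intro mult_left_mono) auto
      then show "norm (far y * of_real (normal_density 0 (\<sigma> n) y)) \<le> norm (h y) * (2 / \<delta>\<^sup>2)"
        by (intro order_trans[OF bound] mult_left_mono) simp_all
    qed
    have "(\<lambda>n. norm (h y) * (2 / \<delta>\<^sup>2 * \<sigma> n)) \<longlonglongrightarrow> norm (h y) * (2 / \<delta>\<^sup>2 * 0)" for y
      using \<sigma>(1) by (intro tendsto_intros)
    then have lim0: "(\<lambda>n. norm (h y) * (2 / \<delta>\<^sup>2 * \<sigma> n)) \<longlonglongrightarrow> 0" for y
      by (simp only: mult_zero_right)
    have "(\<lambda>n. far y * of_real (normal_density 0 (\<sigma> n) y)) \<longlonglongrightarrow> 0" for y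
      by (rule Lim_null_comparison[OF _ lim0]) (rule always_eventually, rule allI, rule bound)
    then show "AE y in lborel. (\<lambda>n. far y * of_real (normal_density 0 (\<sigma> n) y)) \<longlonglongrightarrow> 0"
      by simp
  qed measurable
  ultimately have "(\<lambda>n. (LINT y|lborel. near y * of_real (normal_density 0 (\<sigma> n) y))
      + (LINT y|lborel. far y * of_real (normal_density 0 (\<sigma> n) y))) \<longlonglongrightarrow> near 0 + (LINT (y::real)|lborel. 0)"
    by (rule tendsto_add)
  moreover have "(LINT y|lborel. near y * of_real (normal_density 0 (\<sigma> n) y))
      + (LINT y|lborel. far y * of_real (normal_density 0 (\<sigma> n) y)) = (LINT y|lborel. h y * of_real (normal_density 0 (\<sigma> n) y))" for n
  proof -
    have hN: "integrable lborel (\<lambda>y. h y * of_real (normal_density 0 (\<sigma> n) y))"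
    proof (rule Bochner_Integration.integrable_bound)
      show "integrable lborel (\<lambda>y. norm (h y) * (1 / sqrt (2 * pi * (\<sigma> n)\<^sup>2)))"
        using h by (intro integrable_mult_left integrable_norm)
      have "normal_density 0 (\<sigma> n) y \<le> 1 / sqrt (2 * pi * (\<sigma> n)\<^sup>2)" for y
        unfolding normal_density_def by (rule mult_left_le) simp_all
      then show "AE y in lborel. norm (h y * of_real (normal_density 0 (\<sigma> n) y)) \<le> norm (norm (h y) * (1 / sqrt (2 * pi * (\<sigma> n)\<^sup>2)))"
      proof (intro always_eventually allI)
        fix y
        have "norm (h y * of_real (normal_density 0 (\<sigma> n) y)) = norm (h y) * normal_density 0 (\<sigma> n) y"
          by (simp add: norm_mult)
        also have "\<dots> \<le> norm (h y) * (1 / sqrt (2 * pi * (\<sigma> n)\<^sup>2))"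
          by (rule mult_left_mono) (fact, simp)
        finally show "norm (h y * of_real (normal_density 0 (\<sigma> n) y)) \<le> norm (norm (h y) * (1 / sqrt (2 * pi * (\<sigma> n)\<^sup>2)))"
          unfolding real_norm_def by linarith
      qed
    qed measurable
    have "integrable lborel (\<lambda>y. near y * of_real (normal_density 0 (\<sigma> n) y))"
      using integrable_mult_indicator[OF _ hN, of "{-\<delta><..<\<delta>}"] by (simp add: near_def)
    moreover have "integrable lborel (\<lambda>y. far y * of_real (normal_density 0 (\<sigma> n) y))"
      using integrable_mult_indicator[OF _ hN, of "- {-\<delta><..<\<delta>}"] by (simp add: far_def)
    moreover have "near y * of_real (normal_density 0 (\<sigma> n) y) + far y * of_real (normal_density 0 (\<sigma> n) y)
        = h y * of_real (normal_density 0 (\<sigma> n) y)" for y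
      by (simp add: near_def far_def indicator_def)
    ultimately show ?thesis
      by (simp add: Bochner_Integration.integral_add[symmetric] del: Bochner_Integration.integral_add)
  qed
  ultimately show ?thesis
    using \<delta>(1) by (simp add: near_def)
qed

text \<open>Since \<open>fourier\<close> has the positive sign in its exponent,
  \<open>fourier F (-t)\<close> is the analysing transform. With a Gaussian factor the inversion
  integral is an average of \<open>F\<close> around \<open>x\<close> against a normal density;
  integrability of the transform allows the factor to be removed.\<close>

theorem fourier_inversion:
  assumes F: "integrable lborel F" and cont: "isCont F x" and f: "integrable lborel (\<lambda>t. fourier F (-t))"
  shows "fourier (\<lambda>t. fourier F (-t)) x = F x"
proof -
  note [measurable] = borel_measurable_integrable[OF F, simplified]
  define \<sigma> where "\<sigma> n = 1 / real (Suc n)" for n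
  have \<sigma>: "\<sigma> n > 0" "\<sigma> n \<le> 1" "\<sigma> \<longlonglongrightarrow> 0" for n
    unfolding \<sigma>_def using LIMSEQ_inverse_real_of_nat by (auto simp: inverse_eq_divide)
  let ?A = "\<lambda>n. LINT t|lborel. fourier F (-t) * cis (2 * pi * x * t) * of_real (gauss (\<sigma> n) t)"
  have "?A \<longlonglongrightarrow> fourier (\<lambda>t. fourier F (-t)) x"
    unfolding fourier_def[of "\<lambda>t. fourier F (-t)"]
  proof (rule integral_dominated_convergence[where w = "\<lambda>t. norm (fourier F (-t))"])
    show "integrable lborel (\<lambda>t. norm (fourier F (-t)))" using f by (rule integrable_norm)
    have "(\<lambda>n. fourier F (-t) * cis (2 * pi * x * t) * of_real (gauss (\<sigma> n) t)) \<longlonglongrightarrow> fourier F (-t) * cis (2 * pi * x * t) * of_real 1" for t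
      by (intro tendsto_intros gauss_tendsto_1 \<sigma>)
    then show "AE t in lborel. (\<lambda>n. fourier F (-t) * cis (2 * pi * x * t) * of_real (gauss (\<sigma> n) t)) \<longlonglongrightarrow> fourier F (-t) * cis (2 * pi * x * t)"
      by simp
    show "AE t in lborel. norm (fourier F (-t) * cis (2 * pi * x * t) * of_real (gauss (\<sigma> n) t)) \<le> norm (fourier F (-t))" for n
      using gauss_bounds by (intro always_eventually) (auto simp: norm_mult intro!: mult_right_le_one_le)
  qed measurable
  moreover have "?A = (\<lambda>n. LINT y|lborel. F (x + y) * of_real (normal_density 0 (\<sigma> n) y))"
  proof
    fix n
    have G: "integrable lborel (\<lambda>t. complex_of_real (gauss (\<sigma> n) t))"
      using integrable_gauss[OF \<sigma>(1)] by simp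
    have "?A n = \<bar>-1\<bar> *\<^sub>R (LINT t|lborel. fourier F (- (0 + (-1) * t)) * cis (2 * pi * x * (0 + (-1) * t)) * of_real (gauss (\<sigma> n) (0 + (-1) * t)))"
      by (rule lborel_integral_real_affine) simp
    also have "\<dots> = (LINT t|lborel. fourier F t * (of_real (gauss (\<sigma> n) t) * cis (2 * pi * (-x) * t)))"
      by (simp add: gauss_minus mult_ac)
    also have "\<dots> = (LINT y|lborel. F y * fourier (\<lambda>t. of_real (gauss (\<sigma> n) t) * cis (2 * pi * (-x) * t)) y)"
      by (rule fourier_multiplication[OF F integrable_mult_cis[OF G]])
    also have "\<dots> = (LINT y|lborel. F y * of_real (normal_density 0 (\<sigma> n) (-x + y)))"
      unfolding fourier_gauss_modulated[OF \<sigma>(1)] ..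
    also have "\<dots> = \<bar>1\<bar> *\<^sub>R (LINT y|lborel. F (x + 1 * y) * of_real (normal_density 0 (\<sigma> n) (-x + (x + 1 * y))))"
      by (rule lborel_integral_real_affine) simp
    finally show "?A n = (LINT y|lborel. F (x + y) * of_real (normal_density 0 (\<sigma> n) y))" by simp
  qed
  moreover have "(\<lambda>n. LINT y|lborel. F (x + y) * of_real (normal_density 0 (\<sigma> n) y)) \<longlonglongrightarrow> F (x + 0)"
  proof (rule approx_identity_integrable)
    show "integrable lborel (\<lambda>y. F (x + y))"
      using lborel_integrable_real_affine[OF F, of 1 x] by simp
    show "isCont (\<lambda>y. F (x + y)) 0"
      by (rule isCont_o2[of 0 "\<lambda>y. x + y" F]) (use cont in \<open>auto intro!: continuous_intros\<close>)
  qed (use \<sigma> in auto)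
  ultimately have "F (x + 0) = fourier (\<lambda>t. fourier F (-t)) x"
    by (simp only:) (rule LIMSEQ_unique)
  then show ?thesis by simp
qed

section \<open>Transforms of bandlimited functions as members of the Paley--Wiener space\<close>

text \<open>\<open>fourier\<close> continued to complex arguments; it supplies the concrete entire
  functions used below, the cutoff and the extremal functions.\<close>

definition ft :: "(real \<Rightarrow> complex) \<Rightarrow> complex \<Rightarrow> complex" where
  "ft f z = (LINT t|lborel. f t * exp (2 * of_real pi * \<i> * of_real t * z))"

lemma ft_of_real: "ft f (of_real x) = fourier f x"
  by (simp add: ft_def fourier_def cis_conv_exp mult_ac)

text \<open>Jumps can occur only at the two ends of the band.\<close>

lemma AE_isCont_bandlimit:
  assumes "bandlimit a f" "continuous_on {-a..a} f"
  shows "AE t in lborel. isCont f t"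
proof -
  have "isCont f t" if "t \<noteq> -a" "t \<noteq> a" for t
  proof (cases "-a < t \<and> t < a")
    case True
    then show ?thesis
      using assms(2) by (intro continuous_on_interior) auto
  next
    case False
    then have "t \<in> - {-a..a}" using that by auto
    then have "\<forall>\<^sub>F u in nhds t. u \<in> - {-a..a}"
      by (intro eventually_nhds_in_open) auto
    then have "\<forall>\<^sub>F u in nhds t. f u = 0"
    proof eventually_elim
      case (elim u)
      then have "\<bar>u\<bar> > a" by auto
      then show ?case using assms(1) by (simp add: bandlimit_def)
    qed
    from isCont_cong[OF this] show ?thesis by simp
  qed
  note cont = this
  show ?thesis
    using AE_lborel_singleton[of "-a"] AE_lborel_singleton[of a] by eventually_elim (rule cont)
qed

text \<open>The easy half of Paley--Wiener. Continuity on the closed band allows the integral to be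
  rewritten over a compact interval and differentiated under the integral sign;
  \<open>|t| <= a\<close> bounds the exponential factor by \<open>exp (2 pi a |z|)\<close>.\<close>

lemma ft_in_PW:
  assumes f: "bandlimit a f" and cont: "continuous_on {-a..a} f" and "a \<ge> 0"
  shows "ft f \<in> PW (2 * pi * a)"
proof -
  let ?h = "\<lambda>z t. f t * exp (2 * of_real pi * \<i> * of_real t * z)"
  obtain M where M: "M \<ge> 0" "\<And>t. norm (f t) \<le> M" "\<And>t. norm (f t) \<le> M * indicator {-a..a} t"
    using bandlimit_dominated[OF f] by metis
  have eq: "ft f z = integral (cbox (-a) a) (?h z)" for z
  proof -
    have c: "continuous_on {-a..a} (?h z)"
      by (intro continuous_intros cont)
    have "ft f z = (LINT t:{-a..a}|lborel. ?h z t)"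
      unfolding ft_def set_lebesgue_integral_def
    proof (rule Bochner_Integration.integral_cong)
      fix t
      show "?h z t = indicator {-a..a} t *\<^sub>R ?h z t"
        using M(3)[of t] by (cases "t \<in> {-a..a}") auto
    qed simp
    then show ?thesis
      using set_borel_integral_eq_integral(2)[OF borel_integrable_atLeastAtMost'[OF c]] by simp
  qed
  have "(\<lambda>z. integral (cbox (-a) a) (?h z)) holomorphic_on UNIV"
  proof (rule leibniz_rule_holomorphic)
    show "((\<lambda>z. ?h z t) has_field_derivative ?h z t * (2 * of_real pi * \<i> * of_real t)) (at z within UNIV)" for z t
      by (auto intro!: derivative_eq_intros)
    show "?h z integrable_on cbox (-a) a" for z
      by (intro integrable_continuous) (auto intro!: continuous_intros cont)
    have "continuous_on (UNIV \<times> cbox (-a) a) (\<lambda>p. f (snd p) * exp (2 * of_real pi * \<i> * of_real (snd p) * fst p) * (2 * of_real pi * \<i> * of_real (snd p)))"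
      by (intro continuous_intros continuous_on_compose2[OF cont]) auto
    then show "continuous_on (UNIV \<times> cbox (-a) a) (\<lambda>(z,t). ?h z t * (2 * of_real pi * \<i> * of_real t))"
      by (simp add: case_prod_beta)
  qed auto
  then have hol: "ft f holomorphic_on UNIV"
    by (simp only: eq[abs_def])
  have bound0: "norm (ft f z) \<le> (M * (2 * a)) * exp ((2 * pi * a) * norm z)" for z
  proof -
    have "norm (ft f z) \<le> (LINT t|lborel. norm (?h z t))"
      unfolding ft_def by (rule integral_norm_bound)
    also have "\<dots> \<le> (LINT t|lborel. (M * exp ((2 * pi * a) * norm z)) * indicator {-a..a} t)"
    proof (rule Bochner_Integration.integral_mono')
      show "integrable lborel (\<lambda>t. (M * exp ((2 * pi * a) * norm z)) * indicator {-a..a} t)"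
        by (rule integrable_indicator_interval)
      fix t
      show "norm (?h z t) \<le> (M * exp ((2 * pi * a) * norm z)) * indicator {-a..a} t"
      proof (cases "t \<in> {-a..a}")
        case True
        then have "2 * pi * \<bar>t\<bar> \<le> 2 * pi * a" by auto
        then have "norm (2 * of_real pi * \<i> * of_real t * z) \<le> 2 * pi * a * norm z"
          unfolding norm_mult by (simp add: mult_right_mono)
        then have "norm (exp (2 * of_real pi * \<i> * of_real t * z)) \<le> exp (2 * pi * a * norm z)"
          by (intro order_trans[OF norm_exp]) simp
        then show ?thesis
          unfolding norm_mult[of "f t"] using True M by (simp add: mult_mono)
      next
        case False
        then show ?thesis using M(3)[of t] by simp
      qed
    qed (use M in auto)
    also have "\<dots> = (M * (2 * a)) * exp ((2 * pi * a) * norm z)"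
      using \<open>a \<ge> 0\<close> by simp
    finally show ?thesis .
  qed
  have "norm (ft f z) \<le> (M * (2 * a)) * exp ((2 * pi * a + \<epsilon>) * norm z)" if "\<epsilon> > 0" for z \<epsilon>
  proof -
    have "exp ((2 * pi * a) * norm z) \<le> exp ((2 * pi * a + \<epsilon>) * norm z)"
      using that by (simp add: mult_right_mono)
    then have "(M * (2 * a)) * exp ((2 * pi * a) * norm z) \<le> (M * (2 * a)) * exp ((2 * pi * a + \<epsilon>) * norm z)"
      using M(1) \<open>a \<ge> 0\<close> by (intro mult_left_mono) auto
    then show ?thesis
      using bound0[of z] by linarith
  qed
  then have "exp_type_le (ft f) (2 * pi * a)"
    unfolding exp_type_le_def by blast
  then show ?thesis
    using hol fourier_square_integrable[OF f] by (simp add: PW_def ft_of_real)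
qed

text \<open>\<open>form f\<close> is \<open>\<parallel>F\<parallel>\<^sub>W\<^sup>2 - \<parallel>F\<parallel>\<^sup>2\<close> expressed through the spectral side \<open>f\<close>.\<close>

definition form :: "(real \<Rightarrow> complex) \<Rightarrow> real" where
  "form f = (norm (LINT t|lborel. f t))\<^sup>2 - Re (LINT t|lborel. f t * cnj (LINT s|lborel. half_box t s * f s))"

lemma abs_sinc_le_1: "\<bar>sin y / y\<bar> \<le> (1::real)"
  using abs_sin_x_le_abs_x[of y] by (cases "y = 0") (auto simp: abs_divide)

text \<open>The delta in the weight contributes \<open>|F 0|^2\<close>, and \<open>F 0\<close> is
  the integral of \<open>f\<close>; the sinc has been moved to the spectral side. Only values on the
  real line enter, so the lemma serves both for \<open>ft f\<close> and for functions recovered by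
  Paley--Wiener.\<close>

lemma norms_of_transform:
  assumes f: "bandlimit a f" and cont: "AE t in lborel. isCont f t" and F: "\<And>x. F (of_real x) = fourier f x"
  shows "L2_sq F = (LINT t|lborel. (norm (f t))\<^sup>2)" and "LW_sq F = L2_sq F + form f"
proof -
  note [measurable] = bandlimit_measurable[OF f]
  show L2: "L2_sq F = (LINT t|lborel. (norm (f t))\<^sup>2)"
    unfolding L2_sq_def F by (rule fourier_plancherel[OF f cont])
  let ?s = "\<lambda>x. sin (2 * pi * x) / (2 * pi * x)"
  have int: "integrable lborel (\<lambda>x. (norm (fourier f x))\<^sup>2)"
    by (rule fourier_square_integrable[OF f])
  have ints: "integrable lborel (\<lambda>x. (norm (fourier f x))\<^sup>2 * ?s x)"
  proof (rule Bochner_Integration.integrable_bound[OF int])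
    show "AE x in lborel. norm ((norm (fourier f x))\<^sup>2 * ?s x) \<le> norm ((norm (fourier f x))\<^sup>2)"
    proof (intro always_eventually allI)
      fix x
      have "norm ((norm (fourier f x))\<^sup>2 * ?s x) = (norm (fourier f x))\<^sup>2 * \<bar>?s x\<bar>"
        by (simp only: real_norm_def abs_mult abs_power2)
      also have "\<dots> \<le> (norm (fourier f x))\<^sup>2"
        by (rule mult_left_le[OF abs_sinc_le_1]) simp
      finally show "norm ((norm (fourier f x))\<^sup>2 * ?s x) \<le> norm ((norm (fourier f x))\<^sup>2)" by simp
    qed
  qed measurable
  have "F 0 = (LINT t|lborel. f t)"
    using F[of 0] by (simp add: fourier_def)
  moreover have "(LINT x|lborel. (norm (fourier f x))\<^sup>2 * (1 - ?s x)) = L2_sq F - (LINT x|lborel. (norm (fourier f x))\<^sup>2 * ?s x)"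
    unfolding L2_sq_def F right_diff_distrib mult_1_right by (rule Bochner_Integration.integral_diff[OF int ints])
  moreover have "(LINT x|lborel. (norm (fourier f x))\<^sup>2 * ?s x) = Re (LINT t|lborel. f t * cnj (LINT s|lborel. half_box t s * f s))"
    unfolding fourier_sinc_weight[OF f cont, symmetric] by simp
  ultimately show "LW_sq F = L2_sq F + form f"
    unfolding LW_sq_def F form_def by simp
qed

lemma isCont_fourier:
  assumes "integrable lborel g"
  shows "isCont (fourier g) x"
  unfolding continuous_at_sequentially o_def
proof (intro allI impI)
  fix X assume X: "X \<longlonglongrightarrow> x"
  note [measurable] = borel_measurable_integrable[OF assms, simplified]
  show "(\<lambda>n. fourier g (X n)) \<longlonglongrightarrow> fourier g x"
    unfolding fourier_def
  proof (rule integral_dominated_convergence[where w = "\<lambda>t. norm (g t)"])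
    have "(\<lambda>n. g t * cis (2 * pi * X n * t)) \<longlonglongrightarrow> g t * cis (2 * pi * x * t)" for t
      by (intro tendsto_intros X)
    then show "AE t in lborel. (\<lambda>n. g t * cis (2 * pi * X n * t)) \<longlonglongrightarrow> g t * cis (2 * pi * x * t)"
      by simp
  qed (use assms in \<open>auto simp: norm_mult\<close>)
qed

text \<open>The transform is bounded because \<open>F\<close> is integrable on the line, and it
  vanishes off the band; hence it is integrable, which is the premise of inversion.\<close>

theorem paley_wiener_integrable:
  assumes hol: "F holomorphic_on UNIV" and etype: "exp_type_le F (2 * pi * a)" and "a \<ge> 0"
    and int: "integrable lborel (\<lambda>x. F (of_real x))"
  obtains f where "bandlimit a f" "\<And>t. isCont f t" "\<And>x. F (of_real x) = fourier f x"
proof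
  let ?F = "\<lambda>x. F (of_real x)"
  let ?f = "\<lambda>t. fourier ?F (-t)"
  note [measurable] = borel_measurable_integrable[OF int, simplified]
  show f: "bandlimit a ?f"
    unfolding bandlimit_def
  proof (intro conjI allI impI)
    show "\<exists>M. \<forall>t. norm (?f t) \<le> M"
      using fourier_bound[OF int] by blast
    fix t :: real assume "\<bar>t\<bar> > a"
    then have "\<bar>2 * pi * (-t)\<bar> > 2 * pi * a" by (simp add: abs_mult)
    from exp_type_transform_vanishes[OF hol etype _ this int] \<open>a \<ge> 0\<close> show "?f t = 0"
      by (simp add: fourier_def)
  qed measurable
  show "isCont ?f t" for t
    using isCont_o2[of t uminus "fourier ?F"] isCont_fourier[OF int] by (simp add: continuous_minus)
  show "F (of_real x) = fourier ?f x" for x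
  proof (rule fourier_inversion[symmetric, OF int _ bandlimit_integrable[OF f]])
    have "isCont F (of_real x)"
      using hol holomorphic_on_imp_continuous_on continuous_on_eq_continuous_at open_UNIV by blast
    then show "isCont ?F x"
      using isCont_o2[of x of_real F] by (simp add: continuous_of_real)
  qed
qed

section \<open>From integrable to square-integrable functions\<close>

lemma PW_measurable:
  assumes "F \<in> PW \<tau>"
  shows "(\<lambda>x. F (complex_of_real x)) \<in> borel_measurable borel"
proof -
  have "continuous_on UNIV F"
    using assms holomorphic_on_imp_continuous_on by (auto simp: PW_def)
  then have "continuous_on UNIV (\<lambda>x. F (complex_of_real x))"
    by (rule continuous_on_compose2) (auto intro!: continuous_intros)
  then show ?thesis by (rule borel_measurable_continuous_onI)
qed

text \<open>The dilated factors have types \<open>r \<tau>\<close> and \<open>s \<tau>\<close>,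
  which add up to \<open>\<tau>\<close> again.\<close>

lemma exp_type_le_dilated_product:
  assumes F: "exp_type_le F \<tau>" and S: "exp_type_le S \<tau>" and rs: "r \<ge> 0" "s \<ge> 0" "r + s = 1"
  shows "exp_type_le (\<lambda>z. F (of_real r * z) * S (of_real s * z)) \<tau>"
  unfolding exp_type_le_def
proof (intro allI impI)
  fix \<epsilon> :: real assume "\<epsilon> > 0"
  then obtain C C' where C: "\<And>z. norm (F z) \<le> C * exp ((\<tau> + \<epsilon>) * norm z)"
      and C': "\<And>z. norm (S z) \<le> C' * exp ((\<tau> + \<epsilon>) * norm z)"
    using F S unfolding exp_type_le_def by blast
  have "norm (F (of_real r * z) * S (of_real s * z)) \<le> (C * C') * exp ((\<tau> + \<epsilon>) * norm z)" for z
  proof -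
    have "norm (F (of_real r * z) * S (of_real s * z))
       \<le> (C * exp ((\<tau> + \<epsilon>) * norm (of_real r * z))) * (C' * exp ((\<tau> + \<epsilon>) * norm (of_real s * z)))"
      unfolding norm_mult[of "F _"] by (rule mult_mono[OF C C' order_trans[OF norm_ge_zero C] norm_ge_zero])
    also have "\<dots> = (C * C') * exp ((\<tau> + \<epsilon>) * (r * norm z) + (\<tau> + \<epsilon>) * (s * norm z))"
      using rs by (simp add: norm_mult exp_add mult_ac)
    also have "(\<tau> + \<epsilon>) * (r * norm z) + (\<tau> + \<epsilon>) * (s * norm z) = (\<tau> + \<epsilon>) * ((r + s) * norm z)"
      by (simp add: algebra_simps)
    finally show ?thesis using rs by simp
  qed
  then show "\<exists>C. \<forall>z. norm (F (of_real r * z) * S (of_real s * z)) \<le> C * exp ((\<tau> + \<epsilon>) * norm z)" by blast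
qed

lemma holomorphic_dilate:
  assumes "F holomorphic_on UNIV"
  shows "(\<lambda>z. F (c * z)) holomorphic_on UNIV"
proof -
  have "(\<lambda>z. c * z) holomorphic_on UNIV" by (intro holomorphic_intros)
  from holomorphic_on_compose_gen[OF this assms] show ?thesis by (simp add: o_def)
qed

text \<open>\<open>S\<close> is the transform of the uniform density on \<open>[-a, a]\<close>, on
  the line \<open>sin (2 pi a x) / (2 pi a x)\<close>. As the transform of a probability density it
  is at most 1 in modulus there and equals 1 at 0.\<close>

lemma cutoff_exists:
  assumes "a > 0"
  obtains S where "S \<in> PW (2 * pi * a)" "S 0 = 1" "\<And>x. norm (S (complex_of_real x)) \<le> 1" "isCont (\<lambda>x. S (complex_of_real x)) 0"
proof
  let ?f = "\<lambda>t. complex_of_real (indicator {-a..a} t / (2 * a))"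
  have f: "bandlimit a ?f"
    unfolding bandlimit_def
  proof (intro conjI)
    show "\<exists>M. \<forall>t. norm (?f t) \<le> M"
      using assms by (intro exI[of _ "1 / (2 * a)"]) (auto simp: indicator_def norm_divide)
  qed (auto simp: indicator_def)
  have "continuous_on {-a..a} (\<lambda>t. complex_of_real (1 / (2 * a)))" by (rule continuous_on_const)
  then have "continuous_on {-a..a} ?f"
    by (rule continuous_on_eq) simp
  then show "ft ?f \<in> PW (2 * pi * a)"
    using ft_in_PW[OF f] assms by simp
  have one: "(LINT t|lborel. indicator {-a..a} t / (2 * a)) = (1::real)"
    using assms by simp
  have "ft ?f 0 = (LINT t|lborel. ?f t)" by (simp add: ft_def)
  also have "\<dots> = 1" unfolding integral_complex_of_real one by simp
  finally show "ft ?f 0 = 1" .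
  show "norm (ft ?f (of_real x)) \<le> 1" for x
  proof -
    have "norm (?f t) = indicator {-a..a} t / (2 * a)" for t
      using assms by (simp add: norm_divide indicator_def)
    then show ?thesis
      using fourier_bound[OF bandlimit_integrable[OF f], of x] unfolding ft_of_real by (simp only: one)
  qed
  show "isCont (\<lambda>x. ft ?f (of_real x)) 0"
    unfolding ft_of_real by (rule isCont_fourier[OF bandlimit_integrable[OF f]])
qed

text \<open>Substituting \<open>x = (1 + e) y\<close> undoes the dilation of \<open>F\<close> and
  puts it on the bounded weight \<open>u\<close>, so \<open>B |F|^2\<close> dominates. Continuity of
  \<open>u\<close> is asked away from 0 only: in the intended weight the quotient at 0 is 0 by
  convention, so \<open>u 0 = 1\<close> although the limit there is 0.\<close>

lemma dilated_norms_tendsto: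
  fixes u :: "real \<Rightarrow> real"
  assumes F: "F \<in> PW \<tau>" and S: "S \<in> PW \<tau>" "S 0 = 1" "\<And>x. norm (S (complex_of_real x)) \<le> 1" "isCont (\<lambda>x. S (complex_of_real x)) 0"
    and [measurable]: "u \<in> borel_measurable borel" and u: "\<And>x. \<bar>u x\<bar> \<le> B" "\<And>x. x \<noteq> 0 \<Longrightarrow> isCont u x"
    and e: "e \<longlonglongrightarrow> 0" "\<And>n. e n > 0"
  shows "(\<lambda>n. LINT x|lborel. (norm (F (of_real (1 / (1 + e n)) * of_real x) * S (of_real (e n / (1 + e n)) * of_real x)))\<^sup>2 * u x)
    \<longlonglongrightarrow> (LINT x|lborel. (norm (F (of_real x)))\<^sup>2 * u x)"
proof -
  note [measurable] = PW_measurable[OF F] PW_measurable[OF S(1)]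
  have FL2: "integrable lborel (\<lambda>x. (norm (F (of_real x)))\<^sup>2)"
    using F by (simp add: PW_def)
  have B: "B \<ge> 0" using u(1)[of 0] by linarith
  let ?I = "\<lambda>n. LINT y|lborel. (norm (F (of_real y)))\<^sup>2 * (norm (S (of_real (e n * y))))\<^sup>2 * u ((1 + e n) * y)"
  have "(LINT x|lborel. (norm (F (of_real (1 / (1 + e n)) * of_real x) * S (of_real (e n / (1 + e n)) * of_real x)))\<^sup>2 * u x)
     = (1 + e n) * ?I n" for n
  proof -
    let ?c = "1 + e n"
    let ?g = "\<lambda>x. (norm (F (of_real (1 / ?c) * of_real x) * S (of_real (e n / ?c) * of_real x)))\<^sup>2 * u x"
    have c: "?c > 0" using e(2)[of n] by simp
    have "(LINT x|lborel. ?g x) = \<bar>?c\<bar> *\<^sub>R (LINT y|lborel. ?g (0 + ?c * y))"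
      by (rule lborel_integral_real_affine) (use c in simp)
    moreover have "?g (0 + ?c * y) = (norm (F (of_real y)))\<^sup>2 * (norm (S (of_real (e n * y))))\<^sup>2 * u (?c * y)" for y
    proof -
      have "of_real (1 / ?c) * of_real (0 + ?c * y) = complex_of_real y"
        "of_real (e n / ?c) * of_real (0 + ?c * y) = complex_of_real (e n * y)"
        unfolding of_real_mult[symmetric] of_real_eq_iff using c by (auto simp: field_simps)
      then show ?thesis by (simp only: norm_mult power_mult_distrib add_0_left)
    qed
    ultimately show ?thesis using c by (simp only:) simp
  qed
  moreover have "?I \<longlonglongrightarrow> (LINT x|lborel. (norm (F (of_real x)))\<^sup>2 * u x)"
  proof (rule integral_dominated_convergence[where w = "\<lambda>y. (norm (F (of_real y)))\<^sup>2 * B"])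
    show "integrable lborel (\<lambda>y. (norm (F (of_real y)))\<^sup>2 * B)"
      using FL2 by (rule integrable_mult_left)
    show "AE y in lborel. norm ((norm (F (of_real y)))\<^sup>2 * (norm (S (of_real (e n * y))))\<^sup>2 * u ((1 + e n) * y)) \<le> (norm (F (of_real y)))\<^sup>2 * B" for n
    proof (intro always_eventually allI)
      fix y
      have "(norm (S (of_real (e n * y))))\<^sup>2 * \<bar>u ((1 + e n) * y)\<bar> \<le> 1 * B"
        using S(3)[of "e n * y"] u(1) by (intro mult_mono power_le_one) auto
      then show "norm ((norm (F (of_real y)))\<^sup>2 * (norm (S (of_real (e n * y))))\<^sup>2 * u ((1 + e n) * y)) \<le> (norm (F (of_real y)))\<^sup>2 * B"
        by (simp add: abs_mult mult.assoc mult_left_mono del: of_real_mult)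
    qed
    show "AE y in lborel. (\<lambda>n. (norm (F (of_real y)))\<^sup>2 * (norm (S (of_real (e n * y))))\<^sup>2 * u ((1 + e n) * y))
        \<longlonglongrightarrow> (norm (F (of_real y)))\<^sup>2 * u y"
      using AE_lborel_singleton[of 0]
    proof eventually_elim
      case (elim y)
      have "(\<lambda>n. e n * y) \<longlonglongrightarrow> 0 * y" by (intro tendsto_mult e tendsto_const)
      then have 1: "(\<lambda>n. S (of_real (e n * y))) \<longlonglongrightarrow> S (of_real 0)"
        by (intro isCont_tendsto_compose[OF S(4)]) simp
      have "(\<lambda>n. (1 + e n) * y) \<longlonglongrightarrow> (1 + 0) * y" by (intro tendsto_mult tendsto_add e tendsto_const)
      then have 2: "(\<lambda>n. u ((1 + e n) * y)) \<longlonglongrightarrow> u y"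
        by (intro isCont_tendsto_compose[OF u(2)[OF elim]]) simp
      have "(\<lambda>n. (norm (F (of_real y)))\<^sup>2 * (norm (S (of_real (e n * y))))\<^sup>2 * u ((1 + e n) * y))
        \<longlonglongrightarrow> (norm (F (of_real y)))\<^sup>2 * (norm (S (of_real 0)))\<^sup>2 * u y"
        by (intro tendsto_mult tendsto_power tendsto_norm 1 2 tendsto_const)
      then show ?case by (simp add: S(2))
    qed
  qed measurable
  ultimately have "(\<lambda>n. LINT x|lborel. (norm (F (of_real (1 / (1 + e n)) * of_real x) * S (of_real (e n / (1 + e n)) * of_real x)))\<^sup>2 * u x)
    \<longlonglongrightarrow> (1 + 0) * (LINT x|lborel. (norm (F (of_real x)))\<^sup>2 * u x)"
    by (simp only:) (intro tendsto_mult tendsto_add e tendsto_const)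
  then show ?thesis by simp
qed

text \<open>\<open>G n\<close> keeps the type of \<open>F\<close> and is integrable on the line as a
  product of two square-integrable functions, so it is the transform of a bandlimited function and
  satisfies the bounds. Both norms converge to those of \<open>F\<close>; the point mass is
  unchanged because \<open>S 0 = 1\<close>.\<close>

theorem PW_form_bounds:
  assumes "a > 0" and F: "F \<in> PW (2 * pi * a)"
    and lo: "\<And>f. bandlimit a f \<Longrightarrow> lo * (LINT t|lborel. (norm (f t))\<^sup>2) \<le> form f"
    and up: "\<And>f. bandlimit a f \<Longrightarrow> form f \<le> up * (LINT t|lborel. (norm (f t))\<^sup>2)"
  shows "(1 + lo) * L2_sq F \<le> LW_sq F" and "LW_sq F \<le> (1 + up) * L2_sq F"
proof -
  obtain S where S: "S \<in> PW (2 * pi * a)" "S 0 = 1" "\<And>x. norm (S (complex_of_real x)) \<le> 1" "isCont (\<lambda>x. S (complex_of_real x)) 0"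
    using cutoff_exists[OF \<open>a > 0\<close>] by metis
  define e where "e n = 1 / real (Suc n)" for n
  have e: "e \<longlonglongrightarrow> 0" "\<And>n. e n > 0"
    unfolding e_def using LIMSEQ_inverse_real_of_nat by (auto simp: inverse_eq_divide)
  define G where "G n z = F (of_real (1 / (1 + e n)) * z) * S (of_real (e n / (1 + e n)) * z)" for n z
  have bounds: "(1 + lo) * L2_sq (G n) \<le> LW_sq (G n) \<and> LW_sq (G n) \<le> (1 + up) * L2_sq (G n)" for n
  proof -
    let ?r = "1 / (1 + e n)" and ?s = "e n / (1 + e n)"
    have rs: "?r > 0" "?s > 0" "?r + ?s = 1" using e(2)[of n] by (auto simp: field_simps)
    have hol: "G n holomorphic_on UNIV"
      using F S(1) unfolding G_def PW_def by (intro holomorphic_on_mult holomorphic_dilate) auto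
    have etype: "exp_type_le (G n) (2 * pi * a)"
      unfolding G_def using F S(1) rs by (intro exp_type_le_dilated_product) (auto simp: PW_def)
    have dil: "integrable lborel (\<lambda>x. (norm (H (of_real r * complex_of_real x)))\<^sup>2) \<and> (\<lambda>x. H (of_real r * complex_of_real x)) \<in> borel_measurable borel"
      if H: "H \<in> PW (2 * pi * a)" and "r > 0" for H r
    proof
      note [measurable] = PW_measurable[OF H]
      have "integrable lborel (\<lambda>x. (norm (H (of_real (0 + r * x))))\<^sup>2)"
        using lborel_integrable_real_affine[of "\<lambda>x. (norm (H (of_real x)))\<^sup>2" r 0] that by (simp add: PW_def)
      then show "integrable lborel (\<lambda>x. (norm (H (of_real r * complex_of_real x)))\<^sup>2)" by simp
      have "(\<lambda>x. H (complex_of_real (r * x))) \<in> borel_measurable borel" by measurable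
      then show "(\<lambda>x. H (of_real r * complex_of_real x)) \<in> borel_measurable borel" by simp
    qed
    have int: "integrable lborel (\<lambda>x. G n (of_real x))"
      unfolding G_def using dil[OF F rs(1)] dil[OF S(1) rs(2)] by (intro integrable_mult_square_integrable) blast+
    obtain f where f: "bandlimit a f" "\<And>t. isCont f t" "\<And>x. G n (of_real x) = fourier f x"
      using paley_wiener_integrable[OF hol etype _ int] \<open>a > 0\<close> by (metis less_imp_le)
    show ?thesis
      using norms_of_transform[OF f(1) _ f(3)] f(2) lo[OF f(1)] up[OF f(1)] by (simp add: algebra_simps)
  qed
  have u_meas [measurable]: "(\<lambda>x. 1 - sin (2 * pi * x) / (2 * pi * x)) \<in> borel_measurable borel" by measurable
  have L2: "(\<lambda>n. L2_sq (G n)) \<longlonglongrightarrow> L2_sq F"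
    using dilated_norms_tendsto[OF F S, of "\<lambda>_. 1" 1 e] e by (simp add: L2_sq_def G_def)
  have u_bound: "\<bar>1 - sin (2 * pi * x) / (2 * pi * x)\<bar> \<le> 2" for x
    using abs_sinc_le_1[of "2 * pi * x"] by linarith
  have u_cont: "isCont (\<lambda>x. 1 - sin (2 * pi * x) / (2 * pi * x)) x" if "x \<noteq> 0" for x :: real
    using that by (intro continuous_intros) auto
  have "(\<lambda>n. LINT x|lborel. (norm (G n (of_real x)))\<^sup>2 * (1 - sin (2 * pi * x) / (2 * pi * x)))
      \<longlonglongrightarrow> (LINT x|lborel. (norm (F (of_real x)))\<^sup>2 * (1 - sin (2 * pi * x) / (2 * pi * x)))"
    unfolding G_def by (rule dilated_norms_tendsto[OF F S u_meas u_bound u_cont e])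
  then have "(\<lambda>n. (LINT x|lborel. (norm (G n (of_real x)))\<^sup>2 * (1 - sin (2 * pi * x) / (2 * pi * x))) + (norm (F 0))\<^sup>2)
      \<longlonglongrightarrow> (LINT x|lborel. (norm (F (of_real x)))\<^sup>2 * (1 - sin (2 * pi * x) / (2 * pi * x))) + (norm (F 0))\<^sup>2"
    by (rule tendsto_add[OF _ tendsto_const])
  moreover have "G n 0 = F 0" for n by (simp add: G_def S(2))
  ultimately have LW: "(\<lambda>n. LW_sq (G n)) \<longlonglongrightarrow> LW_sq F"
    unfolding LW_sq_def by (simp only:)
  show "(1 + lo) * L2_sq F \<le> LW_sq F"
    using bounds by (intro LIMSEQ_le[OF tendsto_mult[OF tendsto_const L2] LW]) blast
  show "LW_sq F \<le> (1 + up) * L2_sq F"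
    using bounds by (intro LIMSEQ_le[OF LW tendsto_mult[OF tendsto_const L2]]) blast
qed

text \<open>A continuous function vanishing almost everywhere on the line vanishes on all of it, and
  the identity theorem extends this to the plane. Thus no ratio hides a division by zero.\<close>

lemma L2_sq_pos:
  assumes F: "F \<in> PW \<tau>" and "F \<noteq> (\<lambda>_. 0)"
  shows "L2_sq F > 0"
proof (rule ccontr)
  assume "\<not> L2_sq F > 0"
  moreover have "L2_sq F \<ge> 0" unfolding L2_sq_def by simp
  ultimately have "L2_sq F = 0" by linarith
  then have "AE x in lborel. (norm (F (complex_of_real x)))\<^sup>2 = 0"
    using F integral_nonneg_eq_0_iff_AE[of lborel "\<lambda>x. (norm (F (complex_of_real x)))\<^sup>2"]
    by (simp add: PW_def L2_sq_def)
  then have AE: "AE x in lborel. F (complex_of_real x) = 0" by simp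
  have hol: "F holomorphic_on UNIV" using F by (simp add: PW_def)
  have cont: "continuous_on UNIV (\<lambda>x. F (complex_of_real x))"
    using holomorphic_on_imp_continuous_on[OF hol]
    by (rule continuous_on_compose2) (auto intro!: continuous_intros)
  have zero: "F (complex_of_real x) = 0" for x
  proof (rule ccontr)
    assume nz: "F (complex_of_real x) \<noteq> 0"
    let ?U = "{x. F (complex_of_real x) \<noteq> 0}"
    have "open ?U"
      using cont by (intro open_Collect_neq) (auto intro!: continuous_intros)
    moreover have "?U \<in> null_sets lborel"
      using AE AE_iff_null_sets[of ?U lborel] \<open>open ?U\<close> by simp
    ultimately show False
      using nz open_not_negligible[of ?U] negligible_iff_null_sets null_sets_completionI by blast
  qed
  have "F z = 0" for z
  proof (rule analytic_continuation[OF hol, of "range complex_of_real" 0])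
    show "0 islimpt range complex_of_real"
    proof (unfold islimpt_approachable, intro allI impI)
      fix \<epsilon> :: real assume "\<epsilon> > 0"
      then show "\<exists>x'\<in>range complex_of_real. x' \<noteq> 0 \<and> dist x' 0 < \<epsilon>"
        by (intro bexI[OF _ rangeI[of _ "\<epsilon> / 2"]]) auto
    qed
  qed (use zero in auto)
  with assms(2) show False by auto
qed

section \<open>The quadratic form and the Schur test\<close>

text \<open>\<open>c = 1\<close> is the kernel of the form, \<open>c = 1/2\<close> its part
  supported on \<open>|t - u| > 1\<close>. Different \<open>c\<close> change the quadratic form by a
  multiple of the squared modulus of the integral of \<open>f\<close>.\<close>

definition kern :: "real \<Rightarrow> real \<Rightarrow> real \<Rightarrow> real" where
  "kern c t u = c - indicator {t-1..t+1} u / 2"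

lemma kern_sym: "kern c t u = kern c u t"
  by (auto simp: kern_def indicator_def)

lemma measurable_kern [measurable]: "(\<lambda>(t,u). kern c t u) \<in> borel_measurable (borel \<Otimes>\<^sub>M borel)"
proof -
  have "(\<lambda>(t,u). kern c t u) = (\<lambda>(t,u). if t - 1 \<le> u \<and> u \<le> t + 1 then c - 1/2 else c)"
    by (auto simp: kern_def indicator_def)
  also have "\<dots> \<in> borel_measurable (borel \<Otimes>\<^sub>M borel)" by measurable
  finally show ?thesis .
qed

lemma kern_bounds: "1/2 \<le> c \<Longrightarrow> 0 \<le> kern c t u" "c \<le> 1 \<Longrightarrow> kern c t u \<le> 1"
  by (auto simp: kern_def indicator_def)

lemma abs_kern_le: "1/2 \<le> c \<Longrightarrow> c \<le> 1 \<Longrightarrow> \<bar>kern c t u\<bar> \<le> 1"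
  using kern_bounds[of c t u] by simp

lemma integrable_mult_bounded:
  fixes f h :: "real \<Rightarrow> 'a::{real_normed_algebra, banach, second_countable_topology}"
  assumes f: "integrable lborel f" and [measurable]: "h \<in> borel_measurable borel" and h: "\<And>x. norm (h x) \<le> B"
  shows "integrable lborel (\<lambda>x. h x * f x)"
proof (rule Bochner_Integration.integrable_bound)
  show "integrable lborel (\<lambda>x. B * norm (f x))" using f by simp
  have "0 \<le> B" using order_trans[OF norm_ge_zero h[of 0]] .
  then show "AE x in lborel. norm (h x * f x) \<le> norm (B * norm (f x))"
    using h by (intro always_eventually allI) (auto intro!: order_trans[OF norm_mult_ineq] mult_right_mono)
  show "(\<lambda>x. h x * f x) \<in> borel_measurable lborel"
    using borel_measurable_integrable[OF f] by measurable
qed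

lemma kern_integrable:
  assumes f: "bandlimit a f" and "1/2 \<le> c" "c \<le> 1"
  shows "integrable lborel (\<lambda>u. complex_of_real (kern c t u) * f u)"
  by (rule integrable_mult_bounded[OF bandlimit_integrable[OF f], where B = 1]) (use assms abs_kern_le in auto)

lemma kern_transform_bound:
  assumes f: "bandlimit a f" and c: "1/2 \<le> c" "c \<le> 1"
  shows "norm (LINT u|lborel. complex_of_real (kern c t u) * f u) \<le> (LINT u|lborel. norm (f u))"
proof -
  have "norm (LINT u|lborel. complex_of_real (kern c t u) * f u) \<le> (LINT u|lborel. norm (complex_of_real (kern c t u) * f u))"
    by (rule integral_norm_bound)
  also have "\<dots> \<le> (LINT u|lborel. norm (f u))"
    using bandlimit_integrable[OF f] abs_kern_le[OF c]
    by (intro Bochner_Integration.integral_mono' integrable_norm) (auto simp: norm_mult mult_left_le_one_le)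
  finally show ?thesis .
qed

lemma kern_form_integrable:
  assumes f: "bandlimit a f" and c: "1/2 \<le> c" "c \<le> 1"
  shows "integrable lborel (\<lambda>t. f t * cnj (LINT u|lborel. complex_of_real (kern c t u) * f u))"
proof -
  note [measurable] = bandlimit_measurable[OF f]
  have "integrable lborel (\<lambda>t. cnj (LINT u|lborel. complex_of_real (kern c t u) * f u) * f t)"
    by (rule integrable_mult_bounded[OF bandlimit_integrable[OF f]])
      (use kern_transform_bound[OF f c] in \<open>auto simp: complex_mod_cnj\<close>)
  then show ?thesis by (simp only: mult.commute)
qed

text \<open>A constant in the kernel contributes only the squared modulus of the integral of
  \<open>f\<close>, so the box in \<open>form\<close> can be traded for any \<open>c\<close>. The
  range of \<open>c\<close> keeps both the kernel and the remainder nonnegative: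
  \<open>c = 1\<close> serves the upper bound, \<open>c = 1/2\<close> the lower one.\<close>

lemma form_kernel:
  assumes f: "bandlimit a f" and c: "1/2 \<le> c" "c \<le> 1"
  shows "form f = (1 - c) * (norm (LINT t|lborel. f t))\<^sup>2
      + Re (LINT t|lborel. f t * cnj (LINT u|lborel. complex_of_real (kern c t u) * f u))"
proof -
  let ?S = "LINT t|lborel. f t"
  let ?k = "\<lambda>t. LINT u|lborel. complex_of_real (kern c t u) * f u"
  have int: "integrable lborel f" by (rule bandlimit_integrable[OF f])
  have half_box_eq: "(LINT s|lborel. half_box t s * f s) = of_real c * ?S - ?k t" for t
  proof -
    have "(LINT s|lborel. half_box t s * f s) = (LINT s|lborel. of_real c * f s - complex_of_real (kern c t s) * f s)"
      by (intro Bochner_Integration.integral_cong) (auto simp: half_box_def kern_def algebra_simps)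
    also have "\<dots> = of_real c * ?S - ?k t"
      using int kern_integrable[OF f c] by (subst Bochner_Integration.integral_diff) auto
    finally show ?thesis .
  qed
  have "(LINT t|lborel. f t * cnj (LINT s|lborel. half_box t s * f s)) = (LINT t|lborel. (of_real c * cnj ?S) * f t - f t * cnj (?k t))"
    unfolding half_box_eq by (intro Bochner_Integration.integral_cong) (auto simp: algebra_simps)
  also have "\<dots> = of_real c * cnj ?S * ?S - (LINT t|lborel. f t * cnj (?k t))"
    using int kern_form_integrable[OF f c] by (subst Bochner_Integration.integral_diff) auto
  also have "of_real c * cnj ?S * ?S = of_real (c * (norm ?S)\<^sup>2)"
    unfolding of_real_mult complex_norm_square by (simp add: mult_ac)
  finally have "Re (LINT t|lborel. f t * cnj (LINT s|lborel. half_box t s * f s)) = c * (norm ?S)\<^sup>2 - Re (LINT t|lborel. f t * cnj (?k t))"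
    by (simp only: minus_complex.sel Re_complex_of_real)
  then show ?thesis
    unfolding form_def left_diff_distrib by linarith
qed

text \<open>Weighted arithmetic-geometric mean: \<open>|f t| |f u|\<close> is at most half of
  \<open>|f t|^2 (\<phi> u / \<phi> t) + |f u|^2 (\<phi> t / \<phi> u)\<close>. By symmetry of the
  kernel both terms have the same integral, and \<open>super\<close> bounds the inner one.
  Positivity of the weight is demanded only at points that see the kernel, as the weight for the
  lower bound vanishes on the middle part. Integrals are taken in \<open>ennreal\<close> because
  \<open>\<phi> u / \<phi> t\<close> may be unbounded.\<close>

theorem schur_test:
  fixes \<phi> :: "real \<Rightarrow> real"
  assumes f: "bandlimit a f" and c: "1/2 \<le> c" "c \<le> 1" and "\<eta> \<ge> 0"
    and [measurable]: "\<phi> \<in> borel_measurable borel" and \<phi>: "\<And>u. 0 \<le> \<phi> u" "\<And>u. \<phi> u \<le> 1" "\<And>u. \<bar>u\<bar> > a \<Longrightarrow> \<phi> u = 0"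
    and pos: "\<And>t u. \<bar>t\<bar> \<le> a \<Longrightarrow> \<bar>u\<bar> \<le> a \<Longrightarrow> kern c t u > 0 \<Longrightarrow> \<phi> t > 0"
    and super: "\<And>t. \<bar>t\<bar> \<le> a \<Longrightarrow> (LINT u|lborel. kern c t u * \<phi> u) \<le> \<eta> * \<phi> t"
  shows "norm (LINT t|lborel. f t * cnj (LINT u|lborel. complex_of_real (kern c t u) * f u))
     \<le> \<eta> * (LINT t|lborel. (norm (f t))\<^sup>2)"
proof -
  note [measurable] = bandlimit_measurable[OF f]
  obtain M where M: "M \<ge> 0" "\<And>t. norm (f t) \<le> M" "\<And>t. norm (f t) \<le> M * indicator {-a..a} t"
    using bandlimit_dominated[OF f] by metis
  have f0: "f t = 0" if "\<bar>t\<bar> > a" for t using f that by (simp add: bandlimit_def)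
  let ?p = "\<lambda>t u. ennreal (kern c t u * (norm (f t))\<^sup>2 * (\<phi> u / \<phi> t) / 2)"
  have k0: "kern c t u \<ge> 0" for t u using kern_bounds c by simp
  have sq: "integrable lborel (\<lambda>t. (norm (f t))\<^sup>2)"
    unfolding power2_eq_square
    by (rule integrable_mult_bounded[where B = M]) (use bandlimit_integrable[OF f] M in auto)
  have amgm: "x * y \<le> x\<^sup>2 * (q / p) / 2 + y\<^sup>2 * (p / q) / 2" if "p > 0" "q > 0" for x y p q :: real
  proof -
    have "0 \<le> (x * q - y * p)\<^sup>2 / (p * q)" using that by simp
    also have "\<dots> = x\<^sup>2 * (q / p) + y\<^sup>2 * (p / q) - 2 * (x * y)"
      using that by (simp add: field_simps power2_eq_square)
    finally show ?thesis by simp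
  qed
  have point: "ennreal (norm (f t) * (kern c t u * norm (f u))) \<le> ?p t u + ?p u t" for t u
  proof (cases "kern c t u = 0 \<or> \<bar>t\<bar> > a \<or> \<bar>u\<bar> > a")
    case True
    then have "norm (f t) * (kern c t u * norm (f u)) = 0" using f0[of t] f0[of u] by auto
    then show ?thesis by (simp only: ennreal_0 zero_le)
  next
    case False
    then have k: "kern c t u > 0" "\<bar>t\<bar> \<le> a" "\<bar>u\<bar> \<le> a" using k0[of t u] by auto
    then have p: "\<phi> t > 0" "\<phi> u > 0" using pos[of t u] pos[of u t] kern_sym[of c t u] by auto
    have "norm (f t) * (kern c t u * norm (f u)) = kern c t u * (norm (f t) * norm (f u))" by simp
    also have "\<dots> \<le> kern c t u * ((norm (f t))\<^sup>2 * (\<phi> u / \<phi> t) / 2 + (norm (f u))\<^sup>2 * (\<phi> t / \<phi> u) / 2)"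
      by (intro mult_left_mono amgm p k0)
    also have "\<dots> = kern c t u * (norm (f t))\<^sup>2 * (\<phi> u / \<phi> t) / 2 + kern c u t * (norm (f u))\<^sup>2 * (\<phi> t / \<phi> u) / 2"
      by (simp add: kern_sym[of c u t] algebra_simps)
    finally have "ennreal (norm (f t) * (kern c t u * norm (f u))) \<le> ennreal (kern c t u * (norm (f t))\<^sup>2 * (\<phi> u / \<phi> t) / 2 + kern c u t * (norm (f u))\<^sup>2 * (\<phi> t / \<phi> u) / 2)"
      by (rule ennreal_leI)
    also have "\<dots> = ?p t u + ?p u t"
      using k0 \<phi>(1) by (intro ennreal_plus) auto
    finally show ?thesis .
  qed
  have inner: "(\<integral>\<^sup>+u. ?p t u \<partial>lborel) \<le> ennreal (\<eta> * (norm (f t))\<^sup>2 / 2)" for t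
  proof (cases "\<bar>t\<bar> > a")
    case True
    then show ?thesis using f0 by simp
  next
    case False
    let ?C = "(norm (f t))\<^sup>2 / \<phi> t / 2"
    have "integrable lborel \<phi>"
      by (rule Bochner_Integration.integrable_bound[OF integrable_indicator_interval[of 1 "-a" a]])
        (use \<phi> in \<open>auto simp: indicator_def abs_le_iff not_le intro!: always_eventually\<close>)
    then have int: "integrable lborel (\<lambda>u. kern c t u * \<phi> u)"
      by (rule integrable_mult_bounded[where B = 1]) (use c abs_kern_le in auto)
    have "(\<integral>\<^sup>+u. ?p t u \<partial>lborel) = (\<integral>\<^sup>+u. ennreal (?C * (kern c t u * \<phi> u)) \<partial>lborel)"
      by (intro nn_integral_cong) (simp add: field_simps)
    also have "\<dots> = ennreal (LINT u|lborel. ?C * (kern c t u * \<phi> u))"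
      using int k0 \<phi>(1) by (intro nn_integral_eq_integral integrable_mult_right) auto
    also have "(LINT u|lborel. ?C * (kern c t u * \<phi> u)) = ?C * (LINT u|lborel. kern c t u * \<phi> u)"
      by (rule integral_mult_right_zero)
    also have "\<dots> \<le> ?C * (\<eta> * \<phi> t)"
      using super[of t] False \<phi>(1) by (intro mult_left_mono) auto
    \<comment> \<open>Where \<open>\<phi> t = 0\<close> the quotient \<open>?C\<close> is 0 by
      convention and the inequality is trivial.\<close>
    also have "?C * (\<eta> * \<phi> t) \<le> \<eta> * (norm (f t))\<^sup>2 / 2"
      using \<open>\<eta> \<ge> 0\<close> by (cases "\<phi> t = 0") auto
    finally show ?thesis by (simp add: ennreal_leI)
  qed
  let ?L = "LINT t|lborel. f t * cnj (LINT u|lborel. complex_of_real (kern c t u) * f u)"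
  have "ennreal (norm ?L) \<le> (\<integral>\<^sup>+t. ennreal (norm (f t * cnj (LINT u|lborel. complex_of_real (kern c t u) * f u))) \<partial>lborel)"
    by (rule integral_norm_bound_ennreal[OF kern_form_integrable[OF f c]])
  also have "\<dots> \<le> (\<integral>\<^sup>+t. (\<integral>\<^sup>+u. ennreal (norm (f t) * (kern c t u * norm (f u))) \<partial>lborel) \<partial>lborel)"
  proof (rule nn_integral_mono)
    fix t
    have "ennreal (norm (f t * cnj (LINT u|lborel. complex_of_real (kern c t u) * f u)))
        = ennreal (norm (LINT u|lborel. f t * (complex_of_real (kern c t u) * f u)))"
      by (simp add: norm_mult)
    also have "\<dots> \<le> (\<integral>\<^sup>+u. ennreal (norm (f t * (complex_of_real (kern c t u) * f u))) \<partial>lborel)"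
      by (intro integral_norm_bound_ennreal integrable_mult_right kern_integrable[OF f c])
    also have "\<dots> = (\<integral>\<^sup>+u. ennreal (norm (f t) * (kern c t u * norm (f u))) \<partial>lborel)"
      using k0 by (simp add: norm_mult)
    finally show "ennreal (norm (f t * cnj (LINT u|lborel. complex_of_real (kern c t u) * f u)))
        \<le> (\<integral>\<^sup>+u. ennreal (norm (f t) * (kern c t u * norm (f u))) \<partial>lborel)" .
  qed
  also have "\<dots> \<le> (\<integral>\<^sup>+t. (\<integral>\<^sup>+u. ?p t u + ?p u t \<partial>lborel) \<partial>lborel)"
    by (intro nn_integral_mono point)
  also have "\<dots> = (\<integral>\<^sup>+t. (\<integral>\<^sup>+u. ?p t u \<partial>lborel) \<partial>lborel) + (\<integral>\<^sup>+t. (\<integral>\<^sup>+u. ?p u t \<partial>lborel) \<partial>lborel)"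
    by (simp add: nn_integral_add)
  also have "(\<integral>\<^sup>+t. (\<integral>\<^sup>+u. ?p u t \<partial>lborel) \<partial>lborel) = (\<integral>\<^sup>+t. (\<integral>\<^sup>+u. ?p t u \<partial>lborel) \<partial>lborel)"
    by (rule lborel_pair.Fubini') measurable
  also have "(\<integral>\<^sup>+t. (\<integral>\<^sup>+u. ?p t u \<partial>lborel) \<partial>lborel) + (\<integral>\<^sup>+t. (\<integral>\<^sup>+u. ?p t u \<partial>lborel) \<partial>lborel)
      \<le> (\<integral>\<^sup>+t. ennreal (\<eta> * (norm (f t))\<^sup>2 / 2) \<partial>lborel) + (\<integral>\<^sup>+t. ennreal (\<eta> * (norm (f t))\<^sup>2 / 2) \<partial>lborel)"
    by (intro add_mono nn_integral_mono inner)
  also have "(\<integral>\<^sup>+t. ennreal (\<eta> * (norm (f t))\<^sup>2 / 2) \<partial>lborel) = ennreal (\<eta> * (LINT t|lborel. (norm (f t))\<^sup>2) / 2)"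
    using sq \<open>\<eta> \<ge> 0\<close> by (subst nn_integral_eq_integral) auto
  also have "ennreal (\<eta> * (LINT t|lborel. (norm (f t))\<^sup>2) / 2) + ennreal (\<eta> * (LINT t|lborel. (norm (f t))\<^sup>2) / 2)
      = ennreal (\<eta> * (LINT t|lborel. (norm (f t))\<^sup>2))"
    using \<open>\<eta> \<ge> 0\<close> by (subst ennreal_plus[symmetric]) auto
  finally show ?thesis
    using \<open>\<eta> \<ge> 0\<close> by (subst (asm) ennreal_le_iff) auto
qed

text \<open>With \<open>c = 1\<close> no remainder is left, so an eigenvalue equation on the band
  gives the form exactly. Such functions show that the Schur bounds are attained.\<close>

lemma form_eigenfunction:
  fixes g :: "real \<Rightarrow> real"
  assumes g: "bandlimit a (\<lambda>t. complex_of_real (g t))"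
    and eig: "\<And>t. \<bar>t\<bar> \<le> a \<Longrightarrow> (LINT u|lborel. kern 1 t u * g u) = l * g t"
  shows "form (\<lambda>t. complex_of_real (g t)) = l * (LINT t|lborel. (norm (complex_of_real (g t)))\<^sup>2)"
proof -
  have "(LINT t|lborel. complex_of_real (g t) * cnj (LINT u|lborel. complex_of_real (kern 1 t u) * complex_of_real (g u)))
     = (LINT t|lborel. complex_of_real (l * (g t)\<^sup>2))"
  proof (rule Bochner_Integration.integral_cong)
    fix t
    have "(LINT u|lborel. complex_of_real (kern 1 t u) * complex_of_real (g u)) = complex_of_real (LINT u|lborel. kern 1 t u * g u)"
      unfolding of_real_mult[symmetric] by (rule integral_complex_of_real)
    moreover have "g t * (LINT u|lborel. kern 1 t u * g u) = l * (g t)\<^sup>2"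
    proof (cases "\<bar>t\<bar> \<le> a")
      case True
      then show ?thesis by (simp add: eig power2_eq_square)
    next
      case False
      then have "g t = 0" using g by (simp add: bandlimit_def)
      then show ?thesis by simp
    qed
    ultimately show "complex_of_real (g t) * cnj (LINT u|lborel. complex_of_real (kern 1 t u) * complex_of_real (g u)) = complex_of_real (l * (g t)\<^sup>2)"
      by (simp only: complex_cnj_complex_of_real of_real_mult[symmetric])
  qed simp
  then show ?thesis
    unfolding form_kernel[OF g, of 1, simplified] integral_complex_of_real by simp
qed

lemma L2_norm_pos:
  assumes g: "bandlimit a g" and cont: "continuous_on {-a..a} g" and x: "-a < x" "x < a" "g x \<noteq> 0"
  shows "(LINT t|lborel. (norm (g t))\<^sup>2) > 0"
proof (rule ccontr)
  assume "\<not> (LINT t|lborel. (norm (g t))\<^sup>2) > 0"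
  moreover have "(LINT t|lborel. (norm (g t))\<^sup>2) \<ge> 0" by simp
  ultimately have zero: "(LINT t|lborel. (norm (g t))\<^sup>2) = 0" by linarith
  note [measurable] = bandlimit_measurable[OF g]
  obtain M where M: "\<And>t. norm (g t) \<le> M"
    using bandlimit_dominated[OF g] by metis
  have "integrable lborel (\<lambda>t. (norm (g t))\<^sup>2)"
    unfolding power2_eq_square
    by (rule integrable_mult_bounded[where B = M]) (use bandlimit_integrable[OF g] M in auto)
  then have AE: "AE t in lborel. g t = 0"
    using zero integral_nonneg_eq_0_iff_AE[of lborel "\<lambda>t. (norm (g t))\<^sup>2"] by simp
  let ?U = "{-a<..<a} \<inter> g -` (- {0})"
  have op: "open ?U"
    by (rule continuous_open_preimage[OF continuous_on_subset[OF cont]]) auto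
  have "AE t in lborel. t \<notin> ?U"
    using AE by eventually_elim simp
  then have "?U \<in> null_sets lborel"
    using AE_iff_null_sets[of ?U lborel] op by simp
  then have neg: "negligible ?U"
    unfolding negligible_iff_null_sets by (rule null_sets_completionI)
  have "x \<in> ?U" using x by simp
  then have "?U \<noteq> {}" by blast
  from open_not_negligible[OF op this] neg show False by (rule notE)
qed

section \<open>Eigenfunctions\<close>

text \<open>One family covers three roles. \<open>\<sigma> = 1\<close> with
  \<open>\<beta> > 0\<close> is the candidate positive eigenfunction; \<open>\<sigma> = 1\<close>
  with \<open>\<beta> = 0\<close> is the Schur weight for \<open>c = 1/2\<close>;
  \<open>\<sigma> = -1\<close> flips the right part and gives the odd eigenfunction, where
  \<open>\<beta> = 0\<close> makes the middle part vanish so that the flip stays continuous.\<close>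

locale profile =
  fixes a \<omega> \<beta> \<sigma> :: real
  assumes a: "1/2 < a" "a \<le> 1" and \<omega>: "\<omega> > 0" and \<beta>: "\<beta> \<ge> 0"
    and angle: "\<omega> * (2 * a - 1) + 2 * \<beta> = pi / 2"
    and \<sigma>: "\<sigma> = 1 \<or> \<sigma> = -1 \<and> \<beta> = 0"
begin

text \<open>The clamping by \<open>min\<close> and \<open>max\<close> glues the three pieces; \<open>angle\<close> makes them match at \<open>\<plusminus>(1 - a)\<close>.\<close>

definition prof :: "real \<Rightarrow> real" where
  "prof u = (if \<bar>u\<bar> \<le> a then cos (\<omega> * (min u (a - 1) + a) + \<beta>)
     + \<sigma> * (sin (\<omega> * (max u (1 - a) + a - 1) + \<beta>) - sin \<beta>) else 0)"

lemma end_angle: "\<omega> * (a - 1 + a) + \<beta> = pi / 2 - \<beta>"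
  using angle by (simp add: algebra_simps)

lemma cos_end: "cos (\<omega> * (a - 1 + a) + \<beta>) = sin \<beta>"
  unfolding end_angle by (simp add: cos_diff)

lemma sin_end: "sin (\<omega> * (a - 1 + a) + \<beta>) = cos \<beta>"
  unfolding end_angle by (simp add: sin_diff)

lemma prof_outside: "\<bar>u\<bar> > a \<Longrightarrow> prof u = 0"
  by (simp add: prof_def)

lemma prof_left: "-a \<le> u \<Longrightarrow> u \<le> a - 1 \<Longrightarrow> prof u = cos (\<omega> * (u + a) + \<beta>)"
  using a by (simp add: prof_def min_def max_def)

lemma prof_middle: "a - 1 \<le> u \<Longrightarrow> u \<le> 1 - a \<Longrightarrow> prof u = sin \<beta>"
proof -
  assume u: "a - 1 \<le> u" "u \<le> 1 - a"
  then have "\<bar>u\<bar> \<le> a" "min u (a - 1) = a - 1" "max u (1 - a) = 1 - a" using a by auto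
  then show ?thesis by (simp only: prof_def if_True cos_end) simp
qed

lemma prof_right: "1 - a \<le> u \<Longrightarrow> u \<le> a \<Longrightarrow> prof u = \<sigma> * sin (\<omega> * (u + a - 1) + \<beta>)"
proof -
  assume u: "1 - a \<le> u" "u \<le> a"
  then have "\<bar>u\<bar> \<le> a" "min u (a - 1) = a - 1" "max u (1 - a) = u" using a by auto
  then show ?thesis using \<sigma> cos_end by (auto simp: prof_def)
qed

lemma prof_region:
  assumes "\<bar>u\<bar> \<le> a"
  obtains "-a \<le> u" "u \<le> a - 1" | "a - 1 \<le> u" "u \<le> 1 - a" | "1 - a \<le> u" "u \<le> a"
  using assms by (cases "u \<le> a - 1"; cases "u \<le> 1 - a") auto

lemma measurable_prof [measurable]: "prof \<in> borel_measurable borel"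
  unfolding prof_def by measurable

lemma continuous_prof: "continuous_on {-a..a} prof"
proof -
  have "continuous_on {-a..a} (\<lambda>u. cos (\<omega> * (min u (a - 1) + a) + \<beta>)
     + \<sigma> * (sin (\<omega> * (max u (1 - a) + a - 1) + \<beta>) - sin \<beta>))"
    by (intro continuous_intros)
  then show ?thesis
    by (rule continuous_on_eq) (auto simp: prof_def)
qed

lemma abs_prof_le: "\<bar>prof u\<bar> \<le> 1"
proof (cases "\<bar>u\<bar> \<le> a")
  case True
  then show ?thesis
    by (cases rule: prof_region) (use \<sigma> in \<open>auto simp: prof_left prof_middle prof_right\<close>)
qed (simp add: prof_def)

lemma bandlimit_prof: "bandlimit a (\<lambda>u. complex_of_real (prof u))"
  unfolding bandlimit_def
  using prof_outside abs_prof_le by (auto intro!: exI[of _ 1])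

lemma integrable_prof: "integrable lborel prof"
  by (rule Bochner_Integration.integrable_bound[OF integrable_indicator_interval[of 1 "-a" a]])
    (use prof_outside abs_prof_le in \<open>auto simp: indicator_def abs_le_iff not_le intro!: always_eventually\<close>)

lemma integral_prof_right:
  assumes "1 - a \<le> s" "s \<le> a"
  shows "(LINT u|lborel. prof u * indicator {s..a} u) = \<sigma> * (cos (\<omega> * (s + a - 1) + \<beta>) - sin \<beta>) / \<omega>"
proof -
  let ?F = "\<lambda>u. - \<sigma> * cos (\<omega> * (u + a - 1) + \<beta>) / \<omega>"
  have "(LINT u|lborel. prof u * indicator {s..a} u) = (LINT u|lborel. (\<sigma> * sin (\<omega> * (u + a - 1) + \<beta>)) * indicator {s..a} u)"
    using assms by (intro Bochner_Integration.integral_cong) (auto simp: indicator_def prof_right)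
  also have "\<dots> = ?F a - ?F s"
  proof (rule integral_FTC_Icc_real)
    show "DERIV ?F u :> \<sigma> * sin (\<omega> * (u + a - 1) + \<beta>)" for u
      using \<omega> by (auto intro!: derivative_eq_intros)
  qed (use assms in \<open>auto intro!: continuous_intros\<close>)
  also have "a + a - 1 = a - 1 + a" by simp
  finally show ?thesis
    unfolding cos_end using \<omega> by (simp add: field_simps)
qed

lemma integral_prof_left:
  assumes "-a \<le> s" "s \<le> a - 1"
  shows "(LINT u|lborel. prof u * indicator {-a..s} u) = (sin (\<omega> * (s + a) + \<beta>) - sin \<beta>) / \<omega>"
proof -
  let ?F = "\<lambda>u. sin (\<omega> * (u + a) + \<beta>) / \<omega>"
  have "(LINT u|lborel. prof u * indicator {-a..s} u) = (LINT u|lborel. cos (\<omega> * (u + a) + \<beta>) * indicator {-a..s} u)"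
    using assms by (intro Bochner_Integration.integral_cong) (auto simp: indicator_def prof_left)
  also have "\<dots> = ?F s - ?F (-a)"
  proof (rule integral_FTC_Icc_real)
    show "DERIV ?F u :> cos (\<omega> * (u + a) + \<beta>)" for u
      using \<omega> by (auto intro!: derivative_eq_intros)
  qed (use assms in \<open>auto intro!: continuous_intros\<close>)
  finally show ?thesis using \<omega> by (simp add: field_simps)
qed

lemma integral_prof:
  "(LINT u|lborel. prof u) = (1 + \<sigma>) * (cos \<beta> - sin \<beta>) / \<omega> + (2 - 2 * a) * sin \<beta>"
proof -
  let ?A = "{-a..a-1}" and ?B = "{a-1..1-a}" and ?C = "{1-a..a}"
  have int: "integrable lborel (\<lambda>u. prof u * indicator {x..y} u)" for x y
    using integrable_mult_indicator[OF _ integrable_prof, of "{x..y}"] by (simp add: mult.commute)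
  have "(LINT u|lborel. prof u) = (LINT u|lborel. prof u * indicator ?A u + prof u * indicator ?B u + prof u * indicator ?C u)"
  proof (rule integral_cong_AE)
    show "AE u in lborel. prof u = prof u * indicator ?A u + prof u * indicator ?B u + prof u * indicator ?C u"
      using AE_lborel_singleton[of "a - 1"] AE_lborel_singleton[of "1 - a"]
    proof eventually_elim
      case (elim u)
      then show ?case using a by (cases "\<bar>u\<bar> > a") (auto simp: prof_outside indicator_def)
    qed
  qed measurable
  also have "\<dots> = (LINT u|lborel. prof u * indicator ?A u) + (LINT u|lborel. prof u * indicator ?B u) + (LINT u|lborel. prof u * indicator ?C u)"
    by (simp only: Bochner_Integration.integral_add Bochner_Integration.integrable_add int)
  also have "(LINT u|lborel. prof u * indicator ?B u) = (LINT u|lborel. sin \<beta> * indicator ?B u)"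
    by (intro Bochner_Integration.integral_cong) (auto simp: indicator_def prof_middle)
  also have "\<dots> = (2 - 2 * a) * sin \<beta>"
    using a by (simp add: algebra_simps)
  also have "(LINT u|lborel. prof u * indicator ?A u) = (cos \<beta> - sin \<beta>) / \<omega>"
  proof -
    have "(LINT u|lborel. prof u * indicator ?A u) = (sin (\<omega> * (a - 1 + a) + \<beta>) - sin \<beta>) / \<omega>"
      by (rule integral_prof_left) (use a in auto)
    then show ?thesis by (simp only: sin_end)
  qed
  also have "(LINT u|lborel. prof u * indicator ?C u) = \<sigma> * (cos \<beta> - sin \<beta>) / \<omega>"
    using a by (subst integral_prof_right) auto
  finally show ?thesis by (simp add: add_divide_distrib diff_divide_distrib algebra_simps)
qed

text \<open>The points of the band at distance more than 1 from \<open>t\<close> fill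
  \<open>[t+1, a]\<close> for \<open>t\<close> on the left and \<open>[-a, t-1]\<close> for
  \<open>t\<close> on the right, up to endpoints; in the middle there are none. Integrating the sine
  piece from \<open>t + 1\<close> returns the cosine piece at \<open>t\<close>, and conversely, up
  to the boundary value \<open>sin \<beta>\<close>. So \<open>prof\<close> is an eigenfunction up to
  an additive constant, which for \<open>c = 1\<close> disappears exactly when its integral is
  \<open>\<sigma> * sin \<beta> / \<omega>\<close>.\<close>

theorem kern_prof:
  assumes t: "\<bar>t\<bar> \<le> a" and c: "1/2 \<le> c" "c \<le> 1"
  shows "(LINT u|lborel. kern c t u * prof u) = (c - 1/2) * (LINT u|lborel. prof u) + \<sigma> * (prof t - sin \<beta>) / (2 * \<omega>)"
proof -
  let ?rest = "\<lambda>u. (1 - indicator {t-1..t+1} u) * prof u"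
  have int: "integrable lborel ?rest"
    by (rule integrable_mult_bounded[OF integrable_prof, where B = 1]) (auto simp: indicator_def)
  have "(LINT u|lborel. kern c t u * prof u) = (LINT u|lborel. (c - 1/2) * prof u + 1/2 * ?rest u)"
    by (intro Bochner_Integration.integral_cong) (auto simp: kern_def algebra_simps)
  also have "\<dots> = (c - 1/2) * (LINT u|lborel. prof u) + 1/2 * (LINT u|lborel. ?rest u)"
    using int integrable_prof by (subst Bochner_Integration.integral_add) auto
  also have "(LINT u|lborel. ?rest u) = \<sigma> * (prof t - sin \<beta>) / \<omega>"
    using t
  proof (cases rule: prof_region)
    case 1
    have "(LINT u|lborel. ?rest u) = (LINT u|lborel. prof u * indicator {t+1..a} u)"
    proof (rule integral_cong_AE)
      show "AE u in lborel. ?rest u = prof u * indicator {t+1..a} u"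
        using AE_lborel_singleton[of "t+1"]
      proof eventually_elim
        case (elim u)
        then show ?case using a 1 by (cases "\<bar>u\<bar> > a") (auto simp: prof_outside indicator_def)
      qed
    qed measurable
    also have "\<dots> = \<sigma> * (prof t - sin \<beta>) / \<omega>"
      using 1 by (subst integral_prof_right) (auto simp: prof_left)
    finally show ?thesis .
  next
    case 2
    have "?rest u = 0" for u
      using a 2 by (cases "\<bar>u\<bar> > a") (auto simp: prof_outside indicator_def)
    then have "(LINT u|lborel. ?rest u) = (LINT (u::real)|lborel. 0)" by (simp only:)
    then show ?thesis using 2 by (simp add: prof_middle)
  next
    case 3
    have "(LINT u|lborel. ?rest u) = (LINT u|lborel. prof u * indicator {-a..t-1} u)"
    proof (rule integral_cong_AE)
      show "AE u in lborel. ?rest u = prof u * indicator {-a..t-1} u"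
        using AE_lborel_singleton[of "t-1"]
      proof eventually_elim
        case (elim u)
        then show ?case using a 3 by (cases "\<bar>u\<bar> > a") (auto simp: prof_outside indicator_def)
      qed
    qed measurable
    also have "\<dots> = \<sigma> * (prof t - sin \<beta>) / \<omega>"
      using 3 \<sigma> by (subst integral_prof_left) (auto simp: prof_right algebra_simps)
    finally show ?thesis .
  qed
  finally show ?thesis by (simp add: mult.commute)
qed

text \<open>On each outer part the argument stays in the first quadrant, which is why the cosine and
  sine pieces are nonnegative.\<close>

lemma angle_range:
  assumes "0 \<le> x" "x \<le> 2 * a - 1"
  shows "0 \<le> \<omega> * x + \<beta>" "\<omega> * x + \<beta> \<le> pi / 2 - \<beta>"
proof -
  show "0 \<le> \<omega> * x + \<beta>" using assms \<omega> \<beta> by simp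
  have "\<omega> * x \<le> \<omega> * (2 * a - 1)" using assms \<omega> by (intro mult_left_mono) auto
  then show "\<omega> * x + \<beta> \<le> pi / 2 - \<beta>" using angle by linarith
qed

lemma \<beta>_le: "\<beta> \<le> pi / 4"
proof -
  have "\<omega> * (2 * a - 1) \<ge> 0" using \<omega> a by simp
  then show ?thesis using angle by linarith
qed

lemma prof_nonneg:
  assumes "\<sigma> = 1"
  shows "0 \<le> prof u"
proof (cases "\<bar>u\<bar> \<le> a")
  case True
  then show ?thesis
  proof (cases rule: prof_region)
    case 1
    then show ?thesis
      unfolding prof_left[OF 1] using angle_range[of "u + a"] \<beta> pi_gt_zero by (intro cos_ge_zero) auto
  next
    case 2
    then show ?thesis
      unfolding prof_middle[OF 2] using \<beta> \<beta>_le pi_gt_zero by (intro sin_ge_zero) auto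
  next
    case 3
    have "0 \<le> sin (\<omega> * (u + a - 1) + \<beta>)"
      using 3 angle_range[of "u + a - 1"] \<beta> pi_gt_zero by (intro sin_ge_zero) auto
    then show ?thesis
      by (subst prof_right[OF 3]) (simp add: assms(1))
  qed
qed (simp add: prof_def)

lemma prof_pos:
  assumes "\<sigma> = 1" "\<beta> > 0" "\<bar>u\<bar> \<le> a"
  shows "0 < prof u"
  using assms(3)
proof (cases rule: prof_region)
  case 1
  then show ?thesis
    unfolding prof_left[OF 1] using angle_range[of "u + a"] assms(2) pi_gt_zero by (intro cos_gt_zero_pi) auto
next
  case 2
  then show ?thesis
    unfolding prof_middle[OF 2] using assms(2) \<beta>_le pi_gt_zero by (intro sin_gt_zero) auto
next
  case 3
  then have "0 < \<omega> * (u + a - 1) + \<beta>" using assms \<omega> by (intro add_nonneg_pos) auto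
  then have "0 < sin (\<omega> * (u + a - 1) + \<beta>)"
    using 3 angle_range[of "u + a - 1"] assms pi_gt_zero by (intro sin_gt_zero) auto
  then show ?thesis
    by (subst prof_right[OF 3]) (simp add: assms(1))
qed

text \<open>For \<open>\<beta> = 0\<close> the profile vanishes on the whole middle part, but a
  point with a partner in the band at distance more than 1 lies strictly outside it.\<close>

lemma prof_pos_far:
  assumes "\<sigma> = 1" "\<beta> = 0" "\<bar>t\<bar> \<le> a" "\<bar>u\<bar> \<le> a" "kern (1/2) t u > 0"
  shows "0 < prof t"
proof -
  from assms(5) have far: "t + 1 < u \<or> u < t - 1"
    by (auto simp: kern_def indicator_def split: if_splits)
  show ?thesis
  proof (cases "t + 1 < u")
    case True
    then have t: "t < a - 1" "-a \<le> t" using assms by auto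
    then have "\<omega> * (t + a) < \<omega> * (2 * a - 1)" using \<omega> by (intro mult_strict_left_mono) auto
    then have "0 < cos (\<omega> * (t + a) + \<beta>)"
      using t angle pi_gt_zero assms(2) angle_range(1)[of "t + a"] by (intro cos_gt_zero_pi) auto
    then show ?thesis
      using prof_left[of t] t by simp
  next
    case False
    then have t: "1 - a < t" "t \<le> a" using assms far by auto
    then have "0 < \<omega> * (t + a - 1)" using \<omega> by simp
    then have "0 < sin (\<omega> * (t + a - 1) + \<beta>)"
      using t angle_range[of "t + a - 1"] assms(2) pi_gt_zero by (intro sin_gt_zero) auto
    then show ?thesis
      using prof_right[of t] t assms(1) by (simp only: less_imp_le mult_1_left)
  qed
qed

text \<open>\<open>-1/2\<close> is the centre of the left part, where the argument of the cosine is
  \<open>pi/4\<close> whatever the parameters.\<close>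

lemma prof_norm_pos: "(LINT t|lborel. (norm (complex_of_real (prof t)))\<^sup>2) > 0"
proof (rule L2_norm_pos[OF bandlimit_prof continuous_on_of_real[OF continuous_prof], of "-1/2"])
  have "\<omega> * (-1/2 + a) + \<beta> = pi / 4" using angle by (simp add: algebra_simps)
  moreover have "prof (-1/2) = cos (\<omega> * (-1/2 + a) + \<beta>)" by (rule prof_left) (use a in auto)
  ultimately have "prof (-1/2) = sqrt 2 / 2" by (simp only: cos_45)
  then have "prof (-1/2) > 0" by (simp only:) simp
  then show "complex_of_real (prof (-1/2)) \<noteq> 0" by simp
qed (use a in auto)

lemma upper_form_bound:
  assumes f: "bandlimit a f" and "\<sigma> = 1" "\<beta> > 0" and eig: "(LINT u|lborel. prof u) = sin \<beta> / \<omega>"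
  shows "form f \<le> 1 / (2 * \<omega>) * (LINT t|lborel. (norm (f t))\<^sup>2)"
proof -
  have "norm (LINT t|lborel. f t * cnj (LINT u|lborel. complex_of_real (kern 1 t u) * f u)) \<le> 1 / (2 * \<omega>) * (LINT t|lborel. (norm (f t))\<^sup>2)"
  proof (rule schur_test[OF f, where \<phi> = prof])
    show "(LINT u|lborel. kern 1 t u * prof u) \<le> 1 / (2 * \<omega>) * prof t" if "\<bar>t\<bar> \<le> a" for t
    proof -
      have "\<sigma> * x = x" for x using assms(2) by simp
      then have "(LINT u|lborel. kern 1 t u * prof u) = (1 - 1/2) * (sin \<beta> / \<omega>) + (prof t - sin \<beta>) / (2 * \<omega>)"
        using kern_prof[OF that, of 1] by (simp only: eig)
      then show ?thesis using \<omega> by (simp add: field_simps)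
    qed
    show "prof u \<le> 1" for u using abs_prof_le[of u] by linarith
    show "0 \<le> prof u" for u by (rule prof_nonneg[OF assms(2)])
    show "0 < prof t" if "\<bar>t\<bar> \<le> a" for t by (rule prof_pos[OF assms(2,3) that])
  qed (use \<omega> in \<open>simp_all add: prof_outside\<close>)
  then show ?thesis
    unfolding form_kernel[OF f, of 1, simplified] using complex_Re_le_cmod order_trans by blast
qed

text \<open>The remainder of the splitting with \<open>c = 1/2\<close> is dropped. Nothing is lost,
  because the profile with \<open>\<sigma> = -1\<close> has integral 0.\<close>

lemma lower_form_bound:
  assumes f: "bandlimit a f" and "\<sigma> = 1" "\<beta> = 0"
  shows "- 1 / (2 * \<omega>) * (LINT t|lborel. (norm (f t))\<^sup>2) \<le> form f"
proof -
  let ?L = "LINT t|lborel. f t * cnj (LINT u|lborel. complex_of_real (kern (1/2) t u) * f u)"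
  have "norm ?L \<le> 1 / (2 * \<omega>) * (LINT t|lborel. (norm (f t))\<^sup>2)"
  proof (rule schur_test[OF f, where \<phi> = prof])
    show "(LINT u|lborel. kern (1/2) t u * prof u) \<le> 1 / (2 * \<omega>) * prof t" if "\<bar>t\<bar> \<le> a" for t
    proof -
      have "\<sigma> * x = x" for x using assms(2) by simp
      moreover have "sin \<beta> = 0" using assms(3) by simp
      ultimately have "(LINT u|lborel. kern (1/2) t u * prof u) = (1/2 - 1/2) * (LINT u|lborel. prof u) + (prof t - 0) / (2 * \<omega>)"
        using kern_prof[OF that, of "1/2"] by (simp only:)
      then show ?thesis by simp
    qed
    show "prof u \<le> 1" for u using abs_prof_le[of u] by linarith
    show "0 \<le> prof u" for u by (rule prof_nonneg[OF assms(2)])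
    show "0 < prof t" if "\<bar>t\<bar> \<le> a" "\<bar>u\<bar> \<le> a" "kern (1/2) t u > 0" for t u
      by (rule prof_pos_far[OF assms(2,3) that])
  qed (use \<omega> in \<open>simp_all add: prof_outside\<close>)
  moreover have "- norm ?L \<le> Re ?L" using abs_Re_le_cmod[of ?L] by linarith
  moreover have "form f = 1/2 * (norm (LINT t|lborel. f t))\<^sup>2 + Re ?L"
    using form_kernel[OF f, of "1/2"] by simp
  moreover have "1/2 * (norm (LINT t|lborel. f t))\<^sup>2 \<ge> 0" by simp
  ultimately show ?thesis by linarith
qed

text \<open>For \<open>\<sigma> = 1\<close> the assumption is the transcendental equation in
  disguise; for \<open>\<sigma> = -1\<close>, where \<open>\<beta> = 0\<close>, it says that the
  integral vanishes.\<close>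

lemma form_prof:
  assumes "(LINT u|lborel. prof u) = \<sigma> * sin \<beta> / \<omega>"
  shows "form (\<lambda>t. complex_of_real (prof t)) = \<sigma> / (2 * \<omega>) * (LINT t|lborel. (norm (complex_of_real (prof t)))\<^sup>2)"
proof (rule form_eigenfunction[OF bandlimit_prof])
  show "(LINT u|lborel. kern 1 t u * prof u) = \<sigma> / (2 * \<omega>) * prof t" if "\<bar>t\<bar> \<le> a" for t
    unfolding kern_prof[OF that, of 1, simplified] assms using \<omega> by (simp add: field_simps)
qed

end

text \<open>The form bounds hold throughout \<open>PW\<close> by approximation, and functions
  attaining them that are continuous on the closed band transform into members of \<open>PW\<close>.
  Hence infimum and supremum are a minimum and a maximum.\<close>

theorem extremal_ratios:
  assumes "a > 0"
    and lo: "\<And>f. bandlimit a f \<Longrightarrow> lo * (LINT t|lborel. (norm (f t))\<^sup>2) \<le> form f"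
    and up: "\<And>f. bandlimit a f \<Longrightarrow> form f \<le> up * (LINT t|lborel. (norm (f t))\<^sup>2)"
    and f: "bandlimit a f" "continuous_on {-a..a} f" "(LINT t|lborel. (norm (f t))\<^sup>2) > 0"
      "form f = lo * (LINT t|lborel. (norm (f t))\<^sup>2)"
    and g: "bandlimit a g" "continuous_on {-a..a} g" "(LINT t|lborel. (norm (g t))\<^sup>2) > 0"
      "form g = up * (LINT t|lborel. (norm (g t))\<^sup>2)"
  shows "C_minus (2 * a) = sqrt (1 + lo)" and "C_plus (2 * a) = sqrt (1 + up)"
proof -
  have PW: "PW (pi * (2 * a)) = PW (2 * pi * a)" by (simp add: mult_ac)
  have bounds: "sqrt (1 + lo) \<le> r \<and> r \<le> sqrt (1 + up)" if r: "r \<in> ratios (2 * a)" for r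
  proof -
    obtain F where F: "F \<in> PW (2 * pi * a)" "F \<noteq> (\<lambda>_. 0)" and r: "r = sqrt (LW_sq F) / sqrt (L2_sq F)"
      using r unfolding ratios_def PW by blast
    have "L2_sq F > 0" by (rule L2_sq_pos[OF F])
    moreover have "(1 + lo) * L2_sq F \<le> LW_sq F" "LW_sq F \<le> (1 + up) * L2_sq F"
      by (rule PW_form_bounds[where lo = lo and up = up, OF \<open>a > 0\<close> F(1)], erule lo, erule up)+
    ultimately have "1 + lo \<le> LW_sq F / L2_sq F" "LW_sq F / L2_sq F \<le> 1 + up"
      by (simp_all add: field_simps)
    then show ?thesis
      unfolding r real_sqrt_divide[symmetric] by simp
  qed
  have attained: "sqrt (1 + l) \<in> ratios (2 * a)"
    if h: "bandlimit a h" "continuous_on {-a..a} h" "(LINT t|lborel. (norm (h t))\<^sup>2) > 0"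
      "form h = l * (LINT t|lborel. (norm (h t))\<^sup>2)" for h l
  proof -
    note norms = norms_of_transform[OF h(1) AE_isCont_bandlimit[OF h(1,2)], of "ft h", OF ft_of_real]
    have pos: "L2_sq (ft h) > 0" using norms(1) h(3) by simp
    have "ft h \<in> PW (pi * (2 * a))"
      unfolding PW using ft_in_PW[OF h(1,2)] \<open>a > 0\<close> by simp
    moreover have "ft h \<noteq> (\<lambda>_. 0)"
    proof
      assume "ft h = (\<lambda>_. 0)"
      then show False using pos by (simp add: L2_sq_def)
    qed
    moreover have "LW_sq (ft h) / L2_sq (ft h) = 1 + l"
    proof -
      have "LW_sq (ft h) = (1 + l) * L2_sq (ft h)"
        unfolding norms(2) h(4) norms(1) by (simp add: algebra_simps)
      then show ?thesis using pos by simp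
    qed
    then have "sqrt (1 + l) = sqrt (LW_sq (ft h)) / sqrt (L2_sq (ft h))"
      by (simp add: real_sqrt_divide[symmetric])
    ultimately show ?thesis unfolding ratios_def by blast
  qed
  show "C_minus (2 * a) = sqrt (1 + lo)"
    unfolding C_minus_def using attained[OF f] bounds by (intro cInf_eq_minimum) auto
  show "C_plus (2 * a) = sqrt (1 + up)"
    unfolding C_plus_def using attained[OF g] bounds by (intro cSup_eq_maximum) auto
qed

section \<open>Bandwidth at most one\<close>

lemma bandlimit_real_indicator:
  fixes g :: "real \<Rightarrow> real"
  assumes "continuous_on {-a..a} g"
  shows "bandlimit a (\<lambda>t. complex_of_real (g t * indicator {-a..a} t))"
    and "continuous_on {-a..a} (\<lambda>t. complex_of_real (g t * indicator {-a..a} t))"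
proof -
  have "bounded (g ` {-a..a})"
    using assms by (intro compact_imp_bounded compact_continuous_image) auto
  then obtain M where M: "\<And>t. t \<in> {-a..a} \<Longrightarrow> \<bar>g t\<bar> \<le> M"
    unfolding bounded_iff real_norm_def by blast
  have "norm (complex_of_real (g t * indicator {-a..a} t)) \<le> max M 0" for t
  proof (cases "t \<in> {-a..a}")
    case True
    then show ?thesis using M[OF True] by (simp add: norm_mult le_max_iff_disj)
  qed simp
  moreover have "(\<lambda>t. indicator {-a..a} t *\<^sub>R g t) \<in> borel_measurable borel"
    using assms by (intro borel_measurable_continuous_on_indicator) auto
  then have "(\<lambda>t. g t * indicator {-a..a} t) \<in> borel_measurable borel"
    by (simp add: mult.commute)
  then have "(\<lambda>t. complex_of_real (g t * indicator {-a..a} t)) \<in> borel_measurable borel"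
    by measurable
  ultimately show "bandlimit a (\<lambda>t. complex_of_real (g t * indicator {-a..a} t))"
    unfolding bandlimit_def by (intro conjI exI[of _ "max M 0"]) (auto simp: indicator_def)
  have "continuous_on {-a..a} (\<lambda>t. complex_of_real (g t))"
    using assms by (rule continuous_on_of_real)
  then show "continuous_on {-a..a} (\<lambda>t. complex_of_real (g t * indicator {-a..a} t))"
    by (rule continuous_on_eq) simp
qed

lemma kern_short:
  assumes "a \<le> 1/2" "\<bar>t\<bar> \<le> a" "\<bar>u\<bar> \<le> a"
  shows "kern c t u = c - 1/2"
proof -
  have "u \<in> {t-1..t+1}" using assms by auto
  then show ?thesis by (simp add: kern_def)
qed

lemma kern_short_integral:
  assumes "a \<le> 1/2" "\<bar>t\<bar> \<le> a"
  shows "(LINT u|lborel. kern c t u * (g u * indicator {-a..a} u)) = (c - 1/2) * (LINT u|lborel. g u * indicator {-a..a} u)"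
proof -
  have "kern c t u * (g u * indicator {-a..a} u) = (c - 1/2) * (g u * indicator {-a..a} u)" for u
    using kern_short[OF assms, of u c] by (cases "\<bar>u\<bar> \<le> a") (auto simp: abs_le_iff)
  then show ?thesis by (simp only: integral_mult_right_zero)
qed

text \<open>No two points of the band are more than 1 apart, so for \<open>c = 1\<close> the kernel
  is the constant 1/2 and its operator has rank one: constants have eigenvalue \<open>a\<close>,
  half the length of the band, and functions of mean zero have eigenvalue 0. The odd function
  \<open>t\<close> represents the latter.\<close>

lemma ratios_short:
  assumes a: "0 < a" "a \<le> 1/2"
  shows "C_minus (2 * a) = 1" and "C_plus (2 * a) = sqrt (1 + a)"
proof -
  have one: "continuous_on {-a..a} (\<lambda>t. 1 :: real)" and id: "continuous_on {-a..a} (\<lambda>t. t :: real)"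
    by (auto intro: continuous_intros)
  let ?c = "\<lambda>t. complex_of_real (1 * indicator {-a..a} t)"
  let ?x = "\<lambda>t. complex_of_real (t * indicator {-a..a} t)"
  have c_int: "(LINT u|lborel. 1 * indicator {-a..a} u) = 2 * a"
    using a by simp
  have x_int: "(LINT u|lborel. u * indicator {-a..a} u) = (0::real)"
    using integral_power[of "-a" a 1] a by simp
  have lo: "0 * (LINT t|lborel. (norm (f t))\<^sup>2) \<le> form f" if f: "bandlimit a f" for f
  proof -
    have "f t * cnj (LINT u|lborel. complex_of_real (kern (1/2) t u) * f u) = 0" for t
    proof (cases "\<bar>t\<bar> \<le> a")
      case True
      have "complex_of_real (kern (1/2) t u) * f u = 0" for u
      proof (cases "\<bar>u\<bar> \<le> a")
        case True
        then show ?thesis using kern_short[OF a(2) \<open>\<bar>t\<bar> \<le> a\<close> True, of "1/2"] by simp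
      next
        case False
        then show ?thesis using f by (simp add: bandlimit_def)
      qed
      then have "(LINT u|lborel. complex_of_real (kern (1/2) t u) * f u) = (LINT (u::real)|lborel. 0)" by (simp only:)
      then show ?thesis by simp
    next
      case False
      then show ?thesis using f by (simp add: bandlimit_def)
    qed
    then have "(LINT t|lborel. f t * cnj (LINT u|lborel. complex_of_real (kern (1/2) t u) * f u)) = (LINT (t::real)|lborel. 0)"
      by (simp only:)
    then have "form f = (1 - 1/2) * (norm (LINT t|lborel. f t))\<^sup>2"
      using form_kernel[OF f, of "1/2"] by simp
    then show ?thesis by (simp only: mult_zero_left) simp
  qed
  have up: "form f \<le> a * (LINT t|lborel. (norm (f t))\<^sup>2)" if f: "bandlimit a f" for f
  proof -
    have "norm (LINT t|lborel. f t * cnj (LINT u|lborel. complex_of_real (kern 1 t u) * f u)) \<le> a * (LINT t|lborel. (norm (f t))\<^sup>2)"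
    proof (rule schur_test[OF f, where \<phi> = "\<lambda>u. 1 * indicator {-a..a} u"])
      show "(LINT u|lborel. kern 1 t u * (1 * indicator {-a..a} u)) \<le> a * (1 * indicator {-a..a} t)" if "\<bar>t\<bar> \<le> a" for t
      proof -
        have "t \<in> {-a..a}" using that by auto
        then show ?thesis unfolding kern_short_integral[OF a(2) that] c_int by simp
      qed
      show "0 < 1 * indicat_real {-a..a} t" if "\<bar>t\<bar> \<le> a" for t
        using that by (auto simp: indicator_def)
      show "1 * indicat_real {-a..a} u = 0" if "\<bar>u\<bar> > a" for u
        using that by (auto simp: indicator_def)
    qed (use a in \<open>simp_all add: indicator_le_1\<close>)
    then show ?thesis
      unfolding form_kernel[OF f, of 1, simplified] using complex_Re_le_cmod order_trans by blast
  qed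
  have c_form: "form ?c = a * (LINT t|lborel. (norm (?c t))\<^sup>2)"
  proof (rule form_eigenfunction[OF bandlimit_real_indicator(1)[OF one]])
    show "(LINT u|lborel. kern 1 t u * (1 * indicator {-a..a} u)) = a * (1 * indicator {-a..a} t)" if "\<bar>t\<bar> \<le> a" for t
    proof -
      have "t \<in> {-a..a}" using that by auto
      then show ?thesis unfolding kern_short_integral[OF a(2) that] c_int by simp
    qed
  qed
  have x_form: "form ?x = 0 * (LINT t|lborel. (norm (?x t))\<^sup>2)"
  proof (rule form_eigenfunction[OF bandlimit_real_indicator(1)[OF id]])
    show "(LINT u|lborel. kern 1 t u * (u * indicator {-a..a} u)) = 0 * (t * indicator {-a..a} t)" if "\<bar>t\<bar> \<le> a" for t
      unfolding kern_short_integral[OF a(2) that] x_int by simp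
  qed
  have c_pos: "(LINT t|lborel. (norm (?c t))\<^sup>2) > 0"
    by (rule L2_norm_pos[OF bandlimit_real_indicator[OF one], of 0]) (use a in auto)
  have x_pos: "(LINT t|lborel. (norm (?x t))\<^sup>2) > 0"
    by (rule L2_norm_pos[OF bandlimit_real_indicator[OF id], of "a/2"]) (use a in auto)
  have "C_minus (2 * a) = sqrt (1 + 0)"
    by (rule extremal_ratios(1)[where lo = 0 and up = a and f = ?x and g = ?c])
      (fact a lo up bandlimit_real_indicator[OF id] x_pos x_form bandlimit_real_indicator[OF one] c_pos c_form)+
  then show "C_minus (2 * a) = 1" by simp
  show "C_plus (2 * a) = sqrt (1 + a)"
    by (rule extremal_ratios(2)[where lo = 0 and up = a and f = ?x and g = ?c])
      (fact a lo up bandlimit_real_indicator[OF id] x_pos x_form bandlimit_real_indicator[OF one] c_pos c_form)+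
qed

section \<open>The transcendental equation\<close>

text \<open>In this form the equation depends on eta only through
  \<open>\<theta> = (\<Delta> - 1) / (2 * \<eta>)\<close> and makes sense, continuously, at
  \<open>\<theta> = 0\<close>.\<close>

lemma eta_solution_iff:
  assumes "\<Delta> > 1"
  shows "eta_solution \<Delta> \<eta> \<longleftrightarrow> \<eta> \<noteq> 0 \<and>
    (3/2 - (2 - \<Delta>) / (2 * (\<Delta> - 1)) * ((\<Delta> - 1) / (2 * \<eta>))) * cos ((\<Delta> - 1) / (2 * \<eta>)) - sin ((\<Delta> - 1) / (2 * \<eta>)) = 1"
proof -
  have "(2 - \<Delta>) / (2 * (\<Delta> - 1)) * ((\<Delta> - 1) / (2 * \<eta>)) = (2 - \<Delta>) / (4 * \<eta>)"
    using assms by (cases "\<eta> = 0") (auto simp: divide_simps)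
  then show ?thesis unfolding eta_solution_def by (simp only:)
qed

text \<open>With \<open>x = - (\<Delta> - 1) / (2 * \<eta>)\<close> the equation for negative eta
  reads \<open>(3/2 + k x) cos x + sin x = 1\<close> with \<open>k >= 0\<close>. On
  \<open>(0, pi/2)\<close> the left side exceeds \<open>cos x + sin x\<close>, which is at least 1,
  while \<open>x = pi/2\<close> is a solution; smaller positive \<open>x\<close> means smaller
  eta.\<close>

lemma smallest_eta_solution:
  assumes \<Delta>: "1 < \<Delta>" "\<Delta> \<le> 2"
  shows "eta_solution \<Delta> (- (\<Delta> - 1) / pi)" and "eta_solution \<Delta> \<eta> \<Longrightarrow> - (\<Delta> - 1) / pi \<le> \<eta>"
proof -
  have "(\<Delta> - 1) / (2 * (- (\<Delta> - 1) / pi)) = - (pi / 2)"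
    using \<Delta> by (simp add: field_simps)
  then show "eta_solution \<Delta> (- (\<Delta> - 1) / pi)"
    unfolding eta_solution_def using \<Delta> by simp
  show "- (\<Delta> - 1) / pi \<le> \<eta>" if sol: "eta_solution \<Delta> \<eta>"
  proof (rule ccontr)
    assume "\<not> - (\<Delta> - 1) / pi \<le> \<eta>"
    then have *: "\<Delta> - 1 < pi * (- \<eta>)" by (simp add: field_simps)
    have "\<eta> < 0"
    proof (rule ccontr)
      assume "\<not> \<eta> < 0"
      then have "pi * (- \<eta>) \<le> 0" by simp
      then show False using * \<Delta> by linarith
    qed
    define x where "x = (\<Delta> - 1) / (2 * (- \<eta>))"
    have x: "0 < x" "x < pi / 2"
      using * \<open>\<eta> < 0\<close> \<Delta> by (auto simp: x_def field_simps)
    have "(\<Delta> - 1) / (2 * \<eta>) = - x" by (simp add: x_def)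
    then have eq: "(3/2 + (2 - \<Delta>) / (2 * (\<Delta> - 1)) * x) * cos x + sin x = 1"
      using sol unfolding eta_solution_iff[OF \<Delta>(1)] by simp
    have pos: "cos x > 0" "sin x > 0"
      using x pi_gt_zero by (auto intro!: cos_gt_zero sin_gt_zero)
    have "1 = (sin x)\<^sup>2 + (cos x)\<^sup>2" by simp
    also have "\<dots> \<le> sin x + cos x"
      using pos sin_le_one[of x] cos_le_one[of x]
      by (intro add_mono) (auto simp: power2_eq_square intro: mult_left_le)
    also have "\<dots> < sin x + 3/2 * cos x" using pos by simp
    also have "\<dots> \<le> sin x + (3/2 + (2 - \<Delta>) / (2 * (\<Delta> - 1)) * x) * cos x"
      using \<Delta> x pos by (intro add_left_mono mult_right_mono) auto
    finally show False using eq by simp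
  qed
qed

text \<open>The solutions of \<open>q = c\<close> on the interval form a nonempty compact set, which
  has a least element.\<close>

lemma first_zero:
  fixes q :: "real \<Rightarrow> real"
  assumes "continuous_on {x..y} q" "x \<le> y" "q y \<le> c" "c \<le> q x"
  obtains z where "x \<le> z" "z \<le> y" "q z = c" "\<And>w. x \<le> w \<Longrightarrow> w < z \<Longrightarrow> q w \<noteq> c"
proof -
  let ?Z = "{x..y} \<inter> q -` {c}"
  have "closed ?Z"
    by (rule continuous_closed_preimage[OF assms(1)]) auto
  moreover have "{x..y} \<inter> ?Z = ?Z" by (simp only: Int_left_absorb)
  ultimately have "compact ?Z"
    using compact_Int_closed[OF compact_Icc, of ?Z x y] by (simp only:)
  obtain v where "x \<le> v" "v \<le> y" "q v = c"
    using IVT2'[OF assms(3,4,2,1)] by (elim exE conjE)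
  then have "v \<in> ?Z" by simp
  then have "?Z \<noteq> {}" by blast
  from compact_attains_inf[OF \<open>compact ?Z\<close> this]
  obtain z where z: "z \<in> ?Z" and least: "\<forall>w\<in>?Z. z \<le> w" by (elim bexE)
  have "q w \<noteq> c" if "x \<le> w" "w < z" for w
  proof
    assume "q w = c"
    then have "w \<in> ?Z" using that z by simp
    then have "z \<le> w" using least by (rule bspec[rotated])
    then show False using that by simp
  qed
  then show ?thesis using that[of z] z by simp
qed

text \<open>\<open>q\<close> is 3/2 at 0 and -1 at \<open>pi/2\<close>, so it takes the value 1 in
  between, and \<open>\<theta>\<close> is the first such point. Any positive solution eta
  corresponds to a point at or beyond \<open>\<theta>\<close>, possibly beyond \<open>pi/2\<close>,
  and is therefore no larger.\<close>

lemma largest_eta_solution: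
  assumes \<Delta>: "1 < \<Delta>" "\<Delta> \<le> 2"
  obtains \<theta> where "0 < \<theta>" "\<theta> < pi / 2" "eta_solution \<Delta> ((\<Delta> - 1) / (2 * \<theta>))"
    "(3/2 - (2 - \<Delta>) / (2 * (\<Delta> - 1)) * \<theta>) * cos \<theta> - sin \<theta> = 1"
    "\<And>\<eta>. eta_solution \<Delta> \<eta> \<Longrightarrow> \<eta> \<le> (\<Delta> - 1) / (2 * \<theta>)"
proof -
  define q where "q \<theta> = (3/2 - (2 - \<Delta>) / (2 * (\<Delta> - 1)) * \<theta>) * cos \<theta> - sin \<theta>" for \<theta>
  have cont: "continuous_on {0..pi/2} q" unfolding q_def by (intro continuous_intros)
  obtain \<theta> where \<theta>: "0 \<le> \<theta>" "\<theta> \<le> pi / 2" "q \<theta> = 1" and least: "\<And>w. 0 \<le> w \<Longrightarrow> w < \<theta> \<Longrightarrow> q w \<noteq> 1"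
    by (rule first_zero[OF cont, of 1]) (auto simp: q_def)
  have "q 0 \<noteq> 1" "q (pi / 2) \<noteq> 1" by (simp_all add: q_def)
  then have "\<theta> \<noteq> 0" "\<theta> \<noteq> pi / 2" using \<theta>(3) by metis+
  then have range: "0 < \<theta>" "\<theta> < pi / 2" using \<theta> by auto
  show ?thesis
  proof (rule that[OF range])
    have "(\<Delta> - 1) / (2 * ((\<Delta> - 1) / (2 * \<theta>))) = \<theta>"
      using \<Delta> range by (simp add: divide_simps)
    then show "eta_solution \<Delta> ((\<Delta> - 1) / (2 * \<theta>))"
      using \<theta>(3) \<Delta> range unfolding eta_solution_iff[OF \<Delta>(1)] q_def by simp
    show "(3/2 - (2 - \<Delta>) / (2 * (\<Delta> - 1)) * \<theta>) * cos \<theta> - sin \<theta> = 1"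
      using \<theta>(3) by (simp only: q_def)
    fix \<eta> assume sol: "eta_solution \<Delta> \<eta>"
    show "\<eta> \<le> (\<Delta> - 1) / (2 * \<theta>)"
    proof (cases "\<eta> > 0")
      case True
      have "q ((\<Delta> - 1) / (2 * \<eta>)) = 1"
        using sol unfolding eta_solution_iff[OF \<Delta>(1)] q_def by blast
      moreover have "0 \<le> (\<Delta> - 1) / (2 * \<eta>)" using True \<Delta> by simp
      ultimately have "\<theta> \<le> (\<Delta> - 1) / (2 * \<eta>)"
        using least by (meson not_le)
      then show ?thesis using True range by (simp add: field_simps)
    next
      case False
      have "0 \<le> (\<Delta> - 1) / (2 * \<theta>)" using \<Delta> range by simp
      then show ?thesis using False by linarith
    qed
  qed
qed

section \<open>Bandwidth between one and two\<close>

lemma ratios_long: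
  assumes \<Delta>: "1 < \<Delta>" "\<Delta> \<le> 2" and \<theta>: "0 < \<theta>" "\<theta> < pi / 2"
    and eq: "(3/2 - (2 - \<Delta>) / (2 * (\<Delta> - 1)) * \<theta>) * cos \<theta> - sin \<theta> = 1"
  shows "C_minus \<Delta> = sqrt (1 + - (\<Delta> - 1) / pi)" and "C_plus \<Delta> = sqrt (1 + (\<Delta> - 1) / (2 * \<theta>))"
proof -
  define a where "a = \<Delta> / 2"
  have a: "a > 0" "1/2 < a" "a \<le> 1" "2 * a = \<Delta>" "2 * a - 1 = \<Delta> - 1" using \<Delta> by (auto simp: a_def)
  \<comment> \<open>The parameters are dictated by \<open>angle\<close> with
    \<open>2 * a - 1 = \<Delta> - 1\<close>: \<open>\<omega>\<close> and \<open>\<beta>\<close> by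
    the phase \<open>\<theta> = \<omega> * (\<Delta> - 1)\<close>, and \<open>\<omega>'\<close> by
    the choice of 0 for the offset.\<close>
  define \<omega> where "\<omega> = \<theta> / (\<Delta> - 1)"
  define \<beta> where "\<beta> = (pi / 2 - \<theta>) / 2"
  define \<omega>' where "\<omega>' = pi / (2 * (\<Delta> - 1))"
  have \<omega>: "\<omega> > 0" "\<omega>' > 0" using \<theta> \<Delta> by (auto simp: \<omega>_def \<omega>'_def)
  have \<beta>: "\<beta> > 0" "\<beta> < pi / 2" using \<theta> by (auto simp: \<beta>_def)
  have angles: "\<omega> * (2 * a - 1) + 2 * \<beta> = pi / 2" "\<omega>' * (2 * a - 1) + 2 * 0 = pi / 2"
    using \<Delta> unfolding a(5) by (auto simp: \<omega>_def \<beta>_def \<omega>'_def field_simps)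
  interpret U: profile a \<omega> \<beta> 1
    by unfold_locales (use a \<omega> \<beta> angles in auto)
  interpret L: profile a \<omega>' 0 1
    by unfold_locales (use a \<omega> angles in auto)
  interpret O: profile a \<omega>' 0 "-1"
    by unfold_locales (use a \<omega> angles in auto)
  have half: "1 / (2 * \<omega>) = (\<Delta> - 1) / (2 * \<theta>)" "1 / (2 * \<omega>') = (\<Delta> - 1) / pi"
    using \<Delta> \<theta> by (auto simp: \<omega>_def \<omega>'_def divide_simps)
  \<comment> \<open>With \<open>\<theta> = pi/2 - 2 \<beta>\<close> the transcendental equation
    becomes \<open>2 (3/2 - (1 - a) \<omega>) sin \<beta> cos \<beta> = 2 (cos \<beta>)^2\<close>.
    Cancelling the positive factor \<open>2 cos \<beta>\<close> leaves the condition on the integral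
    of the profile.\<close>
  have eig: "(LINT u|lborel. U.prof u) = sin \<beta> / \<omega>"
  proof -
    have "\<theta> = pi / 2 - 2 * \<beta>" by (simp add: \<beta>_def diff_divide_distrib)
    then have cs: "cos \<theta> = 2 * sin \<beta> * cos \<beta>" "sin \<theta> = 2 * (cos \<beta>)\<^sup>2 - 1"
      by (simp_all add: cos_diff sin_diff sin_double cos_double_cos)
    have w: "(2 - \<Delta>) / (2 * (\<Delta> - 1)) * \<theta> = (1 - a) * \<omega>"
      by (simp add: \<omega>_def a_def field_simps)
    have "cos \<beta> * ((3/2 - (1 - a) * \<omega>) * sin \<beta>) = cos \<beta> * cos \<beta>"
      using eq unfolding w cs by (simp add: algebra_simps power2_eq_square)
    moreover have "cos \<beta> > 0" using \<beta> by (intro cos_gt_zero) auto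
    ultimately have "(3/2 - (1 - a) * \<omega>) * sin \<beta> = cos \<beta>" by simp
    then have "(1 + 1) * (cos \<beta> - sin \<beta>) / \<omega> + (2 - 2 * a) * sin \<beta> = sin \<beta> / \<omega>"
      using \<omega> by (simp add: field_simps)
    then show ?thesis unfolding U.integral_prof .
  qed
  have "(LINT u|lborel. O.prof u) = -1 * sin 0 / \<omega>'"
    unfolding O.integral_prof by simp
  note formO = O.form_prof[OF this]
  have formU: "form (\<lambda>t. complex_of_real (U.prof t)) = 1 / (2 * \<omega>) * (LINT t|lborel. (norm (complex_of_real (U.prof t)))\<^sup>2)"
    by (rule U.form_prof) (simp add: eig)
  have lo: "- 1 / (2 * \<omega>') * (LINT t|lborel. (norm (f t))\<^sup>2) \<le> form f" if "bandlimit a f" for f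
    by (rule L.lower_form_bound[OF that refl refl])
  have up: "form f \<le> 1 / (2 * \<omega>) * (LINT t|lborel. (norm (f t))\<^sup>2)" if "bandlimit a f" for f
    by (rule U.upper_form_bound[OF that refl \<beta>(1) eig])
  note facts = a(1) lo up
      O.bandlimit_prof continuous_on_of_real[OF O.continuous_prof] O.prof_norm_pos formO
      U.bandlimit_prof continuous_on_of_real[OF U.continuous_prof] U.prof_norm_pos formU
  have "- 1 / (2 * \<omega>') = - (\<Delta> - 1) / pi" using half(2) by (simp only: minus_divide_left[symmetric])
  moreover have "C_minus (2 * a) = sqrt (1 + - 1 / (2 * \<omega>'))"
    by (rule extremal_ratios(1)[where lo = "- 1 / (2 * \<omega>')" and up = "1 / (2 * \<omega>)"
        and f = "\<lambda>t. complex_of_real (O.prof t)" and g = "\<lambda>t. complex_of_real (U.prof t)"]) (fact facts)+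
  ultimately show "C_minus \<Delta> = sqrt (1 + - (\<Delta> - 1) / pi)" by (simp only: a(4))
  have "C_plus (2 * a) = sqrt (1 + 1 / (2 * \<omega>))"
    by (rule extremal_ratios(2)[where lo = "- 1 / (2 * \<omega>')" and up = "1 / (2 * \<omega>)"
        and f = "\<lambda>t. complex_of_real (O.prof t)" and g = "\<lambda>t. complex_of_real (U.prof t)"]) (fact facts)+
  then show "C_plus \<Delta> = sqrt (1 + (\<Delta> - 1) / (2 * \<theta>))" by (simp only: a(4) half(1))
qed

theorem theorem18:
  fixes \<Delta> :: real
  shows "(0 < \<Delta> \<and> \<Delta> \<le> 1 \<longrightarrow>
            C_minus \<Delta> = 1 \<and> C_plus \<Delta> = sqrt (1 + \<Delta> / 2))
       \<and> (1 < \<Delta> \<and> \<Delta> \<le> 2 \<longrightarrow>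
            (\<exists>\<eta>p \<eta>m. eta_solution \<Delta> \<eta>p \<and> (\<forall>\<eta>. eta_solution \<Delta> \<eta> \<longrightarrow> \<eta> \<le> \<eta>p)
                    \<and> eta_solution \<Delta> \<eta>m \<and> (\<forall>\<eta>. eta_solution \<Delta> \<eta> \<longrightarrow> \<eta>m \<le> \<eta>)
                    \<and> C_minus \<Delta> = sqrt (1 + \<eta>m) \<and> C_plus \<Delta> = sqrt (1 + \<eta>p)))"
proof (intro conjI impI)
  assume "0 < \<Delta> \<and> \<Delta> \<le> 1"
  then show "C_minus \<Delta> = 1" "C_plus \<Delta> = sqrt (1 + \<Delta> / 2)"
    using ratios_short[of "\<Delta> / 2"] by auto
next
  assume "1 < \<Delta> \<and> \<Delta> \<le> 2"
  then have \<Delta>: "1 < \<Delta>" "\<Delta> \<le> 2" by auto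
  obtain \<theta> where \<theta>: "0 < \<theta>" "\<theta> < pi / 2" and sol: "eta_solution \<Delta> ((\<Delta> - 1) / (2 * \<theta>))"
    and eq: "(3/2 - (2 - \<Delta>) / (2 * (\<Delta> - 1)) * \<theta>) * cos \<theta> - sin \<theta> = 1"
    and greatest: "\<And>\<eta>. eta_solution \<Delta> \<eta> \<Longrightarrow> \<eta> \<le> (\<Delta> - 1) / (2 * \<theta>)"
    by (rule largest_eta_solution[OF \<Delta>]) blast
  show "\<exists>\<eta>p \<eta>m. eta_solution \<Delta> \<eta>p \<and> (\<forall>\<eta>. eta_solution \<Delta> \<eta> \<longrightarrow> \<eta> \<le> \<eta>p)
                    \<and> eta_solution \<Delta> \<eta>m \<and> (\<forall>\<eta>. eta_solution \<Delta> \<eta> \<longrightarrow> \<eta>m \<le> \<eta>)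
                    \<and> C_minus \<Delta> = sqrt (1 + \<eta>m) \<and> C_plus \<Delta> = sqrt (1 + \<eta>p)"
    by (intro exI[of _ "(\<Delta> - 1) / (2 * \<theta>)"] exI[of _ "- (\<Delta> - 1) / pi"] conjI allI impI
        sol greatest smallest_eta_solution[OF \<Delta>] ratios_long[OF \<Delta> \<theta> eq])
qed

end
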